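(* Let $d,L$ be positive integers and let $\widehat F^d_L\in\mathbb{R}^{N^{(d)}_L\times N^{(d)}_L}$ be the square zero-padded modified BPX preconditioner. Then one can implement an $\left(L\,2^{dL/2},\ \mathrm{poly}(L),\ 0\right)$-block encoding of $\widehat F^d_L$ (embedded as the top-left block of an otherwise zero matrix of power-of-two dimension) using $\mathrm{poly}(dL)$ one- and two-qubit gates and ancillas.
   Context: Block encoding: an $(s+q)$-qubit unitary $U$ is an $(\alpha,q,\epsilon)$-block encoding of an $s$-qubit operator $A$ if $\|A-\alpha(\langle 0|^{\otimes q}\otimes I)U(|0\rangle^{\otimes q}\otimes I)\|\le\epsilon$. One- and two-qubit gates are assumed to be implemented perfectly. Notation: $n_l^d=(2^l-1)^d$ and $N_L^{(d)}=\sum_{l=1}^L n_l^d$. Nodal basis: for $h$ with $1/h\in\mathbb{N}$ and $m\in\{1,\dots,1/h-1\}$, $\varphi^h_m:[0,1]\to[0,1]$ is the hat function, piecewise linear on the grid $\{0,h,2h,\dots,1\}$, with value $1$ at $mh$ and $0$ at all other grid points. For a multi-index $\bm m=(m_1,\dots,m_d)$, $\varphi^h_{\bm m}(\bm r)=\prod_{i=1}^d\varphi^h_{m_i}(r_i)$. Interpolation operator: for $l\le l'$, $I^d_{l\to l'}:\mathbb{R}^{n_l^d}\to\mathbb{R}^{n_{l'}^d}$ is the linear map taking the coefficient vector $u$ of $f=\sum_{\bm m}u_{\bm m}\varphi^{2^{-l}}_{\bm m}$ to the coefficient vector $u'$ of the same function in the finer basis, $f=\sum_{\bm m}u'_{\bm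 m}\varphi^{2^{-l'}}_{\bm m}$ (so $I^d_{L\to L}$ is the identity). Embedding: $I^{d''}_{l\to L}\in\mathbb{R}^{n_L^d\times N_L^{(d)}}$ is the $1\times L$ block matrix whose $s$-th block has size $n_L^d\times n_s^d$ ($s=1,\dots,L$), whose $l$-th block is $I^d_{l\to L}$, and all of whose other blocks are $0$. Modified BPX preconditioner: $F^d_L=\sum_{l=1}^L 2^{-l(2-d)/2}\,I^{d''}_{l\to L}\in\mathbb{R}^{n_L^d\times N_L^{(d)}}$. Its square embedding $\widehat F^d_L\in\mathbb{R}^{N_L^{(d)}\times N_L^{(d)}}$ is zero in its first $N_L^{(d)}-n_L^d$ rows and coincides with $F^d_L$ in its last $n_L^d$ rows. *)

theory Defs
  imports
    "Jordan_Normal_Form.Schur_Decomposition"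
    "HOL-Analysis.L2_Norm"
    "HOL-Computational_Algebra.Polynomial"
begin

section \<open>Quantum circuits and block encodings\<close>

text \<open>
  Operators on \<open>n\<close> qubits are complex matrices of dimension \<open>2 ^ n\<close>. Qubit \<open>k\<close> of the
  computational basis state with index \<open>x\<close> is bit \<open>k\<close> of the number \<open>x\<close>. In a tensor product the
  left factor is the most significant one; hence, if \<open>q\<close> ancilla qubits are placed to the left of
  \<open>s\<close> data qubits, the states \<open>|0\<rangle>\<^sup>q \<otimes> |x\<rangle>\<close> are the basis states with index \<open>x < 2 ^ s\<close>.
\<close>

definition unitary_mat :: "nat \<Rightarrow> complex mat \<Rightarrow> bool" where
  "unitary_mat n U \<longleftrightarrow> U \<in> carrier_mat n n \<and> mat_adjoint U * U = 1\<^sub>m n \<and> U * mat_adjoint U = 1\<^sub>m n"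

definition vec_l2_norm :: "complex vec \<Rightarrow> real" where
  "vec_l2_norm v = L2_set (\<lambda>i. cmod (v $ i)) {..<dim_vec v}"

definition spectral_norm :: "complex mat \<Rightarrow> real" where
  "spectral_norm A =
     (SUP v \<in> {v \<in> carrier_vec (dim_col A). vec_l2_norm v \<le> 1}. vec_l2_norm (A *\<^sub>v v))"

text \<open>The matrix of the isometry \<open>|0\<rangle>\<^sup>q \<otimes> I\<close> from \<open>s\<close> qubits to \<open>q + s\<close> qubits.\<close>

definition ket0 :: "nat \<Rightarrow> nat \<Rightarrow> complex mat" where
  "ket0 q s = mat (2 ^ (q + s)) (2 ^ s) (\<lambda>(i, j). of_bool (i = j))"

definition block_encoding ::
    "nat \<Rightarrow> real \<Rightarrow> nat \<Rightarrow> real \<Rightarrow> complex mat \<Rightarrow> complex mat \<Rightarrow> bool" where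
  "block_encoding s \<alpha> q \<epsilon> U A \<longleftrightarrow>
     unitary_mat (2 ^ (q + s)) U \<and> A \<in> carrier_mat (2 ^ s) (2 ^ s) \<and>
     spectral_norm (A - complex_of_real \<alpha> \<cdot>\<^sub>m (mat_adjoint (ket0 q s) * U * ket0 q s)) \<le> \<epsilon>"

text \<open>
  \<open>embed_gate n ks G\<close> lets the gate \<open>G\<close> act on the qubits listed in \<open>ks\<close> (the head of the list
  being the least significant qubit of \<open>G\<close>) and the identity on all other qubits.
\<close>

definition local_index :: "nat list \<Rightarrow> nat \<Rightarrow> nat" where
  "local_index ks x = horner_sum of_bool 2 (map (bit x) ks)"

definition embed_gate :: "nat \<Rightarrow> nat list \<Rightarrow> complex mat \<Rightarrow> complex mat" where
  "embed_gate n ks G = mat (2 ^ n) (2 ^ n) (\<lambda>(x, y).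
     if \<forall>k<n. k \<notin> set ks \<longrightarrow> bit x k = bit y k
     then G $$ (local_index ks x, local_index ks y) else 0)"

definition elementary_gate :: "nat \<Rightarrow> complex mat \<Rightarrow> bool" where
  "elementary_gate n M \<longleftrightarrow>
     (\<exists>ks G. length ks \<in> {1, 2} \<and> distinct ks \<and> set ks \<subseteq> {..<n} \<and>
             unitary_mat (2 ^ length ks) G \<and> M = embed_gate n ks G)"

definition quantum_circuit :: "nat \<Rightarrow> complex mat list \<Rightarrow> bool" where
  "quantum_circuit n Ms \<longleftrightarrow> (\<forall>M \<in> set Ms. elementary_gate n M)"

definition circuit_mat :: "nat \<Rightarrow> complex mat list \<Rightarrow> complex mat" where
  "circuit_mat n Ms = fold (\<lambda>M A. M * A) Ms (1\<^sub>m (2 ^ n))"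

text \<open>
  Workspace ancillas start in \<open>|0\<rangle>\<close> and must be returned to \<open>|0\<rangle>\<close>:
  the circuit maps \<open>|0\<rangle>\<^sup>a \<otimes> \<psi>\<close> to \<open>|0\<rangle>\<^sup>a \<otimes> U \<psi>\<close> for every \<open>n\<close>-qubit state \<open>\<psi>\<close>.
\<close>

definition implements :: "nat \<Rightarrow> nat \<Rightarrow> complex mat list \<Rightarrow> complex mat \<Rightarrow> bool" where
  "implements n a Ms U \<longleftrightarrow>
     quantum_circuit (a + n) Ms \<and> circuit_mat (a + n) Ms * ket0 a n = ket0 a n * U"


section \<open>Nodal bases and the modified BPX preconditioner\<close>

definition hat :: "real \<Rightarrow> nat \<Rightarrow> real \<Rightarrow> real" where
  "hat h m x = max 0 (1 - \<bar>x / h - real m\<bar>)"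

definition hat_prod :: "nat \<Rightarrow> real \<Rightarrow> (nat \<Rightarrow> nat) \<Rightarrow> (nat \<Rightarrow> real) \<Rightarrow> real" where
  "hat_prod d h m r = (\<Prod>i<d. hat h (m i) (r i))"

text \<open>\<open>ndof d l\<close> is \<open>n\<^sub>l\<^sup>d\<close> and \<open>total_dof d L\<close> is \<open>N\<^sub>L\<^sup>(\<^sup>d\<^sup>)\<close>.\<close>

definition ndof :: "nat \<Rightarrow> nat \<Rightarrow> nat" where
  "ndof d l = (2 ^ l - 1) ^ d"

definition total_dof :: "nat \<Rightarrow> nat \<Rightarrow> nat" where
  "total_dof d L = (\<Sum>l=1..L. ndof d l)"

text \<open>
  Lexicographic enumeration of the multi-indices: the position \<open>c < n ^ d\<close> stands for the multi-index
  with components \<open>multi_index n d c i \<in> {1..n}\<close>, \<open>i < d\<close>.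
\<close>

definition multi_index :: "nat \<Rightarrow> nat \<Rightarrow> nat \<Rightarrow> nat \<Rightarrow> nat" where
  "multi_index n d c i = c div n ^ (d - 1 - i) mod n + 1"

text \<open>The function on the unit cube with coefficient vector \<open>u\<close> in the nodal basis of level \<open>l\<close>.\<close>

definition nodal_fun :: "nat \<Rightarrow> nat \<Rightarrow> real vec \<Rightarrow> (nat \<Rightarrow> real) \<Rightarrow> real" where
  "nodal_fun d l u r =
     (\<Sum>c<ndof d l. u $ c * hat_prod d (1 / 2 ^ l) (multi_index (2 ^ l - 1) d c) r)"

definition interp_mat :: "nat \<Rightarrow> nat \<Rightarrow> nat \<Rightarrow> real mat" where
  "interp_mat d l l' = (THE M. M \<in> carrier_mat (ndof d l') (ndof d l) \<and>
     (\<forall>u \<in> carrier_vec (ndof d l). \<forall>r. (\<forall>i<d. r i \<in> {0..1}) \<longrightarrow>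
        nodal_fun d l u r = nodal_fun d l' (M *\<^sub>v u) r))"

definition embedded_interp :: "nat \<Rightarrow> nat \<Rightarrow> nat \<Rightarrow> real mat" where
  "embedded_interp d l L = mat (ndof d L) (total_dof d L) (\<lambda>(i, j).
     if total_dof d (l - 1) \<le> j \<and> j < total_dof d l
     then interp_mat d l L $$ (i, j - total_dof d (l - 1)) else 0)"

definition bpx :: "nat \<Rightarrow> nat \<Rightarrow> real mat" where
  "bpx d L = mat (ndof d L) (total_dof d L) (\<lambda>ij.
     \<Sum>l=1..L. 2 powr (- (real l * (2 - real d) / 2)) * embedded_interp d l L $$ ij)"

definition bpx_square :: "nat \<Rightarrow> nat \<Rightarrow> real mat" where
  "bpx_square d L = mat (total_dof d L) (total_dof d L) (\<lambda>(i, j).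
     if i < total_dof d L - ndof d L then 0
     else bpx d L $$ (i - (total_dof d L - ndof d L), j))"

definition zero_pad :: "nat \<Rightarrow> 'a::zero mat \<Rightarrow> 'a mat" where
  "zero_pad n A = mat n n (\<lambda>(i, j). if i < dim_row A \<and> j < dim_col A then A $$ (i, j) else 0)"

text \<open>The number of qubits of the smallest power-of-two dimension that is at least \<open>N\<close>.\<close>

definition num_qubits :: "nat \<Rightarrow> nat" where
  "num_qubits N = (LEAST s. N \<le> 2 ^ s)"


section \<open>Well-definedness\<close>

text \<open>
  \<open>hat\<close> is the function that is affine on every cell of the grid with mesh size \<open>1 / n\<close> and has the
  nodal values \<open>1\<close> at \<open>m / n\<close> and \<open>0\<close> at all other grid points.
\<close>

lemma hat_node: "n > 0 \<Longrightarrow> hat (1 / real n) m (real k / real n) = of_bool (k = m)"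
  by (cases k m rule: linorder_cases) (auto simp: hat_def)

lemma hat_affine_on_cell:
  assumes "n > 0" "t \<in> {0..1}"
  shows "hat (1 / real n) m ((real k + t) / real n) =
           (1 - t) * of_bool (k = m) + t * of_bool (Suc k = m)"
proof -
  consider "m \<le> k" | "m = Suc k" | "m > Suc k" by linarith
  then show ?thesis
  proof cases
    case 1 then show ?thesis using assms by (cases "m = k") (auto simp: hat_def abs_if)
  next
    case 2 then show ?thesis using assms by (auto simp: hat_def abs_if)
  next
    case 3
    then have "real m \<ge> real k + 2" by linarith
    then show ?thesis using assms 3 by (auto simp: hat_def abs_if)
  qed
qed

lemma cell_cases:
  assumes "n > 0" "x \<in> {0..1::real}"
  obtains k t where "k < n" "t \<in> {0..1}" "x = (real k + t) / real n"
proof (cases "x = 1")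
  case True
  show ?thesis by (rule that[of "n - 1" 1]) (use assms True in \<open>auto simp: of_nat_diff\<close>)
next
  case False
  define k where "k = nat \<lfloor>x * n\<rfloor>"
  have "0 \<le> x * n" using assms by simp
  then have k: "real k \<le> x * n" "x * n < real k + 1" unfolding k_def by linarith+
  have "x * n < n" using assms False by auto
  then have "k < n" using k by linarith
  show ?thesis
    by (rule that[of k "x * n - k"]) (use k \<open>k < n\<close> assms in \<open>auto simp: field_simps\<close>)
qed

lemma hat_unique:
  assumes "n > 0" and nodes: "\<And>k. k \<le> n \<Longrightarrow> \<phi> (real k / real n) = of_bool (k = m)"
    and affine: "\<And>k t. k < n \<Longrightarrow> t \<in> {0..1} \<Longrightarrow> \<phi> ((real k + t) / real n) =
                   (1 - t) * \<phi> (real k / real n) + t * \<phi> (real (Suc k) / real n)"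
    and "x \<in> {0..1}"
  shows "\<phi> x = hat (1 / real n) m x"
proof -
  obtain k t where kt: "k < n" "t \<in> {0..1}" "x = (real k + t) / real n"
    using cell_cases assms(1,4) by metis
  then show ?thesis
    using affine[OF kt(1,2)] hat_affine_on_cell[OF assms(1) kt(2), of m k] nodes[of k] nodes[of "Suc k"]
    by auto
qed

lemma hat_refine:
  assumes "l \<le> l'" "m \<in> {1..2 ^ l - 1}" "x \<in> {0..1::real}"
  shows "hat (1 / 2 ^ l) m x =
           (\<Sum>k=1..2 ^ l' - 1. hat (1 / 2 ^ l) m (real k / 2 ^ l') * hat (1 / 2 ^ l') k x)"
proof -
  define n :: nat where "n = 2 ^ l'"
  define p :: nat where "p = 2 ^ (l' - l)"
  have np: "n = p * 2 ^ l" using assms(1) by (simp add: n_def p_def flip: power_add)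
  have nr: "real n = real p * 2 ^ l" using np by simp
  have n0: "n > 0" and p0: "p > 0" by (simp_all add: n_def p_def)
  let ?H = "hat (1 / 2 ^ l) m"
  obtain k t where k: "k < n" and t: "t \<in> {0..1}" and x: "x = (real k + t) / real n"
    using cell_cases n0 assms(3) by metis
  have H0: "?H 0 = 0" using assms(2) by (simp add: hat_def)
  have m2: "real m \<le> 2 ^ l - 1"
  proof -
    have "m + 1 \<le> 2 ^ l" using assms(2) by (cases "2 ^ l :: nat") auto
    then have "real (m + 1) \<le> real (2 ^ l)" using of_nat_mono by blast
    then show ?thesis by simp
  qed
  then have H1: "?H 1 = 0" by (simp add: hat_def)
  define j where "j = k div p"
  have "k = j * p + k mod p" by (simp add: j_def)
  moreover have "k mod p < p" using p0 by simp
  ultimately have jk: "j * p \<le> k" "k + 1 \<le> (j + 1) * p" by auto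
  have jr: "real j * real p \<le> real k" "real k + 1 \<le> (real j + 1) * real p"
    using jk by (metis of_nat_le_iff of_nat_mult, metis of_nat_le_iff of_nat_mult of_nat_add of_nat_1)
  have aff: "?H ((real k + t') / real n) = (1 - t') * ?H (real k / real n) + t' * ?H (real (Suc k) / real n)"
    if t': "t' \<in> {0..1}" for t'
  proof -
    have gen: "?H ((real k + y) / real n) =
        (1 - ((real k + y) / p - j)) * of_bool (j = m) + ((real k + y) / p - j) * of_bool (Suc j = m)"
      if y: "y \<in> {0..1}" for y
    proof -
      let ?s = "(real k + y) / p - j"
      have "?s \<in> {0..1}" using y jr p0 by (auto simp: field_simps)
      from hat_affine_on_cell[OF _ this, of "2 ^ l" m j]
      have "?H ((real j + ?s) / 2 ^ l) = (1 - ?s) * of_bool (j = m) + ?s * of_bool (Suc j = m)"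
        by simp
      moreover have "(real j + ?s) / 2 ^ l = (real k + y) / real n"
        using p0 by (simp add: nr)
      ultimately show ?thesis by metis
    qed
    show ?thesis
      using gen[OF t'] gen[of 0] gen[of 1] p0 by (simp add: add.commute) (simp add: field_simps)
  qed
  have fine: "hat (1 / 2 ^ l') i x = (1 - t) * of_bool (k = i) + t * of_bool (Suc k = i)" for i
    using hat_affine_on_cell[OF n0 t, of i k] x by (simp add: n_def)
  have "(\<Sum>i=1..n - 1. ?H (real i / n) * hat (1 / 2 ^ l') i x)
      = (\<Sum>i=0..n. ?H (real i / n) * hat (1 / 2 ^ l') i x)"
  proof (rule sum.mono_neutral_left)
    show "\<forall>i\<in>{0..n} - {1..n - 1}. ?H (real i / n) * hat (1 / 2 ^ l') i x = 0"
    proof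
      fix i assume "i \<in> {0..n} - {1..n - 1}"
      then have "i = 0 \<or> i = n" by auto
      then show "?H (real i / n) * hat (1 / 2 ^ l') i x = 0" using H0 H1 n0 by auto
    qed
  qed auto
  also have "\<dots> = (\<Sum>i=0..n. (if k = i then (1 - t) * ?H (real i / n) else 0)
                        + (if Suc k = i then t * ?H (real i / n) else 0))"
    by (rule sum.cong) (auto simp: fine)
  also have "\<dots> = (1 - t) * ?H (real k / n) + t * ?H (real (Suc k) / n)"
    using k by (simp add: sum.distrib)
  also have "\<dots> = ?H x" using aff[OF t] x by simp
  finally show ?thesis by (simp add: n_def)
qed

lemma sum_multi_index:
  fixes g :: "nat \<Rightarrow> nat \<Rightarrow> 'a::comm_semiring_1"
  shows "(\<Sum>c<n ^ d. \<Prod>i<d. g i (multi_index n d c i)) = (\<Prod>i<d. \<Sum>m=1..n. g i m)"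
proof (induction d arbitrary: g)
  case 0
  show ?case by simp
next
  case (Suc d)
  have lo: "multi_index n (Suc d) (a * n ^ d + b) (Suc i) = multi_index n d b i"
    if "i < d" "b < n ^ d" for a b i
  proof -
    have n0: "n > 0" using that by (cases n) (auto simp: power_0_left)
    have "d = (i + 1) + (d - 1 - i)" using that by simp
    then have "n ^ d = n ^ (i + 1) * n ^ (d - 1 - i)" by (metis power_add)
    then have "a * n ^ d + b = b + (a * n ^ i * n) * n ^ (d - 1 - i)"
      by (simp add: algebra_simps)
    then have "(a * n ^ d + b) div n ^ (d - 1 - i) = (a * n ^ i) * n + b div n ^ (d - 1 - i)"
      using n0 by (metis add.commute div_mult_self1 not_gr0 power_not_zero)
    then show ?thesis by (simp add: multi_index_def)
  qed
  have hi: "multi_index n (Suc d) (a * n ^ d + b) 0 = a + 1" if "a < n" "b < n ^ d" for a b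
    using that by (simp add: multi_index_def)
  have "(\<Sum>c<n ^ Suc d. \<Prod>i<Suc d. g i (multi_index n (Suc d) c i))
      = (\<Sum>a<n. \<Sum>c=a * n ^ d..<a * n ^ d + n ^ d. \<Prod>i<Suc d. g i (multi_index n (Suc d) c i))"
    by (simp add: sum.nat_group del: prod.lessThan_Suc)
  also have "\<dots> = (\<Sum>a<n. \<Sum>b<n ^ d. \<Prod>i<Suc d. g i (multi_index n (Suc d) (a * n ^ d + b) i))"
  proof (rule sum.cong[OF refl])
    fix a
    show "(\<Sum>c=a * n ^ d..<a * n ^ d + n ^ d. \<Prod>i<Suc d. g i (multi_index n (Suc d) c i)) =
        (\<Sum>b<n ^ d. \<Prod>i<Suc d. g i (multi_index n (Suc d) (a * n ^ d + b) i))"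
      using sum.shift_bounds_nat_ivl[of "\<lambda>c. \<Prod>i<Suc d. g i (multi_index n (Suc d) c i)" 0 "a * n ^ d" "n ^ d"]
      by (simp add: add.commute atLeast0LessThan del: prod.lessThan_Suc)
  qed
  also have "\<dots> = (\<Sum>a<n. \<Sum>b<n ^ d. g 0 (a + 1) * (\<Prod>i<d. g (Suc i) (multi_index n d b i)))"
    by (intro sum.cong refl) (simp add: prod.lessThan_Suc_shift hi lo del: prod.lessThan_Suc)
  also have "\<dots> = (\<Sum>a<n. g 0 (a + 1)) * (\<Sum>b<n ^ d. \<Prod>i<d. g (Suc i) (multi_index n d b i))"
    by (simp add: sum_product)
  also have "\<dots> = (\<Sum>a<n. g 0 (a + 1)) * (\<Prod>i<d. \<Sum>m=1..n. g (Suc i) m)"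
    by (simp only: Suc.IH[of "\<lambda>i. g (Suc i)"])
  also have "(\<Sum>a<n. g 0 (a + 1)) = (\<Sum>m=1..n. g 0 m)"
    by (rule sum.reindex_bij_witness[of _ "\<lambda>m. m - 1" Suc]) auto
  finally show ?case by (simp add: prod.lessThan_Suc_shift del: prod.lessThan_Suc)
qed

lemma multi_index_range:
  assumes "c < n ^ d" "i < d"
  shows "multi_index n d c i \<in> {1..n}"
proof -
  have "n > 0" using assms by (cases n) (auto simp: power_0_left)
  then have "c div n ^ (d - 1 - i) mod n < n" by simp
  then show ?thesis by (simp add: multi_index_def)
qed

lemma multi_index_inject:
  assumes "c < n ^ d" "c' < n ^ d" "\<And>i. i < d \<Longrightarrow> multi_index n d c i = multi_index n d c' i"
  shows "c = c'"
proof -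
  have "n ^ d > 0" using assms(1) by linarith
  then have n0: "n > 0 \<or> d = 0" by auto
  have "c mod n ^ k = c' mod n ^ k" if "k \<le> d" for k
    using that
  proof (induction k)
    case (Suc k)
    then have "multi_index n d c (d - 1 - k) = multi_index n d c' (d - 1 - k)"
      using assms(3) by simp
    then have "c div n ^ k mod n = c' div n ^ k mod n"
      using Suc.prems by (simp add: multi_index_def)
    moreover have "c mod n ^ k = c' mod n ^ k" using Suc by simp
    ultimately show ?case
      by (metis mod_mult2_eq mult.commute power_Suc)
  qed simp
  from this[of d] show ?thesis using assms by simp
qed

text \<open>The function with coefficient vector \<open>u\<close> takes the value \<open>u $ c\<close> at the \<open>c\<close>-th grid point.\<close>

lemma nodal_fun_node:
  assumes "c < ndof d l"
  shows "nodal_fun d l u (\<lambda>i. real (multi_index (2 ^ l - 1) d c i) / 2 ^ l) = u $ c"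
proof -
  let ?n = "2 ^ l - 1 :: nat"
  have node: "hat (1 / 2 ^ l) m (real k / 2 ^ l) = of_bool (k = m)" for k m
    using hat_node[of "2 ^ l" m k] by simp
  have "hat_prod d (1 / 2 ^ l) (multi_index ?n d c') (\<lambda>i. real (multi_index ?n d c i) / 2 ^ l)
      = of_bool (c' = c)" if "c' < ndof d l" for c'
  proof (cases "c' = c")
    case False
    then obtain i where "i < d" "multi_index ?n d c' i \<noteq> multi_index ?n d c i"
      using multi_index_inject[of c' ?n d c] \<open>c' < ndof d l\<close> assms unfolding ndof_def by blast
    moreover have "hat (1 / 2 ^ l) (multi_index ?n d c' i) (real (multi_index ?n d c i) / 2 ^ l) = 0"
      using calculation(2) by (auto simp add: node)
    ultimately have "hat_prod d (1 / 2 ^ l) (multi_index ?n d c') (\<lambda>i. real (multi_index ?n d c i) / 2 ^ l) = 0"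
      unfolding hat_prod_def by (intro prod_zero) auto
    then show ?thesis using False by simp
  qed (simp add: hat_prod_def node)
  then have "nodal_fun d l u (\<lambda>i. real (multi_index ?n d c i) / 2 ^ l)
      = (\<Sum>c'<ndof d l. if c' = c then u $ c' else 0)"
    unfolding nodal_fun_def by (intro sum.cong) auto
  then show ?thesis using assms by simp
qed

lemma interp_mat_eq:
  assumes "l \<le> l'"
  shows "interp_mat d l l' = mat (ndof d l') (ndof d l) (\<lambda>(i, j).
           hat_prod d (1 / 2 ^ l) (multi_index (2 ^ l - 1) d j)
             (\<lambda>k. real (multi_index (2 ^ l' - 1) d i k) / 2 ^ l'))" (is "_ = ?M")
    and "u \<in> carrier_vec (ndof d l) \<Longrightarrow> \<forall>i<d. r i \<in> {0..1} \<Longrightarrow>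
           nodal_fun d l u r = nodal_fun d l' (interp_mat d l l' *\<^sub>v u) r"
proof -
  let ?P = "\<lambda>M. M \<in> carrier_mat (ndof d l') (ndof d l) \<and>
     (\<forall>u \<in> carrier_vec (ndof d l). \<forall>r. (\<forall>i<d. r i \<in> {0..1}) \<longrightarrow>
        nodal_fun d l u r = nodal_fun d l' (M *\<^sub>v u) r)"
  let ?x = "\<lambda>i k. real (multi_index (2 ^ l' - 1) d i k) / 2 ^ l'"
  have ex: "?P ?M"
  proof (intro conjI ballI allI impI)
    fix u :: "real vec" and r :: "nat \<Rightarrow> real"
    assume u: "u \<in> carrier_vec (ndof d l)" and r: "\<forall>i<d. r i \<in> {0..1}"
    let ?b = "\<lambda>c. hat_prod d (1 / 2 ^ l) (multi_index (2 ^ l - 1) d c)"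
    let ?b' = "\<lambda>c. hat_prod d (1 / 2 ^ l') (multi_index (2 ^ l' - 1) d c)"
    have basis: "?b j r = (\<Sum>i<ndof d l'. ?b j (?x i) * ?b' i r)" if j: "j < ndof d l" for j
    proof -
      let ?m = "multi_index (2 ^ l - 1) d j"
      have "?b j r = (\<Prod>k<d. hat (1 / 2 ^ l) (?m k) (r k))" by (simp add: hat_prod_def)
      also have "\<dots> = (\<Prod>k<d. \<Sum>i=1..2 ^ l' - 1.
          hat (1 / 2 ^ l) (?m k) (real i / 2 ^ l') * hat (1 / 2 ^ l') i (r k))"
        using j r assms
        by (intro prod.cong refl hat_refine multi_index_range) (auto simp: ndof_def)
      also have "\<dots> = (\<Sum>i<ndof d l'. \<Prod>k<d.
          hat (1 / 2 ^ l) (?m k) (?x i k) * hat (1 / 2 ^ l') (multi_index (2 ^ l' - 1) d i k) (r k))"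
        unfolding ndof_def
        by (rule sum_multi_index[symmetric, of "\<lambda>k i. hat (1 / 2 ^ l) (?m k) (real i / 2 ^ l') * hat (1 / 2 ^ l') i (r k)"])
      finally show ?thesis by (simp add: hat_prod_def prod.distrib)
    qed
    have "nodal_fun d l' (?M *\<^sub>v u) r
        = (\<Sum>i<ndof d l'. (\<Sum>j<ndof d l. ?b j (?x i) * u $ j) * ?b' i r)"
      unfolding nodal_fun_def using u
      by (intro sum.cong refl arg_cong2[where f = "(*)"])
         (auto simp: mult_mat_vec_def scalar_prod_def atLeast0LessThan)
    also have "\<dots> = (\<Sum>j<ndof d l. \<Sum>i<ndof d l'. u $ j * (?b j (?x i) * ?b' i r))"
      by (subst sum.swap) (simp add: sum_distrib_left sum_distrib_right mult_ac)
    also have "\<dots> = nodal_fun d l u r"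
      unfolding nodal_fun_def by (intro sum.cong refl) (simp only: basis sum_distrib_left lessThan_iff)
    finally show "nodal_fun d l u r = nodal_fun d l' (?M *\<^sub>v u) r" by simp
  qed simp
  have uniq: "M = ?M" if M: "?P M" for M
  proof (rule eq_matI)
    fix i j assume ij: "i < dim_row ?M" "j < dim_col ?M"
    have rng: "\<forall>k<d. ?x i k \<in> {0..1}"
    proof (intro allI impI)
      fix k assume "k < d"
      then have "multi_index (2 ^ l' - 1) d i k \<le> 2 ^ l' - 1"
        using multi_index_range[of i "2 ^ l' - 1" d k] ij by (simp add: ndof_def)
      then have "multi_index (2 ^ l' - 1) d i k \<le> 2 ^ l'" by linarith
      then have "real (multi_index (2 ^ l' - 1) d i k) \<le> real (2 ^ l')"
        using of_nat_mono by blast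
      then show "?x i k \<in> {0..1}" by simp
    qed
    have val: "nodal_fun d l (unit_vec (ndof d l) j) (?x i) = A $$ (i, j)" if A: "?P A" for A
    proof -
      have "nodal_fun d l (unit_vec (ndof d l) j) (?x i)
          = nodal_fun d l' (A *\<^sub>v unit_vec (ndof d l) j) (?x i)"
        using A rng by simp
      also have "\<dots> = (A *\<^sub>v unit_vec (ndof d l) j) $ i"
        using ij by (intro nodal_fun_node) simp
      also have "\<dots> = A $$ (i, j)"
        using A ij by auto
      finally show ?thesis .
    qed
    show "M $$ (i, j) = ?M $$ (i, j)" using val[OF M] val[OF ex] by simp
  qed (use M in auto)
  have "interp_mat d l l' = ?M"
    unfolding interp_mat_def by (rule the_equality) (use ex uniq in blast)+
  then show "interp_mat d l l' = ?M" and
    "u \<in> carrier_vec (ndof d l) \<Longrightarrow> \<forall>i<d. r i \<in> {0..1} \<Longrightarrow>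
       nodal_fun d l u r = nodal_fun d l' (interp_mat d l l' *\<^sub>v u) r"
    using ex by auto
qed

end

theory Submission
  imports Defs
begin

text \<open>
In one space dimension, a grid point \<open>m' = k p + t\<close> of level \<open>L\<close>, where \<open>p = 2 ^ (L - l)\<close> and
\<open>t < p\<close>, receives the value \<open>(1 - t / p) f\<^sub>k + (t / p) f\<^sub>k\<^sub>+\<^sub>1\<close> from level \<open>l\<close>. For a uniformly random
coin \<open>u < p\<close> this is the average of \<open>f\<^sub>m\<close> over \<open>m = k + [u < t]\<close>. So Hadamard gates on \<open>t\<close> and \<open>u\<close>, the
reversible map \<open>(m, t, u) \<mapsto> (p (m - [u < t]) + t, u)\<close> and Hadamard gates on \<open>u\<close> implement the
interpolation matrix divided by \<open>sqrt p\<close> whenever \<open>u\<close> ends up as \<open>0\<close>. The \<open>d\<close> dimensions are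
treated one after the other. They share the register \<open>u\<close>: a branch in which \<open>u \<noteq> 0\<close> is parked, and it
records the dimension of its failure in the top bit of the next digit, which is unused because that
digit still belongs to a coarse grid. Therefore the number of ancillas of the block encoding does
not depend on \<open>d\<close>. Finally, the one-hot encoded level \<open>l\<close> is rotated to \<open>0\<close> with amplitude
proportional to \<open>2 ^ - l\<close>.

Every permutation of basis states that is used is an involution of the block-encoding register.
It is computed by a Boolean circuit into a clean workspace, swapped in, and uncomputed by the same
circuit. The index arithmetic needs only additions, comparisons, and multiplications and divisions
by constants, so these Boolean circuits have polynomial size.
\<close>

section \<open>Boolean circuits\<close>

text \<open>The normalisation comes from balancing three factors. One dimension contributes
  \<open>2 powr (-(L - l) / 2)\<close> times a hat value, the level rotation contributes
  \<open>1 / (L * 2 ^ l)\<close>, and the preconditioner weights level \<open>l\<close> by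
  \<open>2 powr (-l) * 2 powr (d * l / 2)\<close>. Weight divided by amplitude is
  \<open>L * 2 powr (d * L / 2)\<close> for every \<open>l\<close>, so a single subnormalisation
  serves all blocks and the error is exactly \<open>0\<close>. Garbage of the \<open>d\<close>
  dimensions therefore cannot stay in separate registers, and yet a branch that has failed once must
  never interfere back into \<open>u = 0\<close>. Parking achieves this because every gate of an
  interpolation step is controlled by the level register \<open>e\<close>, so that a branch with
  \<open>e = 0\<close> is inert from then on. The correctness proof is an invariant over the
  dimensions which gives the exact amplitudes of the successful branch and only constrains where the
  failed ones may live.\<close>

type_synonym bfun = "nat \<Rightarrow> bool"

text \<open>Straight-line programs are tracked as the whole set \<open>H\<close> of functions
  available after \<open>k\<close> gates, so an intermediate result can be used repeatedly without
  being paid for again.\<close>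

inductive nand_circuit :: "bfun set \<Rightarrow> bfun set \<Rightarrow> nat \<Rightarrow> bool" for G where
  nand_circuit_base: "nand_circuit G G 0"
| nand_circuit_const: "nand_circuit G H k \<Longrightarrow> nand_circuit G (insert (\<lambda>x. c) H) (Suc k)"
| nand_circuit_step: "nand_circuit G H k \<Longrightarrow> f \<in> H \<Longrightarrow> g \<in> H \<Longrightarrow> nand_circuit G (insert (\<lambda>x. \<not> (f x \<and> g x)) H) (Suc k)"

lemma nand_circuit_trans:
  assumes "nand_circuit H K j" "nand_circuit G H k"
  shows "nand_circuit G K (k + j)"
  using assms
proof induction
  case (nand_circuit_step H' k' f g)
  then show ?case using nand_circuit.nand_circuit_step[of G H' "k + k'" f g] by simp
qed (auto intro: nand_circuit_const)

lemma nand_circuit_mono: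
  assumes "nand_circuit G H k" "G \<subseteq> G'"
  shows "nand_circuit G' (G' \<union> H) k"
  using assms
proof induction
  case nand_circuit_base
  then show ?case by (simp add: Un_absorb2 nand_circuit.nand_circuit_base)
next
  case (nand_circuit_const H k c)
  then show ?case using nand_circuit.nand_circuit_const[of G' "G' \<union> H" k c] by simp
next
  case (nand_circuit_step H k f g)
  then show ?case using nand_circuit.nand_circuit_step[of G' "G' \<union> H" k f g] by simp
qed

lemma nand_circuit_subset: "nand_circuit G H k \<Longrightarrow> G \<subseteq> H"
  by (induction rule: nand_circuit.induct) auto

text \<open>Discarding surplus wires and rounding up the gate count gives a judgement that is
  monotone in all three arguments, which the exact \<open>nand_circuit\<close> is not.\<close>

definition computes :: "bfun set \<Rightarrow> bfun set \<Rightarrow> nat \<Rightarrow> bool" where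
  "computes G H k \<longleftrightarrow> (\<exists>H' k'. k' \<le> k \<and> H \<subseteq> H' \<and> nand_circuit G H' k')"

lemma computes_weaken: "computes G H k \<Longrightarrow> H' \<subseteq> H \<Longrightarrow> k \<le> k' \<Longrightarrow> computes G H' k'"
  unfolding computes_def by (meson order_trans)

lemma computes_mem: "H \<subseteq> G \<Longrightarrow> computes G H 0"
  unfolding computes_def using nand_circuit_base by blast

lemma computes_mono: "computes G H k \<Longrightarrow> G \<subseteq> G' \<Longrightarrow> computes G' H k"
  unfolding computes_def using nand_circuit_mono by (meson le_supI2)

text \<open>Cut rule: the results \<open>H\<close> become wires of the second program, and their
  cost is added once. This keeps carry chains and long division polynomial.\<close>

lemma computes_let2:
  assumes "computes G H k" "computes (G \<union> H) K j"
  shows "computes G (G \<union> H \<union> K) (k + j)"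
proof -
  obtain H' k' where 1: "k' \<le> k" "H \<subseteq> H'" "nand_circuit G H' k'" using assms(1) unfolding computes_def by blast
  obtain K' j' where 2: "j' \<le> j" "K \<subseteq> K'" "nand_circuit (G \<union> H) K' j'" using assms(2) unfolding computes_def by blast
  have "G \<union> H \<subseteq> H'" using 1 nand_circuit_subset by blast
  then have "nand_circuit H' (H' \<union> K') j'" using 2 nand_circuit_mono by blast
  then have "nand_circuit G (H' \<union> K') (k' + j')" using 1 nand_circuit_trans by blast
  moreover have "G \<union> H \<union> K \<subseteq> H' \<union> K'" using \<open>G \<union> H \<subseteq> H'\<close> 2 by blast
  ultimately show ?thesis unfolding computes_def using 1 2 by (meson add_mono)
qed

lemma computes_let:
  assumes "computes G H k" "computes H K j"
  shows "computes G K (k + j)"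
  using computes_let2[OF assms(1) computes_mono[OF assms(2)]] computes_weaken by blast

lemma computes_Un:
  assumes "computes G H k" "computes G K j"
  shows "computes G (H \<union> K) (k + j)"
  using computes_let2[OF assms(1) computes_mono[OF assms(2)]] computes_weaken by blast

lemma computes_UN:
  assumes "\<And>i. i < m \<Longrightarrow> computes G (H i) c"
  shows "computes G (\<Union>i<m. H i) (m * c)"
  using assms
proof (induction m)
  case 0
  show ?case by (simp add: computes_mem)
next
  case (Suc m)
  have "computes G ((\<Union>i<m. H i) \<union> H m) (m * c + c)" by (intro computes_Un Suc) auto
  then show ?case by (simp add: lessThan_Suc Un_commute add.commute)
qed

lemma computes_const: "computes G {\<lambda>x. c} 1"
  unfolding computes_def using nand_circuit_const[OF nand_circuit_base, of G c] by (metis One_nat_def insertI1 le_refl empty_subsetI insert_subset)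

lemma computes_nand:
  assumes "computes G {f} k" "computes G {g} j"
  shows "computes G {\<lambda>x. \<not> (f x \<and> g x)} (k + j + 1)"
proof -
  have "nand_circuit {f, g} (insert (\<lambda>x. \<not> (f x \<and> g x)) {f, g}) (Suc 0)"
    by (rule nand_circuit_step[OF nand_circuit_base]) auto
  then have "computes ({f} \<union> {g}) {\<lambda>x. \<not> (f x \<and> g x)} 1"
    unfolding computes_def insert_is_Un[symmetric]
    by (intro exI[of _ "insert (\<lambda>x. \<not> (f x \<and> g x)) {f, g}"] exI[of _ "Suc 0"]) auto
  from computes_let[OF computes_Un[OF assms] this] show ?thesis .
qed

lemma computes_not:
  assumes "computes G {f} k"
  shows "computes G {\<lambda>x. \<not> f x} (k + 1)"
proof -
  have "computes {f} {f} 0" by (rule computes_mem) simp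
  from computes_let[OF assms computes_nand[OF this this]] show ?thesis by simp
qed

lemma computes_and:
  assumes "computes G {f} k" "computes G {g} j"
  shows "computes G {\<lambda>x. f x \<and> g x} (k + j + 2)"
  using computes_not[OF computes_nand[OF assms]] by (simp add: add.assoc)

lemma computes_or:
  assumes "computes G {f} k" "computes G {g} j"
  shows "computes G {\<lambda>x. f x \<or> g x} (k + j + 3)"
proof -
  have "(\<lambda>x. \<not> (\<not> f x \<and> \<not> g x)) = (\<lambda>x. f x \<or> g x)" by auto
  moreover have "computes G {\<lambda>x. \<not> (\<not> f x \<and> \<not> g x)} ((k + 1) + (j + 1) + 1)"
    by (intro computes_nand computes_not assms)
  ultimately show ?thesis by (simp add: ac_simps eval_nat_numeral)
qed

lemma computes_xor:
  assumes "computes G {f} k" "computes G {g} j"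
  shows "computes G {\<lambda>x. f x \<noteq> g x} (k + j + 9)"
proof -
  have f: "computes {f, g} {f} 0" and g: "computes {f, g} {g} 0" by (rule computes_mem; simp)+
  have "computes {f, g} {\<lambda>x. (f x \<and> \<not> g x) \<or> (\<not> f x \<and> g x)} (0 + (0 + 1) + 2 + (0 + 1 + 0 + 2) + 3)"
    by (intro computes_or computes_and computes_not f g)
  moreover have "(\<lambda>x. (f x \<and> \<not> g x) \<or> (\<not> f x \<and> g x)) = (\<lambda>x. f x \<noteq> g x)" by auto
  ultimately have "computes ({f} \<union> {g}) {\<lambda>x. f x \<noteq> g x} 9" by (simp add: insert_commute)
  from computes_let[OF computes_Un[OF assms] this] show ?thesis by simp
qed

lemma computes_if:
  assumes "computes G {b} i" "computes G {f} k" "computes G {g} j"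
  shows "computes G {\<lambda>x. if b x then f x else g x} (i + k + j + 8)"
proof -
  let ?H = "{b} \<union> {f} \<union> {g}"
  have b: "computes ?H {b} 0" and f: "computes ?H {f} 0" and g: "computes ?H {g} 0" by (rule computes_mem; simp)+
  have "computes ?H {\<lambda>x. (b x \<and> f x) \<or> (\<not> b x \<and> g x)} (0 + 0 + 2 + (0 + 1 + 0 + 2) + 3)"
    by (intro computes_or computes_and computes_not b f g)
  moreover have "(\<lambda>x. (b x \<and> f x) \<or> (\<not> b x \<and> g x)) = (\<lambda>x. if b x then f x else g x)" by auto
  ultimately have "computes ?H {\<lambda>x. if b x then f x else g x} 8" by simp
  from computes_let[OF computes_Un[OF computes_Un[OF assms(1,2)] assms(3)] this] show ?thesis .
qed

lemma computes_all:
  assumes "\<And>i. i < m \<Longrightarrow> computes G {f i} c"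
  shows "computes G {\<lambda>x. \<forall>i<m. f i x} (m * (c + 2) + 1)"
  using assms
proof (induction m)
  case 0
  show ?case using computes_const[of G True] by simp
next
  case (Suc m)
  have "computes G {\<lambda>x. (\<forall>i<m. f i x) \<and> f m x} ((m * (c + 2) + 1) + c + 2)"
    by (intro computes_and Suc) auto
  moreover have "(\<lambda>x. (\<forall>i<m. f i x) \<and> f m x) = (\<lambda>x. \<forall>i<Suc m. f i x)"
    by (auto simp: less_Suc_eq)
  ultimately show ?case by (simp add: ac_simps)
qed

section \<open>Fixed-width binary arithmetic\<close>

definition bits :: "nat \<Rightarrow> (nat \<Rightarrow> nat) \<Rightarrow> bfun set" where
  "bits m v = (\<lambda>i x. bit (v x) i) ` {..<m}"

lemma bits_mem: "i < m \<Longrightarrow> (\<lambda>x. bit (v x) i) \<in> bits m v"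
  by (auto simp: bits_def)

lemma bits_UN: "bits m v = (\<Union>i<m. {\<lambda>x. bit (v x) i})"
  by (auto simp: bits_def)

lemma bits_mono: "m \<le> m' \<Longrightarrow> bits m v \<subseteq> bits m' v"
  by (auto simp: bits_def)

lemma bits_Suc: "bits (Suc m) v = bits m v \<union> {\<lambda>x. bit (v x) m}"
  by (auto simp: bits_def lessThan_Suc)

lemma computes_bit: "computes G (bits m v) k \<Longrightarrow> i < m \<Longrightarrow> computes G {\<lambda>x. bit (v x) i} k"
  by (erule computes_weaken) (auto simp: bits_mem)

lemma computes_bits_const: "computes G (bits m (\<lambda>x. c)) m"
  using computes_UN[of m G "\<lambda>i. {\<lambda>x. bit c i}" 1] computes_const by (simp add: bits_UN)

lemma computes_bits_if:
  assumes "computes G {b} i" "computes G (bits m u) k" "computes G (bits m v) j"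
  shows "computes G (bits m (\<lambda>x. if b x then u x else v x)) (i + k + j + m * 8)"
proof -
  let ?H = "{b} \<union> bits m u \<union> bits m v"
  have "computes ?H (\<Union>i<m. {\<lambda>x. if b x then bit (u x) i else bit (v x) i}) (m * (0 + 0 + 0 + 8))"
    by (intro computes_UN computes_if computes_mem) (auto simp: bits_mem)
  moreover have "(\<Union>i<m. {\<lambda>x. if b x then bit (u x) i else bit (v x) i}) = bits m (\<lambda>x. if b x then u x else v x)"
    unfolding bits_UN by (intro SUP_cong refl) auto
  ultimately have "computes ?H (bits m (\<lambda>x. if b x then u x else v x)) (m * 8)" by simp
  from computes_let[OF computes_Un[OF computes_Un[OF assms(1,2)] assms(3)] this] show ?thesis .
qed

text \<open>\<open>c\<close> is the carry out of the lower \<open>m\<close> positions: the truncated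
  summands add up to less than \<open>2 * 2 ^ m\<close>, so the quotient by \<open>2 ^ m\<close> is
  \<open>0\<close> or \<open>1\<close>.\<close>

lemma half_adder:
  fixes u v m :: nat
  defines "c \<equiv> (2 ^ m \<le> take_bit m u + take_bit m v)"
  shows "bit (u + v) m \<longleftrightarrow> (bit u m \<noteq> (bit v m \<noteq> c))"
    and "2 ^ Suc m \<le> take_bit (Suc m) u + take_bit (Suc m) v \<longleftrightarrow>
           (if bit u m then bit v m \<or> c else bit v m \<and> c)"
proof -
  have a: "take_bit m u < 2 ^ m" "take_bit m v < 2 ^ m" by simp_all
  have "(take_bit m u + take_bit m v) div 2 ^ m = of_bool c"
    using a unfolding c_def by (auto intro!: div_nat_eqI add_strict_mono)
  then have "(u + v) div 2 ^ m = u div 2 ^ m + v div 2 ^ m + of_bool c"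
    using div_add1_eq[of u v "2 ^ m"] by (simp add: take_bit_eq_mod)
  then show "bit (u + v) m \<longleftrightarrow> (bit u m \<noteq> (bit v m \<noteq> c))"
    by (auto simp: bit_iff_odd)
  show "2 ^ Suc m \<le> take_bit (Suc m) u + take_bit (Suc m) v \<longleftrightarrow>
           (if bit u m then bit v m \<or> c else bit v m \<and> c)"
    using a add_strict_mono[OF a] unfolding c_def
    by (cases "bit u m"; cases "bit v m") (auto simp add: take_bit_Suc_from_most not_le)
qed

text \<open>Ripple-carry addition. The carry is exported with the sum bits because the next position
  needs it; 18 gates for a sum bit and 13 for a carry stay below 40.\<close>

lemma computes_adder:
  "computes (bits m u \<union> bits m v)
     (bits m (\<lambda>x. u x + v x) \<union> {\<lambda>x. 2 ^ m \<le> take_bit m (u x) + take_bit m (v x)}) (m * 40 + 1)"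
proof (induction m)
  case 0
  show ?case using computes_const[of _ False] by (simp add: bits_def)
next
  case (Suc m)
  let ?c = "\<lambda>m x. 2 ^ m \<le> take_bit m (u x) + take_bit m (v x)"
  let ?G = "bits (Suc m) u \<union> bits (Suc m) v"
  let ?H = "bits m (\<lambda>x. u x + v x) \<union> {?c m}"
  have IH: "computes ?G ?H (m * 40 + 1)"
    by (rule computes_mono[OF Suc]) (auto simp: bits_Suc)
  let ?H' = "?G \<union> ?H"
  have u: "computes ?H' {\<lambda>x. bit (u x) m} 0" and v: "computes ?H' {\<lambda>x. bit (v x) m} 0" and c: "computes ?H' {?c m} 0"
    by (rule computes_mem; simp add: bits_mem)+
  have "computes ?H' {\<lambda>x. (bit (u x) m \<noteq> (bit (v x) m \<noteq> ?c m x))} (0 + (0 + 0 + 9) + 9)"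
    by (intro computes_xor u v c)
  then have 1: "computes ?H' {\<lambda>x. bit (u x + v x) m} 18"
    by (simp only: half_adder(1)) simp
  have "computes ?H' {\<lambda>x. (if bit (u x) m then bit (v x) m \<or> ?c m x else bit (v x) m \<and> ?c m x)}
      (0 + (0 + 0 + 3) + (0 + 0 + 2) + 8)"
    by (intro computes_if computes_or computes_and u v c)
  then have 2: "computes ?H' {?c (Suc m)} 13"
    by (simp only: half_adder(2)) simp
  have "computes ?G (?G \<union> ?H \<union> ({\<lambda>x. bit (u x + v x) m} \<union> {?c (Suc m)})) (m * 40 + 1 + (18 + 13))"
    by (intro computes_let2 computes_Un IH 1 2)
  then show ?case
    by (rule computes_weaken) (auto simp: bits_Suc)
qed

lemma computes_bits_add:
  assumes "computes G (bits m u) k" "computes G (bits m v) j"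
  shows "computes G (bits m (\<lambda>x. u x + v x)) (k + j + (m * 40 + 1))"
  by (rule computes_let[OF computes_Un[OF assms]], rule computes_weaken[OF computes_adder]) auto

lemma computes_bits_cong:
  "computes G (bits m u) k \<Longrightarrow> (\<And>x. take_bit m (u x) = take_bit m (v x)) \<Longrightarrow> computes G (bits m v) k"
proof -
  assume a: "computes G (bits m u) k" and b: "\<And>x. take_bit m (u x) = take_bit m (v x)"
  have "(\<lambda>x. bit (u x) i) = (\<lambda>x. bit (v x) i)" if "i < m" for i
  proof
    fix x show "bit (u x) i = bit (v x) i"
      using b[of x] that by (metis bit_take_bit_iff)
  qed
  then have "bits m u = bits m v" unfolding bits_def by (intro image_cong) auto
  then show ?thesis using a by simp
qed

lemma computes_bits_weaken:
  "computes G (bits m u) k \<Longrightarrow> (\<And>x. take_bit m (u x) = take_bit m (v x)) \<Longrightarrow> k \<le> k' \<Longrightarrow> computes G (bits m v) k'"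
  using computes_weaken[OF computes_bits_cong[of G m u k v] order_refl] by simp

text \<open>\<open>u < v\<close> holds iff adding the complement of \<open>u\<close> to \<open>v\<close> produces a carry.\<close>

lemma computes_less:
  assumes "computes G (bits m u) k" "computes G (bits m v) j"
    and "\<And>x. u x < 2 ^ m" "\<And>x. v x < 2 ^ m"
  shows "computes G {\<lambda>x. u x < v x} (k + j + (m * 41 + 1))"
proof -
  let ?w = "\<lambda>x. mask m - u x"
  have bw: "bit (?w x) i \<longleftrightarrow> \<not> bit (u x) i" if "i < m" for i x
  proof -
    \<comment> \<open>With \<open>2 ^ m = 2 ^ i * (2 * q)\<close>, the quotients \<open>r\<close> of
      the complement and \<open>?a\<close> of \<open>u x\<close> satisfy
      \<open>r + ?a + 1 = 2 * q\<close>, so exactly one of the two is odd.\<close>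
    have "even ((mask m - u x) div 2 ^ i) \<longleftrightarrow> odd (u x div 2 ^ i)"
    proof -
      define q :: nat where "q = 2 ^ (m - Suc i)"
      have q: "2 ^ m = 2 ^ i * (2 * q)"
      proof -
        have "m = i + Suc (m - Suc i)" using that by simp
        then have "(2::nat) ^ m = 2 ^ (i + Suc (m - Suc i))" by (rule arg_cong)
        then show ?thesis by (simp only: power_add power_Suc q_def)
      qed
      let ?a = "u x div 2 ^ i" and ?b = "u x mod 2 ^ i"
      have ab: "u x = 2 ^ i * ?a + ?b" by simp
      have b: "?b < 2 ^ i" by simp
      have "2 ^ i * ?a < 2 ^ i * (2 * q)" using assms(3)[of x] q ab by linarith
      then have aq: "?a < 2 * q" by simp
      define r where "r = 2 * q - 1 - ?a"
      have r: "2 * q = r + ?a + 1" using aq by (simp add: r_def)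
      have "2 ^ m = 2 ^ i * r + 2 ^ i * ?a + 2 ^ i" unfolding q r by (simp add: algebra_simps)
      moreover have "R + A + P - 1 - U = R + (P - 1 - b)" if "U = A + b" "b < P" for R A P U b :: nat
        using that by simp
      ultimately have "mask m - u x = 2 ^ i * r + (2 ^ i - 1 - ?b)"
        using ab b by (simp only: mask_eq_exp_minus_1)
      then have "(mask m - u x) div 2 ^ i = r + (2 ^ i - 1 - ?b) div 2 ^ i" by simp
      moreover have "(2 ^ i - 1 - ?b) < (2 ^ i :: nat)" by (simp add: less_imp_diff_less)
      ultimately have "(mask m - u x) div 2 ^ i = r" by simp
      moreover have "even (r + ?a + 1)" using r by (metis dvd_triv_left)
      ultimately show ?thesis by auto
    qed
    then show ?thesis by (simp add: bit_iff_odd)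
  qed
  let ?H = "bits m u \<union> bits m v"
  have "computes ?H (\<Union>i<m. {\<lambda>x. \<not> bit (u x) i}) (m * (0 + 1))"
    by (intro computes_UN computes_not computes_mem) (auto simp: bits_mem)
  moreover have "(\<Union>i<m. {\<lambda>x. \<not> bit (u x) i}) = bits m ?w"
    unfolding bits_UN by (intro SUP_cong refl) (simp add: bw)
  ultimately have "computes ?H (bits m ?w) m" by simp
  then have "computes ?H (bits m ?w \<union> bits m v) (m + 0)" by (intro computes_Un computes_mem) auto
  from computes_let[OF this computes_adder]
  have "computes ?H {\<lambda>x. 2 ^ m \<le> take_bit m (?w x) + take_bit m (v x)} (m + 0 + (m * 40 + 1))"
    by (rule computes_weaken) auto
  moreover have "2 ^ m \<le> take_bit m (?w x) + take_bit m (v x) \<longleftrightarrow> u x < v x" for x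
  proof -
    have "?w x < 2 ^ m" by (simp add: mask_eq_exp_minus_1 less_imp_diff_less)
    then show ?thesis using assms(3)[of x] assms(4)[of x]
      by (auto simp: take_bit_nat_eq_self mask_eq_exp_minus_1)
  qed
  ultimately have "computes ?H {\<lambda>x. u x < v x} (m * 41 + 1)" by (simp add: ac_simps)
  from computes_let[OF computes_Un[OF assms(1,2)] this] show ?thesis .
qed

text \<open>The range bound excludes wrap-around, so the \<open>m\<close> bits determine the value
  and modular circuits compute exact natural-number operations.\<close>

definition num :: "nat \<Rightarrow> bfun set \<Rightarrow> (nat \<Rightarrow> nat) \<Rightarrow> nat \<Rightarrow> bool" where
  "num m G v k \<longleftrightarrow> (\<forall>x. v x < 2 ^ m) \<and> computes G (bits m v) k"

lemma num_const: "c < 2 ^ m \<Longrightarrow> num m G (\<lambda>x. c) m"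
  by (simp add: num_def computes_bits_const)

lemma num_self: "(\<And>x. v x < 2 ^ m) \<Longrightarrow> bits m v \<subseteq> G \<Longrightarrow> num m G v 0"
  by (simp add: num_def computes_mem)

lemma num_if:
  "computes G {b} i \<Longrightarrow> num m G u k \<Longrightarrow> num m G v j \<Longrightarrow>
    num m G (\<lambda>x. if b x then u x else v x) (i + k + j + m * 8)"
  by (simp add: num_def computes_bits_if)

lemma num_add:
  "num m G u k \<Longrightarrow> num m G v j \<Longrightarrow> (\<And>x. u x + v x < 2 ^ m) \<Longrightarrow>
    num m G (\<lambda>x. u x + v x) (k + j + (m * 40 + 1))"
  unfolding num_def using computes_bits_add by blast

lemma num_less:
  "num m G u k \<Longrightarrow> num m G v j \<Longrightarrow> computes G {\<lambda>x. u x < v x} (k + j + (m * 41 + 1))"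
  unfolding num_def using computes_less by blast

lemma num_let:
  assumes "num m G u k" "num m (bits m u) v j"
  shows "num m G v (k + j)"
  using assms computes_let unfolding num_def by blast

text \<open>Subtraction is addition of the two's complement \<open>2 ^ m - c\<close>; a comparison
  inserts the value \<open>0\<close> where subtraction of naturals is cut off.\<close>

lemma num_diff_const:
  assumes "num m G u k" "c < 2 ^ m"
  shows "num m G (\<lambda>x. u x - c) (k + (m * 92 + 2))"
proof -
  have u: "num m (bits m u) u 0" using assms by (intro num_self) (auto simp: num_def)
  have "computes (bits m u) {\<lambda>x. u x < c} (0 + m + (m * 41 + 1))"
    by (intro num_less u num_const assms)
  moreover have "computes (bits m u) (bits m (\<lambda>x. u x + (2 ^ m - c))) (0 + m + (m * 40 + 1))"
    by (intro computes_bits_add computes_bits_const computes_mem order_refl)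
  ultimately have "computes (bits m u) (bits m (\<lambda>x. if u x < c then 0 else u x + (2 ^ m - c)))
      ((0 + m + (m * 41 + 1)) + m + (0 + m + (m * 40 + 1)) + m * 8)"
    by (intro computes_bits_if computes_bits_const)
  then have "computes (bits m u) (bits m (\<lambda>x. u x - c)) (m * 92 + 2)"
  proof (rule computes_bits_weaken)
    fix x
    show "take_bit m (if u x < c then 0 else u x + (2 ^ m - c)) = take_bit m (u x - c)"
    proof (cases "u x < c")
      case False
      then have "u x + (2 ^ m - c) = (u x - c) + 2 ^ m" using assms(2) by simp
      then have "(u x + (2 ^ m - c)) mod 2 ^ m = (u x - c) mod 2 ^ m" by (simp only: mod_add_self2)
      then show ?thesis unfolding take_bit_eq_mod using False by (simp only: if_False)
    qed simp
  qed auto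
  moreover have "u x - c < 2 ^ m" for x using assms(1) by (simp add: num_def less_imp_diff_less)
  ultimately have "num m (bits m u) (\<lambda>x. u x - c) (m * 92 + 2)" by (simp add: num_def)
  from num_let[OF assms(1) this] show ?thesis by simp
qed

text \<open>Shift and add: the constant \<open>2 ^ j * c\<close> is wired in and switched on by bit
  \<open>j\<close> of \<open>u\<close>, so \<open>m\<close> additions suffice.\<close>

lemma num_mult_const:
  assumes "num m G u k" "\<And>x. u x * c < 2 ^ m"
  shows "num m G (\<lambda>x. u x * c) (k + (m * (m * 50 + 1) + m))"
proof -
  have "computes (bits m u) (bits m (\<lambda>x. take_bit j (u x) * c)) (j * (m * 50 + 1) + m)" if "j \<le> m" for j
    using that
  proof (induction j)
    case 0
    show ?case using computes_bits_const[of _ m 0] by simp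
  next
    case (Suc j)
    have "computes (bits m u) (bits m (\<lambda>x. take_bit j (u x) * c + (if bit (u x) j then 2 ^ j * c else 0)))
        (j * (m * 50 + 1) + m + (0 + m + m + m * 8) + (m * 40 + 1))"
      using Suc by (intro computes_bits_add computes_bits_if computes_bits_const Suc.IH computes_mem) (auto simp: bits_mem)
    then show ?case
      by (rule computes_bits_weaken) (auto simp: take_bit_Suc_from_most algebra_simps)
  qed
  from this[of m] have "computes (bits m u) (bits m (\<lambda>x. u x * c)) (m * (m * 50 + 1) + m)"
    using assms(1) by (simp add: num_def take_bit_nat_eq_self)
  then have "num m (bits m u) (\<lambda>x. u x * c) (m * (m * 50 + 1) + m)" using assms(2) by (simp add: num_def)
  from num_let[OF assms(1) this] show ?thesis .
qed

text \<open>Restoring long division. The remainders \<open>R i\<close> descend from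
  \<open>R m = u\<close> to \<open>R 0 = u mod c\<close>, and bit \<open>i\<close> of the quotient
  decides whether \<open>2 ^ i * c\<close> is subtracted from \<open>R (Suc i)\<close>.\<close>

lemma num_div_mod_const:
  assumes "num m G u k" "c > 0"
  shows "num m G (\<lambda>x. u x div c) (k + m * (m * 184 + 6))"
    and "num m G (\<lambda>x. u x mod c) (k + m * (m * 184 + 6))"
proof -
  have u: "u x < 2 ^ m" for x using assms(1) by (simp add: num_def)
  define R where "R i x = u x mod (2 ^ i * c)" for i x
  have R: "R i x < 2 ^ m" for i x unfolding R_def by (rule le_less_trans[OF _ u[of x]]) simp
  have Rm: "R m x = u x" for x
  proof -
    have "2 ^ m * 1 \<le> 2 ^ m * c" using assms(2) by (intro mult_left_mono) linarith+
    then have "u x < 2 ^ m * c" using u[of x] by linarith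
    then show ?thesis by (simp add: R_def)
  qed
  have split: "R (Suc i) x = 2 ^ i * c * of_bool (bit (u x div c) i) + R i x" for i x
  proof -
    have "u x mod (2 ^ i * c * 2) = 2 ^ i * c * (u x div (2 ^ i * c) mod 2) + u x mod (2 ^ i * c)"
      by (rule mod_mult2_eq)
    moreover have "u x div (2 ^ i * c) mod 2 = of_bool (bit (u x div c) i)"
      by (simp add: bit_iff_odd mod_2_eq_odd mult.commute[of _ c] div_mult2_eq)
    ultimately show ?thesis by (simp add: R_def mult_ac)
  qed
  have Ri: "R i x < 2 ^ i * c" for i x using assms(2) by (simp add: R_def)
  have step: "computes (bits m (R (Suc i))) (bits m (R i) \<union> {\<lambda>x. bit (u x div c) i}) (m * 184 + 6)" for i
  proof (cases "2 ^ i * c < 2 ^ m")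
    case True
    let ?H = "bits m (R (Suc i))"
    have r: "num m ?H (R (Suc i)) 0" using R by (intro num_self) auto
    have "computes ?H {\<lambda>x. R (Suc i) x < 2 ^ i * c} (0 + m + (m * 41 + 1))"
      by (intro num_less r num_const True)
    moreover have "(\<lambda>x. R (Suc i) x < 2 ^ i * c) = (\<lambda>x. \<not> bit (u x div c) i)"
    proof
      fix x show "R (Suc i) x < 2 ^ i * c \<longleftrightarrow> \<not> bit (u x div c) i"
        using Ri[of i x] split[of i x] by (cases "bit (u x div c) i") simp_all
    qed
    ultimately have b: "computes ?H {\<lambda>x. \<not> bit (u x div c) i} (m * 42 + 1)"
      by (simp add: mult.commute)
    have b': "computes ?H {\<lambda>x. bit (u x div c) i} (m * 42 + 2)"
      using computes_not[where f = "\<lambda>x. \<not> bit (u x div c) i", OF b] by simp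
    have "computes ?H (bits m (\<lambda>x. if bit (u x div c) i then R (Suc i) x - 2 ^ i * c else R (Suc i) x))
        ((m * 42 + 2) + (0 + (m * 92 + 2)) + 0 + m * 8)"
      using b' num_diff_const[OF r True] by (intro computes_bits_if computes_mem) (auto simp: num_def)
    then have "computes ?H (bits m (R i)) (m * 142 + 4)"
    proof (rule computes_bits_weaken)
      fix x show "take_bit m (if bit (u x div c) i then R (Suc i) x - 2 ^ i * c else R (Suc i) x) = take_bit m (R i x)"
        using split[of i x] by (cases "bit (u x div c) i") simp_all
    qed simp
    from computes_Un[OF this b'] show ?thesis by (rule computes_weaken) auto
  next
    \<comment> \<open>Here \<open>2 ^ i * c\<close> does not fit into \<open>m\<close> bits, but the
      remainder does; the quotient bit is then \<open>0\<close> and the remainder stays as it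
      is.\<close>
    case False
    then have *: "\<not> bit (u x div c) i" for x
      using split[of i x] R[of "Suc i" x] by (cases "bit (u x div c) i") simp_all
    have "R i x = R (Suc i) x" for x using split[of i x] * by simp
    then have "R i = R (Suc i)" by (rule ext)
    moreover have "(\<lambda>x. bit (u x div c) i) = (\<lambda>x. False)" using * by simp
    moreover have "computes (bits m (R i)) (bits m (R i) \<union> {\<lambda>x. False}) (0 + 1)"
      by (intro computes_Un computes_mem computes_const) simp
    ultimately show ?thesis by (simp only:) (erule computes_weaken; simp)
  qed
  have "computes (bits m u) (bits m (R (m - n)) \<union> (\<lambda>i x. bit (u x div c) i) ` {m - n..<m}) (n * (m * 184 + 6))"
    if "n \<le> m" for n
    using that
  proof (induction n)
    case 0
    have "R m = u" using Rm by auto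
    then show ?case by (simp add: computes_mem)
  next
    case (Suc n)
    let ?B = "\<lambda>n. (\<lambda>i x. bit (u x div c) i) ` {m - n..<m}"
    have e: "Suc (m - Suc n) = m - n" using Suc.prems by simp
    have "{m - Suc n..<m} = insert (m - Suc n) {m - n..<m}"
      using Suc.prems by auto
    then have B: "?B (Suc n) = insert (\<lambda>x. bit (u x div c) (m - Suc n)) (?B n)" by simp
    have "computes (bits m (R (m - n)) \<union> ?B n)
        (bits m (R (m - Suc n)) \<union> {\<lambda>x. bit (u x div c) (m - Suc n)}) (m * 184 + 6)"
      by (rule computes_mono[OF step[of "m - Suc n", unfolded e]]) simp
    moreover have "computes (bits m (R (m - n)) \<union> ?B n) (?B n) 0" by (rule computes_mem) simp
    ultimately have step': "computes (bits m (R (m - n)) \<union> ?B n)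
        (bits m (R (m - Suc n)) \<union> {\<lambda>x. bit (u x div c) (m - Suc n)} \<union> ?B n) (m * 184 + 6 + 0)"
      by (rule computes_Un)
    have IH: "computes (bits m u) (bits m (R (m - n)) \<union> ?B n) (n * (m * 184 + 6))"
      using Suc by simp
    have "computes (bits m u) (bits m (R (m - Suc n)) \<union> {\<lambda>x. bit (u x div c) (m - Suc n)} \<union> ?B n)
        (n * (m * 184 + 6) + (m * 184 + 6 + 0))"
      using IH step' by (rule computes_let)
    then show ?case unfolding B by (rule computes_weaken) auto
  qed
  from this[of m]
  have *: "computes (bits m u) (bits m (R 0) \<union> bits m (\<lambda>x. u x div c)) (m * (m * 184 + 6))"
    by (simp add: bits_def atLeast0LessThan)
  have "R 0 = (\<lambda>x. u x mod c)" by (simp add: R_def fun_eq_iff)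
  with * have "computes (bits m u) (bits m (\<lambda>x. u x mod c) \<union> bits m (\<lambda>x. u x div c)) (m * (m * 184 + 6))"
    by (simp only:)
  note computes_weaken[OF this]
  then have "computes (bits m u) (bits m (\<lambda>x. u x div c)) (m * (m * 184 + 6))"
    and "computes (bits m u) (bits m (\<lambda>x. u x mod c)) (m * (m * 184 + 6))"
    by simp_all
  moreover have "u x div c < 2 ^ m" "u x mod c < 2 ^ m" for x
    by (rule le_less_trans[OF _ u[of x]], simp)+
  ultimately have 1: "num m (bits m u) (\<lambda>x. u x div c) (m * (m * 184 + 6))"
    and 2: "num m (bits m u) (\<lambda>x. u x mod c) (m * (m * 184 + 6))" unfolding num_def by blast+
  show "num m G (\<lambda>x. u x div c) (k + m * (m * 184 + 6))" using assms(1) 1 by (rule num_let)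
  show "num m G (\<lambda>x. u x mod c) (k + m * (m * 184 + 6))" using assms(1) 2 by (rule num_let)
qed

lemma num_sum:
  assumes "\<And>i. i < d \<Longrightarrow> num m G (v i) k" "\<And>x. (\<Sum>i<d. v i x) < 2 ^ m"
  shows "num m G (\<lambda>x. \<Sum>i<d. v i x) (d * (k + (m * 40 + 1)) + m)"
  using assms
proof (induction d)
  case 0
  show ?case using num_const[of 0 m G] by simp
next
  case (Suc d)
  have *: "(\<Sum>i<d. v i x) < 2 ^ m" for x using Suc.prems(2)[of x] by simp
  have "num m G (\<lambda>x. (\<Sum>i<d. v i x) + v d x) ((d * (k + (m * 40 + 1)) + m) + k + (m * 40 + 1))"
    using Suc.prems(2) by (intro num_add Suc.IH *) (auto intro: Suc.prems)
  then show ?case by (simp add: ac_simps)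
qed


section \<open>Reversible circuits\<close>

type_synonym cgate = "nat list \<times> nat"

text \<open>These are the NOT, CNOT and Toffoli gates, given by their controls and target. Since the
  target is not among the controls, each gate is its own inverse.\<close>

definition valid_cgate :: "nat \<Rightarrow> cgate \<Rightarrow> bool" where
  "valid_cgate W g \<longleftrightarrow> length (fst g) \<le> 2 \<and> distinct (snd g # fst g) \<and> snd g < W \<and> set (fst g) \<subseteq> {..<W}"

definition flip_if :: "cgate \<Rightarrow> (nat \<Rightarrow> bool) \<Rightarrow> nat \<Rightarrow> bool" where
  "flip_if g \<sigma> = (if \<forall>c\<in>set (fst g). \<sigma> c then \<sigma>(snd g := \<not> \<sigma> (snd g)) else \<sigma>)"

abbreviation run :: "cgate list \<Rightarrow> (nat \<Rightarrow> bool) \<Rightarrow> nat \<Rightarrow> bool" where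
  "run \<equiv> fold flip_if"

definition flip_index :: "cgate \<Rightarrow> nat \<Rightarrow> nat" where
  "flip_index g x = (if \<forall>c\<in>set (fst g). bit x c then flip_bit (snd g) x else x)"

lemma bit_flip_index: "bit (flip_index g x) = flip_if g (bit x)"
  by (auto simp: flip_index_def flip_if_def bit_simps fun_eq_iff)

lemma bit_fold_flip_index: "bit (fold flip_index gs x) = run gs (bit x)"
  by (induction gs arbitrary: x) (auto simp: bit_flip_index)

lemma flip_if_involution: "valid_cgate W g \<Longrightarrow> flip_if g (flip_if g \<sigma>) = \<sigma>"
  by (auto simp: flip_if_def valid_cgate_def)

lemma run_rev: "\<forall>g\<in>set gs. valid_cgate W g \<Longrightarrow> run (rev gs) (run gs \<sigma>) = \<sigma>"
  by (induction gs arbitrary: \<sigma>) (auto simp: flip_if_involution)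

lemma valid_cgate_mono: "valid_cgate W g \<Longrightarrow> W \<le> W' \<Longrightarrow> valid_cgate W' g"
  by (auto simp: valid_cgate_def)

lemma run_other: "(\<And>g. g \<in> set gs \<Longrightarrow> snd g \<noteq> i) \<Longrightarrow> run gs \<sigma> i = \<sigma> i"
  by (induction gs arbitrary: \<sigma>) (auto simp: flip_if_def)

lemma run_agree:
  "\<forall>g\<in>set gs. valid_cgate m g \<Longrightarrow> (\<And>i. i < m \<Longrightarrow> \<sigma> i = \<tau> i) \<Longrightarrow> i < m \<Longrightarrow> run gs \<sigma> i = run gs \<tau> i"
proof (induction gs arbitrary: \<sigma> \<tau>)
  case (Cons g gs)
  have "(\<forall>c\<in>set (fst g). \<sigma> c) \<longleftrightarrow> (\<forall>c\<in>set (fst g). \<tau> c)"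
    using Cons.prems(1,2) by (auto simp: valid_cgate_def subset_iff)
  then have "flip_if g \<sigma> j = flip_if g \<tau> j" if "j < m" for j
    using Cons.prems(2)[OF that] by (cases "j = snd g") (simp_all add: flip_if_def)
  then have "run gs (flip_if g \<sigma>) i = run gs (flip_if g \<tau>) i"
    using Cons.prems(1,3) by (intro Cons.IH) auto
  then show ?case by simp
qed simp

abbreviation inputs :: "nat \<Rightarrow> bfun set" where
  "inputs n \<equiv> bits n (\<lambda>x. x)"

text \<open>Only the scratch wires \<open>n..<n + k\<close> have to start at \<open>False\<close>.
  Wires above them are arbitrary, so the circuit also works while a second register beyond the
  scratch space is occupied.\<close>

definition wire_computes :: "nat \<Rightarrow> nat \<Rightarrow> cgate list \<Rightarrow> bfun \<Rightarrow> nat \<Rightarrow> bool" where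
  "wire_computes n k gs f w \<longleftrightarrow>
     (\<forall>\<sigma> x. (\<forall>i<n. \<sigma> i = bit x i) \<longrightarrow> (\<forall>i\<in>{n..<n + k}. \<not> \<sigma> i) \<longrightarrow> run gs \<sigma> w = f x)"

lemma wire_computesD:
  "wire_computes n k gs f w \<Longrightarrow> (\<And>i. i < n \<Longrightarrow> \<sigma> i = bit x i) \<Longrightarrow>
    (\<And>i. n \<le> i \<Longrightarrow> i < n + k \<Longrightarrow> \<not> \<sigma> i) \<Longrightarrow> run gs \<sigma> w = f x"
  by (simp add: wire_computes_def)

lemma wire_computes_append:
  assumes "wire_computes n k gs f w" "\<And>g. g \<in> set gs' \<Longrightarrow> snd g \<noteq> w"
  shows "wire_computes n (Suc k) (gs @ gs') f w"
  unfolding wire_computes_def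
proof (intro allI impI)
  fix \<sigma> :: "nat \<Rightarrow> bool" and x :: nat
  assume "\<forall>i<n. \<sigma> i = bit x i" "\<forall>i\<in>{n..<n + Suc k}. \<not> \<sigma> i"
  then have "run gs \<sigma> w = f x" by (intro wire_computesD[OF assms(1)]) auto
  then show "run (gs @ gs') \<sigma> w = f x" using run_other[OF assms(2)] by simp
qed

definition compiled :: "nat \<Rightarrow> nat \<Rightarrow> cgate list \<Rightarrow> bfun set \<Rightarrow> bool" where
  "compiled n k gs H \<longleftrightarrow> (\<forall>g\<in>set gs. valid_cgate (n + k) g \<and> n \<le> snd g) \<and> length gs \<le> 2 * k \<and>
     (\<forall>f\<in>H. \<exists>w<n + k. wire_computes n k gs f w)"

lemma compiled_insert:
  assumes "compiled n k gs H" "wire_computes n (Suc k) (gs @ gs') f (n + k)" "length gs' \<le> 2"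
    and gs': "\<And>g. g \<in> set gs' \<Longrightarrow> valid_cgate (n + Suc k) g \<and> snd g = n + k"
  shows "compiled n (Suc k) (gs @ gs') (insert f H)"
  unfolding compiled_def
proof (intro conjI ballI)
  fix g assume "g \<in> set (gs @ gs')"
  then have "valid_cgate (n + Suc k) g \<and> n \<le> snd g"
    using assms(1) gs'[of g] valid_cgate_mono[of "n + k" g "n + Suc k"]
    by (cases "g \<in> set gs'") (simp_all add: compiled_def)
  then show "valid_cgate (n + Suc k) g" "n \<le> snd g" by auto
next
  show "length (gs @ gs') \<le> 2 * Suc k" using assms(1,3) by (simp add: compiled_def)
next
  fix h assume "h \<in> insert f H"
  then consider "h = f" | "h \<in> H" by blast
  then show "\<exists>w<n + Suc k. wire_computes n (Suc k) (gs @ gs') h w"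
  proof cases
    case 1
    then show ?thesis using assms(2) by (intro exI[of _ "n + k"]) simp
  next
    case 2
    then obtain w where w: "w < n + k" "wire_computes n k gs h w"
      using assms(1) unfolding compiled_def by blast
    have "wire_computes n (Suc k) (gs @ gs') h w"
      by (rule wire_computes_append[OF w(2)]) (use w(1) gs' in force)
    then show ?thesis using w(1) by (intro exI[of _ w]) simp
  qed
qed

lemma compiled_fresh:
  assumes "compiled n k gs H"
  shows "run gs \<sigma> (n + k) = \<sigma> (n + k)"
  using assms by (intro run_other) (auto simp: valid_cgate_def compiled_def)

text \<open>Each gate writes to the fresh wire \<open>n + k\<close>, which earlier gates leave alone
  and later ones only read. A NAND is a Toffoli followed by a NOT, whence the bound
  \<open>2 * k\<close> in \<open>compiled\<close>.\<close>

lemma nand_circuit_compile: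
  assumes "nand_circuit (inputs n) H k"
  shows "\<exists>gs. compiled n k gs H"
  using assms
proof induction
  case nand_circuit_base
  have "\<exists>w<n + 0. wire_computes n 0 [] f w" if "f \<in> inputs n" for f
  proof -
    from that obtain i where "i < n" "f = (\<lambda>x. bit x i)" by (auto simp: bits_def)
    then show ?thesis by (intro exI[of _ i]) (simp add: wire_computes_def)
  qed
  then have "compiled n 0 [] (inputs n)" by (simp add: compiled_def)
  then show ?case ..
next
  case (nand_circuit_const H k c)
  then obtain gs where gs: "compiled n k gs H" by blast
  have "compiled n (Suc k) (gs @ (if c then [([], n + k)] else [])) (insert (\<lambda>x. c) H)"
  proof (rule compiled_insert[OF gs])
    show "wire_computes n (Suc k) (gs @ (if c then [([], n + k)] else [])) (\<lambda>x. c) (n + k)"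
      by (simp add: wire_computes_def flip_if_def compiled_fresh[OF gs])
  qed (auto simp: valid_cgate_def split: if_splits)
  then show ?case ..
next
  case (nand_circuit_step H k f1 f2)
  then obtain gs where gs: "compiled n k gs H" by blast
  with nand_circuit_step.hyps(2,3) obtain w1 w2 where w: "w1 < n + k" "w2 < n + k"
      "wire_computes n k gs f1 w1" "wire_computes n k gs f2 w2"
    unfolding compiled_def by meson
  \<comment> \<open>Both operands may sit on the same wire; \<open>remdups\<close> then turns the
    Toffoli into a CNOT, because controls must be distinct.\<close>
  have "compiled n (Suc k) (gs @ [(remdups [w1, w2], n + k), ([], n + k)]) (insert (\<lambda>x. \<not> (f1 x \<and> f2 x)) H)"
  proof (rule compiled_insert[OF gs])
    show "wire_computes n (Suc k) (gs @ [(remdups [w1, w2], n + k), ([], n + k)])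
        (\<lambda>x. \<not> (f1 x \<and> f2 x)) (n + k)"
      unfolding wire_computes_def
    proof (intro allI impI)
      fix \<sigma> :: "nat \<Rightarrow> bool" and x :: nat
      assume "\<forall>i<n. \<sigma> i = bit x i" "\<forall>i\<in>{n..<n + Suc k}. \<not> \<sigma> i"
      then have "run gs \<sigma> w1 = f1 x" "run gs \<sigma> w2 = f2 x" "\<not> \<sigma> (n + k)"
        by (auto intro!: wire_computesD[OF w(3)] wire_computesD[OF w(4)])
      then show "run (gs @ [(remdups [w1, w2], n + k), ([], n + k)]) \<sigma> (n + k) = (\<not> (f1 x \<and> f2 x))"
        by (cases "w1 = w2") (auto simp: flip_if_def compiled_fresh[OF gs])
    qed
  next
    fix g assume "g \<in> set [(remdups [w1, w2], n + k), ([], n + k)]"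
    then consider "g = (remdups [w1, w2], n + k)" | "g = ([], n + k)" by auto
    then show "valid_cgate (n + Suc k) g \<and> snd g = n + k"
      by cases (use w(1,2) in \<open>auto simp: valid_cgate_def\<close>)
  qed simp
  then show ?case ..
qed

lemma run_copy:
  assumes "\<And>i. i < n \<Longrightarrow> w i < m"
  shows "run (map (\<lambda>i. ([w i], m + i)) [0..<n]) \<sigma> =
    (\<lambda>j. if m \<le> j \<and> j < m + n then \<sigma> j \<noteq> \<sigma> (w (j - m)) else \<sigma> j)"
  using assms
proof (induction n)
  case 0
  show ?case by (auto simp: fun_eq_iff)
next
  case (Suc n)
  then have "w n < m" and IH: "run (map (\<lambda>i. ([w i], m + i)) [0..<n]) \<sigma> =
    (\<lambda>j. if m \<le> j \<and> j < m + n then \<sigma> j \<noteq> \<sigma> (w (j - m)) else \<sigma> j)" by auto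
  have "run (map (\<lambda>i. ([w i], m + i)) [0..<Suc n]) \<sigma> =
      flip_if ([w n], m + n) (run (map (\<lambda>i. ([w i], m + i)) [0..<n]) \<sigma>)" by simp
  moreover define \<tau> where "\<tau> = run (map (\<lambda>i. ([w i], m + i)) [0..<n]) \<sigma>"
  ultimately have 1: "run (map (\<lambda>i. ([w i], m + i)) [0..<Suc n]) \<sigma> = flip_if ([w n], m + n) \<tau>" by simp
  have \<tau>: "\<tau> j = (if m \<le> j \<and> j < m + n then \<sigma> j \<noteq> \<sigma> (w (j - m)) else \<sigma> j)" for j
    by (simp add: \<tau>_def IH)
  show ?case
  proof
    fix j
    show "run (map (\<lambda>i. ([w i], m + i)) [0..<Suc n]) \<sigma> j =
        (if m \<le> j \<and> j < m + Suc n then \<sigma> j \<noteq> \<sigma> (w (j - m)) else \<sigma> j)"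
      unfolding 1 using \<open>w n < m\<close> by (cases "j = m + n") (simp_all add: flip_if_def \<tau>)
  qed
qed

lemma run_swap:
  assumes "n \<le> m"
  shows "run (concat (map (\<lambda>i. [([i], m + i), ([m + i], i), ([i], m + i)]) [0..<n])) \<sigma> =
    (\<lambda>j. if j < n then \<sigma> (m + j) else if m \<le> j \<and> j < m + n then \<sigma> (j - m) else \<sigma> j)"
  using assms
proof (induction n)
  case 0
  show ?case by (auto simp: fun_eq_iff)
next
  case (Suc n)
  have "run [([n], m + n), ([m + n], n), ([n], m + n)] \<tau> = \<tau>(n := \<tau> (m + n), m + n := \<tau> n)" for \<tau>
    using Suc.prems by (auto simp: flip_if_def fun_eq_iff)
  with Suc show ?case by (auto simp: fun_eq_iff less_Suc_eq)
qed

text \<open>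
  The permutation is computed into a second register, the two registers are swapped, and computing
  it once more clears the second register, because it is an involution.
\<close>

lemma involution_gates:
  assumes P: "\<And>x. x < 2 ^ n \<Longrightarrow> P x < 2 ^ n" "\<And>x. x < 2 ^ n \<Longrightarrow> P (P x) = x"
    and "computes (inputs n) (bits n P) k"
  obtains gs where "\<forall>g\<in>set gs. valid_cgate (n + k + n) g" "length gs \<le> 8 * k + 5 * n"
    "\<And>x. x < 2 ^ n \<Longrightarrow> fold flip_index gs x = P x"
proof -
  from assms(3) obtain H k' where k': "k' \<le> k" "bits n P \<subseteq> H" "nand_circuit (inputs n) H k'"
    unfolding computes_def by blast
  from nand_circuit_compile[OF k'(3)] obtain gs where cg: "compiled n k' gs H" ..
  then have gs: "\<forall>g\<in>set gs. valid_cgate (n + k') g \<and> n \<le> snd g" and len: "length gs \<le> 2 * k'"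
    by (auto simp: compiled_def)
  let ?m = "n + k'"
  have "\<exists>w<?m. wire_computes n k' gs (\<lambda>x. bit (P x) i) w" if "i < n" for i
    using cg bits_mem[OF that, of P] k'(2) unfolding compiled_def by blast
  then obtain w where w: "\<And>i. i < n \<Longrightarrow> w i < ?m"
    and wP: "\<And>i. i < n \<Longrightarrow> wire_computes n k' gs (\<lambda>x. bit (P x) i) (w i)"
    by metis
  \<comment> \<open>\<open>S\<close> describes the states with a clean scratch space: one bit string
    on the data wires, another on the second register.\<close>
  define S where "S \<alpha> \<beta> = (\<lambda>i. if i < n then \<alpha> i else if ?m \<le> i \<and> i < ?m + n then \<beta> (i - ?m) else False)"
    for \<alpha> \<beta> :: "nat \<Rightarrow> bool"
  let ?copy = "map (\<lambda>i. ([w i], ?m + i)) [0..<n]"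
  let ?C = "gs @ ?copy @ rev gs"
  let ?swap = "concat (map (\<lambda>i. [([i], ?m + i), ([?m + i], i), ([i], ?m + i)]) [0..<n])"
  \<comment> \<open>Compute, XOR the outputs into the second register, uncompute. The copying gates
    change only wires from \<open>?m\<close> on, which \<open>rev gs\<close> neither reads nor
    writes, so the uncomputation is exact.\<close>
  have C: "run ?C (S (bit x) \<beta>) = S (bit x) (\<lambda>i. \<beta> i \<noteq> bit (P x) i)" (is "?l = ?r") for x \<beta>
  proof
    fix j
    let ?\<sigma> = "S (bit x) \<beta>"
    let ?\<tau> = "run gs ?\<sigma>"
    have t: "?\<tau> (w i) = bit (P x) i" if "i < n" for i
      by (rule wire_computesD[OF wP[OF that]]) (auto simp: S_def)
    have c: "run ?copy ?\<tau> = (\<lambda>j. if ?m \<le> j \<and> j < ?m + n then ?\<tau> j \<noteq> ?\<tau> (w (j - ?m)) else ?\<tau> j)"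
      by (rule run_copy[OF w])
    show "?l j = ?r j"
    proof (cases "j < ?m")
      case True
      have "run (rev gs) (run ?copy ?\<tau>) j = run (rev gs) ?\<tau> j"
        using True gs by (intro run_agree[of _ ?m]) (auto simp: c)
      also have "\<dots> = ?\<sigma> j" using run_rev[of gs ?m] gs by auto
      finally show ?thesis using True by (simp add: S_def)
    next
      case False
      then have o: "run (rev gs) \<tau> j = \<tau> j" "run gs \<tau> j = \<tau> j" for \<tau>
        using gs by (intro run_other; force simp: valid_cgate_def)+
      have "?l j = (if ?m \<le> j \<and> j < ?m + n then ?\<sigma> j \<noteq> ?\<tau> (w (j - ?m)) else ?\<sigma> j)"
        by (simp only: fold_append comp_apply o(1) c) (simp only: o(2))
      also have "\<dots> = ?r j"
      proof (cases "j < ?m + n")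
        case True
        then have "j - ?m < n" using False by simp
        from t[OF this] show ?thesis using True False by (simp add: S_def)
      qed (use False in \<open>simp add: S_def\<close>)
      finally show ?thesis .
    qed
  qed
  have sw: "run ?swap (S \<alpha> \<beta>) = S \<beta> \<alpha>" for \<alpha> \<beta>
    by (subst run_swap) (auto simp: S_def fun_eq_iff)
  let ?gs = "?C @ ?swap @ ?C"
  show ?thesis
  proof (rule that[of ?gs])
    have v: "valid_cgate (n + k + n) g" if "g \<in> set gs" for g
      using gs that k'(1) valid_cgate_mono[of ?m g "n + k + n"] by auto
    have "valid_cgate (n + k + n) ([w i], ?m + i)" if "i < n" for i
      using w[OF that] that k'(1) by (auto simp: valid_cgate_def)
    moreover have "valid_cgate (n + k + n) ([i], ?m + i)" "valid_cgate (n + k + n) ([?m + i], i)" if "i < n" for i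
      using that k'(1) by (auto simp: valid_cgate_def)
    ultimately show "\<forall>g\<in>set ?gs. valid_cgate (n + k + n) g"
      using v by auto
    have "length (concat (map (\<lambda>i. [([i], ?m + i), ([?m + i], i), ([i], ?m + i)]) xs)) = 3 * length xs"
      for xs by (induction xs) auto
    then have "length ?swap = 3 * n" by simp
    then show "length ?gs \<le> 8 * k + 5 * n" using len k'(1) by simp
  next
    fix x :: nat assume x: "x < 2 ^ n"
    have b: "bit y = S (bit y) (\<lambda>_. False)" if "y < 2 ^ n" for y :: nat
    proof
      fix i show "bit y i = S (bit y) (\<lambda>_. False) i"
        using that bit_take_bit_iff[of n y i] by (auto simp: S_def take_bit_nat_eq_self)
    qed
    have "run ?gs (bit x) = run ?C (run ?swap (run ?C (bit x)))"
      by simp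
    also have "\<dots> = S (bit (P x)) (\<lambda>i. bit x i \<noteq> bit (P (P x)) i)"
    proof -
      have "run ?C (bit x) = S (bit x) (bit (P x))"
        using C[of x "\<lambda>_. False"] b[OF x] by simp
      then show ?thesis by (simp only: C sw)
    qed
    also have "\<dots> = bit (P x)" using b[OF P(1)[OF x]] P(2)[OF x] by simp
    finally show "fold flip_index ?gs x = P x"
      by (intro bit_eqI) (simp only: bit_fold_flip_index)
  qed
qed


section \<open>Quantum gates\<close>

type_synonym qgate = "bool \<Rightarrow> bool \<Rightarrow> complex"
type_synonym amp = "nat \<Rightarrow> complex"

definition put_bit :: "nat \<Rightarrow> bool \<Rightarrow> nat \<Rightarrow> nat" where
  "put_bit t b x = (if b then set_bit t x else unset_bit t x)"

lemma bit_put_bit: "bit (put_bit t b x) i = (if i = t then b else bit x i)"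
  by (auto simp: put_bit_def bit_simps)

lemma nat_less_exp_iff_bit: "x < 2 ^ n \<longleftrightarrow> (\<forall>i\<ge>n. \<not> bit x i)" for x :: nat
proof
  assume "x < 2 ^ n"
  then have "take_bit n x = x" by (simp add: take_bit_nat_eq_self)
  then show "\<forall>i\<ge>n. \<not> bit x i" by (metis bit_take_bit_iff not_less)
next
  assume a: "\<forall>i\<ge>n. \<not> bit x i"
  have "take_bit n x = x" by (rule bit_eqI) (use a in \<open>auto simp: bit_take_bit_iff not_less[symmetric]\<close>)
  then show "x < 2 ^ n" by (metis take_bit_nat_less_exp)
qed

lemma put_bit_less: "t < n \<Longrightarrow> put_bit t b x < 2 ^ n \<longleftrightarrow> (\<forall>i\<ge>n. \<not> bit x i)"
  unfolding nat_less_exp_iff_bit by (auto simp: bit_put_bit)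

lemma put_bit_less': "t < n \<Longrightarrow> put_bit t b x < 2 ^ n \<longleftrightarrow> x < 2 ^ n"
  by (simp add: put_bit_less flip: nat_less_exp_iff_bit)

lemma put_bit_same: "put_bit t (bit x t) x = x"
  by (rule bit_eqI) (simp add: bit_put_bit)

lemma put_bit_put_bit: "put_bit t b (put_bit t c x) = put_bit t b x"
  by (rule bit_eqI) (simp add: bit_put_bit)

text \<open>Amplitudes are functions on all naturals, so a gate acts without reference to the number
  of qubits; matrices enter only through \<open>embed_apply1\<close> and
  \<open>embed_applyc\<close>.\<close>

definition apply1 :: "qgate \<Rightarrow> nat \<Rightarrow> amp \<Rightarrow> amp" where
  "apply1 g t \<psi> x = g (bit x t) False * \<psi> (put_bit t False x) + g (bit x t) True * \<psi> (put_bit t True x)"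

definition applyc :: "qgate \<Rightarrow> nat \<Rightarrow> nat \<Rightarrow> amp \<Rightarrow> amp" where
  "applyc g c t \<psi> x = (if bit x c then apply1 g t \<psi> x else \<psi> x)"

definition unitary_gate :: "qgate \<Rightarrow> bool" where
  "unitary_gate g \<longleftrightarrow>
     (\<forall>i j. cnj (g False i) * g False j + cnj (g True i) * g True j = of_bool (i = j)) \<and>
     (\<forall>i j. g i False * cnj (g j False) + g i True * cnj (g j True) = of_bool (i = j))"

definition gate_mat :: "qgate \<Rightarrow> complex mat" where
  "gate_mat g = mat 2 2 (\<lambda>(i, j). g (odd i) (odd j))"

definition controlled_mat :: "qgate \<Rightarrow> complex mat" where
  "controlled_mat g = mat 4 4 (\<lambda>(i, j). if i < 2 \<and> j < 2 then of_bool (i = j)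
     else if 2 \<le> i \<and> 2 \<le> j then g (odd i) (odd j) else 0)"

lemma mat_adjoint_eq: "mat_adjoint A = mat (dim_col A) (dim_row A) (\<lambda>(i, j). cnj (A $$ (j, i)))"
  unfolding mat_adjoint_def by (rule eq_matI) (auto simp: mat_of_rows_index)

lemma unitary_mat_mat:
  assumes "\<And>i j. i < n \<Longrightarrow> j < n \<Longrightarrow> (\<Sum>k<n. cnj (f (k, i)) * f (k, j)) = of_bool (i = j)"
    and "\<And>i j. i < n \<Longrightarrow> j < n \<Longrightarrow> (\<Sum>k<n. f (i, k) * cnj (f (j, k))) = of_bool (i = j)"
  shows "unitary_mat n (mat n n f)"
  unfolding unitary_mat_def mat_adjoint_eq
  by (auto simp: scalar_prod_def atLeast0LessThan assms intro!: eq_matI)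

lemma sum_less_2: "(\<Sum>k<2. F k) = F 0 + F (1::nat)" for F :: "nat \<Rightarrow> complex"
  by (simp add: numeral_2_eq_2)

lemma sum_less_4: "(\<Sum>k<4. F k) = F 0 + F 1 + F 2 + F (3::nat)" for F :: "nat \<Rightarrow> complex"
  by (simp add: eval_nat_numeral)

lemma less_2_cases: "i < 2 \<Longrightarrow> i = 0 \<or> i = (1::nat)"
  by auto

lemma less_4_cases: "i < 4 \<Longrightarrow> i = 0 \<or> i = 1 \<or> i = 2 \<or> i = (3::nat)"
  by auto

lemma unitary_gate_mat:
  assumes "unitary_gate g"
  shows "unitary_mat 2 (gate_mat g)"
  unfolding gate_mat_def
  by (rule unitary_mat_mat; drule less_2_cases; drule less_2_cases; elim disjE; hypsubst)
     (use assms in \<open>simp_all add: sum_less_2 unitary_gate_def\<close>)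

lemma unitary_controlled_mat:
  assumes "unitary_gate g"
  shows "unitary_mat 4 (controlled_mat g)"
  unfolding controlled_mat_def
  by (rule unitary_mat_mat; drule less_4_cases; drule less_4_cases; elim disjE; hypsubst)
     (use assms in \<open>simp_all add: sum_less_4 unitary_gate_def\<close>)

text \<open>Row \<open>x\<close> of a gate on qubit \<open>t\<close> sees only the two indices that
  agree with \<open>x\<close> on the other qubits, which collapses matrix-vector products to two
  terms.\<close>

lemma sum_put_bit:
  fixes F :: "nat \<Rightarrow> complex"
  assumes "t < W" "x < 2 ^ W" "\<And>y. y < 2 ^ W \<Longrightarrow> \<exists>k<W. k \<noteq> t \<and> bit x k \<noteq> bit y k \<Longrightarrow> F y = 0"
  shows "(\<Sum>y<2 ^ W. F y) = F (put_bit t False x) + F (put_bit t True x)"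
proof -
  have "(\<Sum>y<2 ^ W. F y) = (\<Sum>y\<in>{put_bit t False x, put_bit t True x}. F y)"
  proof (rule sum.mono_neutral_right)
    show "\<forall>y\<in>{..<2 ^ W} - {put_bit t False x, put_bit t True x}. F y = 0"
    proof
      fix y :: nat assume y: "y \<in> {..<2 ^ W} - {put_bit t False x, put_bit t True x}"
      then have "y \<noteq> put_bit t (bit y t) x" by (cases "bit y t") auto
      then obtain k where k: "bit y k \<noteq> bit (put_bit t (bit y t) x) k" by (metis bit_eqI)
      then have "k \<noteq> t \<and> bit x k \<noteq> bit y k" by (auto simp: bit_put_bit split: if_splits)
      moreover have "k < W"
        using calculation y assms(2) nat_less_exp_iff_bit by (metis DiffD1 lessThan_iff linorder_not_less)
      ultimately show "F y = 0" using assms(3) y by blast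
    qed
  qed (use assms put_bit_less' in auto)
  moreover have "put_bit t False x \<noteq> put_bit t True x" by (metis bit_put_bit)
  ultimately show ?thesis by simp
qed

lemma embed_apply1:
  assumes "t < W"
  shows "embed_gate W [t] (gate_mat g) *\<^sub>v vec (2 ^ W) \<psi> = vec (2 ^ W) (apply1 g t \<psi>)"
proof (rule eq_vecI)
  fix x assume "x < dim_vec (vec (2 ^ W) (apply1 g t \<psi>))"
  then have x: "x < 2 ^ W" by simp
  have li: "local_index [t] y = of_bool (bit y t)" for y by (simp add: local_index_def)
  let ?F = "\<lambda>y. embed_gate W [t] (gate_mat g) $$ (x, y) * \<psi> y"
  have "(embed_gate W [t] (gate_mat g) *\<^sub>v vec (2 ^ W) \<psi>) $ x = (\<Sum>y<2 ^ W. ?F y)"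
    using x by (simp add: mult_mat_vec_def scalar_prod_def embed_gate_def atLeast0LessThan)
  also have "\<dots> = ?F (put_bit t False x) + ?F (put_bit t True x)"
    using x assms by (intro sum_put_bit) (auto simp: embed_gate_def)
  also have "\<dots> = apply1 g t \<psi> x"
    using x assms by (simp add: embed_gate_def put_bit_less' bit_put_bit li gate_mat_def apply1_def)
  finally show "(embed_gate W [t] (gate_mat g) *\<^sub>v vec (2 ^ W) \<psi>) $ x = vec (2 ^ W) (apply1 g t \<psi>) $ x"
    using x by simp
qed (simp add: embed_gate_def)

lemma embed_applyc:
  assumes "t < W" "c < W" "c \<noteq> t"
  shows "embed_gate W [t, c] (controlled_mat g) *\<^sub>v vec (2 ^ W) \<psi> = vec (2 ^ W) (applyc g c t \<psi>)"
proof (rule eq_vecI)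
  fix x assume "x < dim_vec (vec (2 ^ W) (applyc g c t \<psi>))"
  then have x: "x < 2 ^ W" by simp
  have li: "local_index [t, c] y = of_bool (bit y t) + 2 * of_bool (bit y c)" for y
    by (simp add: local_index_def)
  let ?F = "\<lambda>y. embed_gate W [t, c] (controlled_mat g) $$ (x, y) * \<psi> y"
  have "(embed_gate W [t, c] (controlled_mat g) *\<^sub>v vec (2 ^ W) \<psi>) $ x = (\<Sum>y<2 ^ W. ?F y)"
    using x by (simp add: mult_mat_vec_def scalar_prod_def embed_gate_def atLeast0LessThan)
  \<comment> \<open>Although the gate touches two qubits, its matrix is block diagonal in the
    control, so again only bit \<open>t\<close> may differ.\<close>
  also have "\<dots> = ?F (put_bit t False x) + ?F (put_bit t True x)"
  proof (rule sum_put_bit[OF assms(1) x])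
    fix y assume "(y::nat) < 2 ^ W" "\<exists>k<W. k \<noteq> t \<and> bit x k \<noteq> bit y k"
    then show "?F y = 0" using x
      by (cases "bit x c"; cases "bit y c") (auto simp: embed_gate_def li controlled_mat_def)
  qed
  also have "\<dots> = applyc g c t \<psi> x"
    using x assms put_bit_same[of t x]
    by (cases "bit x t"; cases "bit x c")
       (simp_all add: embed_gate_def put_bit_less' bit_put_bit li controlled_mat_def apply1_def applyc_def)
  finally show "(embed_gate W [t, c] (controlled_mat g) *\<^sub>v vec (2 ^ W) \<psi>) $ x = vec (2 ^ W) (applyc g c t \<psi>) $ x"
    using x by simp
qed (simp add: embed_gate_def)

definition realizes :: "nat \<Rightarrow> complex mat list \<Rightarrow> (amp \<Rightarrow> amp) \<Rightarrow> bool" where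
  "realizes W Ms \<Phi> \<longleftrightarrow> quantum_circuit W Ms \<and>
     (\<forall>\<psi>. fold (\<lambda>M v. M *\<^sub>v v) Ms (vec (2 ^ W) \<psi>) = vec (2 ^ W) (\<Phi> \<psi>))"

lemma realizes_Nil: "realizes W [] (\<lambda>\<psi>. \<psi>)"
  by (simp add: realizes_def quantum_circuit_def)

lemma realizes_append:
  "realizes W Ms \<Phi> \<Longrightarrow> realizes W Ms' \<Phi>' \<Longrightarrow> realizes W (Ms @ Ms') (\<lambda>\<psi>. \<Phi>' (\<Phi> \<psi>))"
  by (auto simp: realizes_def quantum_circuit_def)

lemma realizes_apply1:
  assumes "t < W" "unitary_gate g"
  shows "realizes W [embed_gate W [t] (gate_mat g)] (apply1 g t)"
  unfolding realizes_def quantum_circuit_def elementary_gate_def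
  using assms unitary_gate_mat[OF assms(2)] embed_apply1[OF assms(1)]
  by (auto intro!: exI[of _ "[t]"] exI[of _ "gate_mat g"])

lemma realizes_applyc:
  assumes "t < W" "c < W" "c \<noteq> t" "unitary_gate g"
  shows "realizes W [embed_gate W [t, c] (controlled_mat g)] (applyc g c t)"
  unfolding realizes_def quantum_circuit_def elementary_gate_def
  using assms unitary_controlled_mat[OF assms(4)] embed_applyc[OF assms(1-3)]
  by (auto intro!: exI[of _ "[t, c]"] exI[of _ "controlled_mat g"])

definition X_gate :: qgate where "X_gate i j = of_bool (i \<noteq> j)"

definition sqrtX_gate :: qgate where
  "sqrtX_gate i j = (if i = j then Complex (1/2) (1/2) else Complex (1/2) (-1/2))"

definition sqrtX_inv_gate :: qgate where
  "sqrtX_inv_gate i j = (if i = j then Complex (1/2) (-1/2) else Complex (1/2) (1/2))"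

definition reflection_gate :: "real \<Rightarrow> real \<Rightarrow> qgate" where
  "reflection_gate c s i j = (if i = j then (if i then - of_real c else of_real c) else of_real s)"

lemma unitary_X: "unitary_gate X_gate"
  by (auto simp: unitary_gate_def X_gate_def)

lemma unitary_sqrtX: "unitary_gate sqrtX_gate" "unitary_gate sqrtX_inv_gate"
  by (auto simp: unitary_gate_def sqrtX_gate_def sqrtX_inv_gate_def complex_eq_iff)

lemma unitary_reflection: "c\<^sup>2 + s\<^sup>2 = 1 \<Longrightarrow> unitary_gate (reflection_gate c s)"
  by (auto simp: unitary_gate_def reflection_gate_def power2_eq_square add.commute simp flip: of_real_mult of_real_add)

text \<open>With \<open>V\<close> the square root of \<open>X\<close>, the target undergoes
  \<open>V\<close> to the power \<open>b - (a XOR b) + a\<close>, reading the control bits as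
  numbers. This exponent is \<open>2\<close> if both bits are set and \<open>0\<close>
  otherwise.\<close>

lemma toffoli_decomposition:
  assumes "a \<noteq> b" "a \<noteq> t" "b \<noteq> t"
  shows "applyc sqrtX_gate a t (applyc X_gate a b (applyc sqrtX_inv_gate b t (applyc X_gate a b
     (applyc sqrtX_gate b t \<psi>)))) = (\<lambda>x. \<psi> (flip_index ([a, b], t) x))"
proof
  fix x
  have f: "flip_bit t x = put_bit t (\<not> bit x t) x" for t
    by (rule bit_eqI) (simp add: bit_put_bit bit_simps)
  have s: "put_bit t (bit x t) x = x" "put_bit b (bit x b) x = x" by (rule put_bit_same)+
  have c: "put_bit b q (put_bit t p y) = put_bit t p (put_bit b q y)" for p q y
    by (rule bit_eqI) (use assms in \<open>simp add: bit_put_bit\<close>)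
  have q: "Complex (1/2) (1/2) * Complex (1/2) (1/2) = Complex 0 (1/2)"
    "Complex (1/2) (-1/2) * Complex (1/2) (-1/2) = Complex 0 (-1/2)"
    "Complex (1/2) (1/2) * Complex (1/2) (-1/2) = Complex (1/2) 0"
    by (simp_all add: complex_eq_iff)
  show "applyc sqrtX_gate a t (applyc X_gate a b (applyc sqrtX_inv_gate b t (applyc X_gate a b
     (applyc sqrtX_gate b t \<psi>)))) x = \<psi> (flip_index ([a, b], t) x)"
    using assms s
    apply (cases "bit x a"; cases "bit x b"; cases "bit x t")
    apply (simp_all add: applyc_def apply1_def X_gate_def sqrtX_gate_def sqrtX_inv_gate_def bit_put_bit flip_index_def
      f put_bit_put_bit c)
    apply (simp_all add: complex_eq_iff algebra_simps)
    done
qed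


section \<open>Implementable operations\<close>

definition supported :: "nat \<Rightarrow> amp \<Rightarrow> bool" where
  "supported n \<psi> \<longleftrightarrow> (\<forall>x\<ge>2 ^ n. \<psi> x = 0)"

definition iprod :: "nat \<Rightarrow> amp \<Rightarrow> amp \<Rightarrow> complex" where
  "iprod n \<psi> \<phi> = (\<Sum>x<2 ^ n. cnj (\<psi> x) * \<phi> x)"

definition impl :: "nat \<Rightarrow> nat \<Rightarrow> nat \<Rightarrow> (amp \<Rightarrow> amp) \<Rightarrow> bool" where
  "impl n a K \<Phi> \<longleftrightarrow>
     (\<forall>\<psi>. supported n \<psi> \<longrightarrow> supported n (\<Phi> \<psi>)) \<and>
     (\<forall>\<psi> \<phi>. supported n \<psi> \<longrightarrow> supported n \<phi> \<longrightarrow> iprod n (\<Phi> \<psi>) (\<Phi> \<phi>) = iprod n \<psi> \<phi>) \<and>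
     (\<exists>Ms. length Ms \<le> K \<and> quantum_circuit (a + n) Ms \<and>
       (\<forall>\<psi>. supported n \<psi> \<longrightarrow>
         fold (\<lambda>M v. M *\<^sub>v v) Ms (vec (2 ^ (a + n)) \<psi>) = vec (2 ^ (a + n)) (\<Phi> \<psi>)))"

lemma impl_supported: "impl n a K \<Phi> \<Longrightarrow> supported n \<psi> \<Longrightarrow> supported n (\<Phi> \<psi>)"
  by (simp add: impl_def)

lemma impl_weaken: "impl n a K \<Phi> \<Longrightarrow> K \<le> K' \<Longrightarrow> impl n a K' \<Phi>"
  unfolding impl_def by (meson order_trans)

lemma impl_id: "impl n a 0 (\<lambda>\<psi>. \<psi>)"
  unfolding impl_def by (intro conjI exI[of _ "[]"]) (auto simp: quantum_circuit_def)

lemma impl_compose: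
  assumes "impl n a K \<Phi>" "impl n a K' \<Phi>'"
  shows "impl n a (K + K') (\<lambda>\<psi>. \<Phi>' (\<Phi> \<psi>))"
proof -
  obtain Ms where Ms: "length Ms \<le> K" "quantum_circuit (a + n) Ms"
      "\<And>\<psi>. supported n \<psi> \<Longrightarrow> fold (\<lambda>M v. M *\<^sub>v v) Ms (vec (2 ^ (a + n)) \<psi>) = vec (2 ^ (a + n)) (\<Phi> \<psi>)"
    using assms(1) unfolding impl_def by blast
  obtain Ms' where Ms': "length Ms' \<le> K'" "quantum_circuit (a + n) Ms'"
      "\<And>\<psi>. supported n \<psi> \<Longrightarrow> fold (\<lambda>M v. M *\<^sub>v v) Ms' (vec (2 ^ (a + n)) \<psi>) = vec (2 ^ (a + n)) (\<Phi>' \<psi>)"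
    using assms(2) unfolding impl_def by blast
  have "quantum_circuit (a + n) (Ms @ Ms')" using Ms(2) Ms'(2) by (auto simp: quantum_circuit_def)
  moreover have "fold (\<lambda>M v. M *\<^sub>v v) (Ms @ Ms') (vec (2 ^ (a + n)) \<psi>) = vec (2 ^ (a + n)) (\<Phi>' (\<Phi> \<psi>))"
    if "supported n \<psi>" for \<psi>
    using Ms(3)[OF that] Ms'(3)[OF impl_supported[OF assms(1) that]] by simp
  moreover have "length (Ms @ Ms') \<le> K + K'" using Ms(1) Ms'(1) by simp
  ultimately have "\<exists>Ms. length Ms \<le> K + K' \<and> quantum_circuit (a + n) Ms \<and>
       (\<forall>\<psi>. supported n \<psi> \<longrightarrow>
         fold (\<lambda>M v. M *\<^sub>v v) Ms (vec (2 ^ (a + n)) \<psi>) = vec (2 ^ (a + n)) (\<Phi>' (\<Phi> \<psi>)))"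
    by blast
  then show ?thesis using assms unfolding impl_def by simp
qed

lemma impl_fold:
  assumes "\<And>i. i \<in> set xs \<Longrightarrow> impl n a K (\<Phi> i)"
  shows "impl n a (length xs * K) (fold \<Phi> xs)"
  using assms
proof (induction xs)
  case Nil
  show ?case using impl_id by (simp add: id_def)
next
  case (Cons i xs)
  have "impl n a (K + length xs * K) (\<lambda>\<psi>. fold \<Phi> xs (\<Phi> i \<psi>))"
    by (intro impl_compose Cons) (auto intro: Cons.prems)
  then show ?case by (simp add: o_def)
qed

lemma sum_pairs:
  fixes f :: "nat \<Rightarrow> complex"
  assumes "t < n"
  shows "(\<Sum>x<2 ^ n. f x) = (\<Sum>x\<in>{x. x < 2 ^ n \<and> \<not> bit x t}. f x + f (put_bit t True x))"
proof -
  have "(\<Sum>x<2 ^ n. f x) = (\<Sum>x\<in>{x. x < 2 ^ n \<and> \<not> bit x t} \<union> {x. x < 2 ^ n \<and> bit x t}. f x)"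
    by (rule sum.cong) auto
  also have "\<dots> = (\<Sum>x\<in>{x. x < 2 ^ n \<and> \<not> bit x t}. f x) + (\<Sum>x\<in>{x. x < 2 ^ n \<and> bit x t}. f x)"
    by (rule sum.union_disjoint) auto
  also have "(\<Sum>x\<in>{x. x < 2 ^ n \<and> bit x t}. f x) = (\<Sum>x\<in>{x. x < 2 ^ n \<and> \<not> bit x t}. f (put_bit t True x))"
  proof (rule sum.reindex_bij_witness[of _ "put_bit t True" "put_bit t False"])
    fix x :: nat assume "x \<in> {x. x < 2 ^ n \<and> bit x t}"
    then show "put_bit t True (put_bit t False x) = x" using put_bit_same[of t x] by (simp add: put_bit_put_bit)
    then show "f (put_bit t True (put_bit t False x)) = f x" by simp
    show "put_bit t False x \<in> {x. x < 2 ^ n \<and> \<not> bit x t}"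
      using \<open>x \<in> _\<close> assms by (simp add: put_bit_less' bit_put_bit)
  next
    fix x :: nat assume "x \<in> {x. x < 2 ^ n \<and> \<not> bit x t}"
    then show "put_bit t False (put_bit t True x) = x" using put_bit_same[of t x] by (simp add: put_bit_put_bit)
    show "put_bit t True x \<in> {x. x < 2 ^ n \<and> bit x t}"
      using \<open>x \<in> _\<close> assms by (simp add: put_bit_less' bit_put_bit)
  qed
  finally show ?thesis by (simp add: sum.distrib)
qed

lemma unitary_gate_iprod:
  assumes "unitary_gate g"
  shows "cnj (g False False * a + g False True * b) * (g False False * a' + g False True * b') +
    cnj (g True False * a + g True True * b) * (g True False * a' + g True True * b') = cnj a * a' + cnj b * b'"
proof -
  have u: "cnj (g False i) * g False j + cnj (g True i) * g True j = of_bool (i = j)" for i j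
    using assms by (simp add: unitary_gate_def)
  have "cnj (g False False * a + g False True * b) * (g False False * a' + g False True * b') +
    cnj (g True False * a + g True True * b) * (g True False * a' + g True True * b') =
    (cnj (g False False) * g False False + cnj (g True False) * g True False) * (cnj a * a') +
    (cnj (g False False) * g False True + cnj (g True False) * g True True) * (cnj a * b') +
    (cnj (g False True) * g False False + cnj (g True True) * g True False) * (cnj b * a') +
    (cnj (g False True) * g False True + cnj (g True True) * g True True) * (cnj b * b')"
    by (simp add: algebra_simps)
  then show ?thesis unfolding u by simp
qed

lemma iprod_apply1:
  assumes "t < n" "unitary_gate g"
  shows "iprod n (apply1 g t \<psi>) (apply1 g t \<phi>) = iprod n \<psi> \<phi>"
  unfolding iprod_def sum_pairs[OF assms(1)]
proof (rule sum.cong[OF refl])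
  fix x :: nat assume "x \<in> {x. x < 2 ^ n \<and> \<not> bit x t}"
  then have "\<not> bit x t" "put_bit t False x = x" using put_bit_same[of t x] by auto
  then show "cnj (apply1 g t \<psi> x) * apply1 g t \<phi> x +
      cnj (apply1 g t \<psi> (put_bit t True x)) * apply1 g t \<phi> (put_bit t True x) =
      cnj (\<psi> x) * \<phi> x + cnj (\<psi> (put_bit t True x)) * \<phi> (put_bit t True x)"
    by (simp only: apply1_def bit_put_bit put_bit_put_bit simp_thms if_True unitary_gate_iprod[OF assms(2)])
qed

lemma iprod_applyc:
  assumes "t < n" "c \<noteq> t" "unitary_gate g"
  shows "iprod n (applyc g c t \<psi>) (applyc g c t \<phi>) = iprod n \<psi> \<phi>"
  unfolding iprod_def sum_pairs[OF assms(1)]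
proof (rule sum.cong[OF refl])
  fix x :: nat assume "x \<in> {x. x < 2 ^ n \<and> \<not> bit x t}"
  then have x: "\<not> bit x t" "put_bit t False x = x" using put_bit_same[of t x] by auto
  show "cnj (applyc g c t \<psi> x) * applyc g c t \<phi> x +
      cnj (applyc g c t \<psi> (put_bit t True x)) * applyc g c t \<phi> (put_bit t True x) =
      cnj (\<psi> x) * \<phi> x + cnj (\<psi> (put_bit t True x)) * \<phi> (put_bit t True x)"
  proof (cases "bit x c")
    case True
    then have "bit (put_bit t True x) c" using assms(2) by (simp add: bit_put_bit)
    with True x show ?thesis
      by (simp only: applyc_def apply1_def bit_put_bit put_bit_put_bit simp_thms if_True if_cancel unitary_gate_iprod[OF assms(3)])
  next
    case False
    then have "\<not> bit (put_bit t True x) c" using assms(2) by (simp add: bit_put_bit)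
    with False show ?thesis by (simp add: applyc_def)
  qed
qed

lemma supported_apply1: "t < n \<Longrightarrow> supported n \<psi> \<Longrightarrow> supported n (apply1 g t \<psi>)"
  by (simp add: supported_def apply1_def not_less[symmetric] put_bit_less')

lemma supported_applyc: "t < n \<Longrightarrow> supported n \<psi> \<Longrightarrow> supported n (applyc g c t \<psi>)"
  using supported_apply1[of t n \<psi> g] by (simp add: supported_def applyc_def)

lemma impl_apply1:
  assumes "t < n" "unitary_gate g"
  shows "impl n a 1 (apply1 g t)"
  unfolding impl_def using assms supported_apply1 iprod_apply1 realizes_apply1[of t "a + n" g]
  unfolding realizes_def
  by (intro conjI allI impI exI[of _ "[embed_gate (a + n) [t] (gate_mat g)]"]) auto

lemma impl_applyc:
  assumes "t < n" "c < n" "c \<noteq> t" "unitary_gate g"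
  shows "impl n a 1 (applyc g c t)"
  unfolding impl_def using assms supported_applyc iprod_applyc realizes_applyc[of t "a + n" c g]
  unfolding realizes_def
  by (intro conjI allI impI exI[of _ "[embed_gate (a + n) [t, c] (controlled_mat g)]"]) auto

lemma realizes_cgate:
  assumes "valid_cgate W g"
  shows "\<exists>Ms. length Ms \<le> 5 \<and> realizes W Ms (\<lambda>\<psi> x. \<psi> (flip_index g x))"
proof -
  obtain cs t where g: "g = (cs, t)" by fastforce
  have f: "flip_bit t x = put_bit t (\<not> bit x t) x" for x
    by (rule bit_eqI) (simp add: bit_put_bit bit_simps)
  have X: "apply1 X_gate t \<psi> = (\<lambda>x. \<psi> (flip_bit t x))" for \<psi>
    by (rule ext) (auto simp: apply1_def X_gate_def f)
  have "t < W" using assms g by (simp add: valid_cgate_def)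
  consider "cs = []" | c where "cs = [c]" | b c where "cs = [b, c]"
    using assms g by (auto simp: valid_cgate_def numeral_2_eq_2 le_Suc_eq length_Suc_conv)
  then show ?thesis
  proof cases
    case 1
    have "(\<lambda>\<psi> x. \<psi> (flip_index g x)) = apply1 X_gate t"
      by (intro ext) (simp add: X g 1 flip_index_def)
    with realizes_apply1[OF \<open>t < W\<close> unitary_X] show ?thesis by (intro exI) auto
  next
    case 2
    have "(\<lambda>\<psi> x. \<psi> (flip_index g x)) = applyc X_gate c t"
      by (intro ext) (simp add: X applyc_def g 2 flip_index_def)
    moreover have "c < W" "c \<noteq> t" using assms g 2 by (auto simp: valid_cgate_def)
    ultimately show ?thesis using realizes_applyc[OF \<open>t < W\<close> _ _ unitary_X, of c] by (intro exI) auto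
  next
    case 3
    then have d: "b \<noteq> c" "b \<noteq> t" "c \<noteq> t" "b < W" "c < W" using assms g by (auto simp: valid_cgate_def)
    let ?E = "\<lambda>t c g. embed_gate W [t, c] (controlled_mat g)"
    have "realizes W (((([?E t c sqrtX_gate] @ [?E c b X_gate]) @ [?E t c sqrtX_inv_gate]) @ [?E c b X_gate]) @ [?E t b sqrtX_gate])
      (\<lambda>\<psi>. applyc sqrtX_gate b t (applyc X_gate b c (applyc sqrtX_inv_gate c t (applyc X_gate b c
        (applyc sqrtX_gate c t \<psi>)))))"
      using d \<open>t < W\<close> by (intro realizes_append realizes_applyc unitary_X unitary_sqrtX) auto
    then show ?thesis
      unfolding toffoli_decomposition[OF d(1-3)] g 3 by (intro exI) auto
  qed
qed

text \<open>Permutations act on amplitudes by substitution, so the first gate of the list becomes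
  the outermost function. This gives \<open>foldr\<close>, the inverse of the \<open>fold\<close>
  that runs the gates on an index.\<close>

lemma realizes_cgates:
  assumes "\<forall>g\<in>set gs. valid_cgate W g"
  shows "\<exists>Ms. length Ms \<le> 5 * length gs \<and> realizes W Ms (\<lambda>\<psi> x. \<psi> (foldr flip_index gs x))"
  using assms
proof (induction gs)
  case Nil
  show ?case using realizes_Nil by (intro exI[of _ "[]"]) simp
next
  case (Cons g gs)
  then obtain Ms where Ms: "length Ms \<le> 5 * length gs" "realizes W Ms (\<lambda>\<psi> x. \<psi> (foldr flip_index gs x))" by auto
  obtain Ms' where Ms': "length Ms' \<le> 5" "realizes W Ms' (\<lambda>\<psi> x. \<psi> (flip_index g x))"
    using realizes_cgate Cons.prems by (meson list.set_intros(1))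
  from realizes_append[OF Ms'(2) Ms(2)] Ms(1) Ms'(1) show ?case
    by (intro exI[of _ "Ms' @ Ms"]) (simp add: o_def)
qed

definition permute :: "nat \<Rightarrow> (nat \<Rightarrow> nat) \<Rightarrow> amp \<Rightarrow> amp" where
  "permute n P \<psi> x = (if x < 2 ^ n then \<psi> (P x) else 0)"

text \<open>The \<open>foldr\<close> of the gates inverts their \<open>fold\<close>, which agrees
  with \<open>P\<close> below \<open>2 ^ n\<close>; as \<open>P\<close> is its own inverse, both
  orders give \<open>P\<close>. Each of the \<open>8 * k + 5 * n\<close> classical gates costs at
  most five elementary ones.\<close>

lemma impl_involution:
  assumes P: "\<And>x. x < 2 ^ n \<Longrightarrow> P x < 2 ^ n" "\<And>x. x < 2 ^ n \<Longrightarrow> P (P x) = x"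
    and "computes (inputs n) (bits n P) k" "k + n \<le> a"
  shows "impl n a (40 * k + 25 * n) (permute n P)"
proof -
  obtain gs where gs: "\<forall>g\<in>set gs. valid_cgate (n + k + n) g" "length gs \<le> 8 * k + 5 * n"
    "\<And>x. x < 2 ^ n \<Longrightarrow> fold flip_index gs x = P x"
    using involution_gates[OF P assms(3)] by metis
  have gs': "\<forall>g\<in>set gs. valid_cgate (a + n) g" using gs(1) assms(4) valid_cgate_mono by auto
  obtain Ms where Ms: "length Ms \<le> 5 * length gs" "realizes (a + n) Ms (\<lambda>\<psi> x. \<psi> (foldr flip_index gs x))"
    using realizes_cgates[OF gs'] by blast
  have inv1: "fold flip_index gs (foldr flip_index gs x) = x" for x
  proof (rule bit_eqI)
    fix i show "bit (fold flip_index gs (foldr flip_index gs x)) i = bit x i"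
      using run_rev[of "rev gs" "a + n" "bit x"] gs' by (simp add: foldr_conv_fold bit_fold_flip_index)
  qed
  have inv2: "foldr flip_index gs (fold flip_index gs x) = x" for x
  proof (rule bit_eqI)
    fix i show "bit (foldr flip_index gs (fold flip_index gs x)) i = bit x i"
      using run_rev[of gs "a + n" "bit x"] gs' by (simp add: foldr_conv_fold bit_fold_flip_index)
  qed
  have perm: "\<psi> (foldr flip_index gs x) = permute n P \<psi> x" if "supported n \<psi>" for \<psi> x
  proof (cases "x < 2 ^ n")
    case True
    have "foldr flip_index gs x = P x"
      using gs(3)[OF P(1)[OF True]] P(2)[OF True] inv2[of "P x"] by simp
    then show ?thesis using True by (simp add: permute_def)
  next
    case False
    have "\<not> foldr flip_index gs x < 2 ^ n"
      using gs(3)[of "foldr flip_index gs x"] P(1)[of "foldr flip_index gs x"] inv1[of x] False by auto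
    then show ?thesis using False that by (simp add: permute_def supported_def)
  qed
  have ip: "iprod n (permute n P \<psi>) (permute n P \<phi>) = iprod n \<psi> \<phi>" for \<psi> \<phi>
    unfolding iprod_def
    by (rule sum.reindex_bij_witness[of _ P P]) (auto simp: permute_def P)
  show ?thesis
    unfolding impl_def
  proof (intro conjI allI impI ip exI[of _ Ms])
    fix \<psi> assume \<psi>: "supported n \<psi>"
    have "fold (\<lambda>M v. M *\<^sub>v v) Ms (vec (2 ^ (a + n)) \<psi>) = vec (2 ^ (a + n)) (\<lambda>x. \<psi> (foldr flip_index gs x))"
      using Ms(2) by (simp add: realizes_def)
    then show "fold (\<lambda>M v. M *\<^sub>v v) Ms (vec (2 ^ (a + n)) \<psi>) = vec (2 ^ (a + n)) (permute n P \<psi>)"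
      by (simp add: perm[OF \<psi>])
  qed (use Ms gs(2) in \<open>auto simp: realizes_def permute_def supported_def\<close>)
qed

lemma fold_mult_mat_vec:
  assumes "quantum_circuit W Ms" "v \<in> carrier_vec (2 ^ W)"
  shows "circuit_mat W Ms *\<^sub>v v = fold (\<lambda>M v. M *\<^sub>v v) Ms v" "circuit_mat W Ms \<in> carrier_mat (2 ^ W) (2 ^ W)"
proof -
  have "fold (\<lambda>M A. M * A) Ms A *\<^sub>v v = fold (\<lambda>M v. M *\<^sub>v v) Ms (A *\<^sub>v v) \<and>
      fold (\<lambda>M A. M * A) Ms A \<in> carrier_mat (2 ^ W) (2 ^ W)"
    if "A \<in> carrier_mat (2 ^ W) (2 ^ W)" for A
    using assms(1) that
  proof (induction Ms arbitrary: A)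
    case (Cons M Ms)
    have M: "M \<in> carrier_mat (2 ^ W) (2 ^ W)"
      using Cons.prems(1) by (auto simp: quantum_circuit_def elementary_gate_def embed_gate_def)
    have "quantum_circuit W Ms" using Cons.prems(1) by (simp add: quantum_circuit_def)
    from Cons.IH[OF this mult_carrier_mat[OF M Cons.prems(2)]] show ?case
      using assoc_mult_mat_vec[OF M Cons.prems(2) assms(2)] by simp
  qed simp
  from this[of "1\<^sub>m (2 ^ W)"] assms(2)
  show "circuit_mat W Ms *\<^sub>v v = fold (\<lambda>M v. M *\<^sub>v v) Ms v" "circuit_mat W Ms \<in> carrier_mat (2 ^ W) (2 ^ W)"
    by (simp_all add: circuit_mat_def)
qed

definition ket :: "nat \<Rightarrow> amp" where
  "ket y x = of_bool (x = y)"

text \<open>The columns of \<open>U\<close> are the images of the basis states. Preserved inner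
  products make them orthonormal, and a one-sided inverse of a square matrix is two-sided.\<close>

lemma impl_implements:
  assumes "impl n a K \<Phi>"
  defines "U \<equiv> mat (2 ^ n) (2 ^ n) (\<lambda>(i, j). \<Phi> (ket j) i)"
  obtains Ms where "length Ms \<le> K" "implements n a Ms U" "unitary_mat (2 ^ n) U"
proof -
  let ?W = "a + n"
  from assms(1) obtain Ms where Ms: "length Ms \<le> K" "quantum_circuit ?W Ms"
    and act: "\<And>\<psi>. supported n \<psi> \<Longrightarrow> fold (\<lambda>M v. M *\<^sub>v v) Ms (vec (2 ^ ?W) \<psi>) = vec (2 ^ ?W) (\<Phi> \<psi>)"
    and supp: "\<And>\<psi>. supported n \<psi> \<Longrightarrow> supported n (\<Phi> \<psi>)"
    and ip: "\<And>\<psi> \<phi>. supported n \<psi> \<Longrightarrow> supported n \<phi> \<Longrightarrow> iprod n (\<Phi> \<psi>) (\<Phi> \<phi>) = iprod n \<psi> \<phi>"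
    unfolding impl_def by blast
  have k: "supported n (ket j)" if "j < 2 ^ n" for j using that by (auto simp: supported_def ket_def)
  let ?C = "circuit_mat ?W Ms"
  have C: "?C \<in> carrier_mat (2 ^ ?W) (2 ^ ?W)" using fold_mult_mat_vec[OF Ms(2), of "0\<^sub>v (2 ^ ?W)"] by simp
  have "?C * ket0 a n = ket0 a n * U"
  proof (rule eq_matI)
    fix i j assume "i < dim_row (ket0 a n * U)" "j < dim_col (ket0 a n * U)"
    then have ij: "i < 2 ^ ?W" "j < 2 ^ n" by (simp_all add: ket0_def U_def)
    have "col (ket0 a n) j = vec (2 ^ ?W) (ket j)"
      using ij by (intro eq_vecI) (auto simp: ket0_def ket_def)
    then have "(?C * ket0 a n) $$ (i, j) = (?C *\<^sub>v vec (2 ^ ?W) (ket j)) $ i"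
      using ij C by (simp add: ket0_def)
    also have "\<dots> = \<Phi> (ket j) i"
      using fold_mult_mat_vec(1)[OF Ms(2), of "vec (2 ^ ?W) (ket j)"] act[OF k[OF ij(2)]] ij by simp
    also have "\<dots> = (ket0 a n * U) $$ (i, j)"
    proof -
      have "(ket0 a n * U) $$ (i, j) = (\<Sum>x<2 ^ n. of_bool (i = x) * \<Phi> (ket j) x)"
        using ij by (simp add: ket0_def U_def scalar_prod_def atLeast0LessThan)
      also have "\<dots> = (\<Sum>x<2 ^ n. if i = x then \<Phi> (ket j) x else 0)"
        by (intro sum.cong) auto
      also have "\<dots> = \<Phi> (ket j) i"
        using supp[OF k[OF ij(2)]] by (auto simp: supported_def)
      finally show ?thesis by simp
    qed
    finally show "(?C * ket0 a n) $$ (i, j) = (ket0 a n * U) $$ (i, j)" .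
  qed (use C in \<open>simp_all add: ket0_def U_def\<close>)
  then have impl: "implements n a Ms U" using Ms(2) by (simp add: implements_def)
  have U: "U \<in> carrier_mat (2 ^ n) (2 ^ n)" by (simp add: U_def)
  have "mat_adjoint U * U = 1\<^sub>m (2 ^ n)"
  proof (rule eq_matI)
    fix i j :: nat assume "i < dim_row (1\<^sub>m (2 ^ n) :: complex mat)" "j < dim_col (1\<^sub>m (2 ^ n) :: complex mat)"
    then have ij: "i < 2 ^ n" "j < 2 ^ n" by simp_all
    have "(mat_adjoint U * U) $$ (i, j) = iprod n (\<Phi> (ket i)) (\<Phi> (ket j))"
      using ij by (simp add: mat_adjoint_eq U_def scalar_prod_def atLeast0LessThan iprod_def)
    also have "\<dots> = iprod n (ket i) (ket j)" by (rule ip[OF k[OF ij(1)] k[OF ij(2)]])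
    also have "\<dots> = (\<Sum>x<2 ^ n. if x = i then of_bool (i = j) else 0)"
      unfolding iprod_def by (intro sum.cong) (auto simp: ket_def)
    also have "\<dots> = of_bool (i = j)" using ij by simp
    finally show "(mat_adjoint U * U) $$ (i, j) = 1\<^sub>m (2 ^ n) $$ (i, j)" using ij by simp
  qed (simp_all add: U_def mat_adjoint_eq)
  moreover from this have "U * mat_adjoint U = 1\<^sub>m (2 ^ n)"
    using U by (intro mat_mult_left_right_inverse[of "mat_adjoint U" _ U]) (simp_all add: mat_adjoint_eq U_def)
  ultimately have "unitary_mat (2 ^ n) U" using U by (simp add: unitary_mat_def)
  with that Ms(1) impl show ?thesis by blast
qed

lemma spectral_norm_zero: "spectral_norm (0\<^sub>m m n) = 0"
proof -
  have "vec_l2_norm (0\<^sub>m m n *\<^sub>v v) = 0" if "v \<in> carrier_vec n" for v :: "complex vec"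
    using that by (simp add: vec_l2_norm_def L2_set_def)
  moreover have "0\<^sub>v n \<in> {v \<in> carrier_vec n. vec_l2_norm v \<le> 1}"
    by (simp add: vec_l2_norm_def L2_set_def)
  ultimately have "(\<lambda>v. vec_l2_norm (0\<^sub>m m n *\<^sub>v v)) ` {v \<in> carrier_vec n. vec_l2_norm v \<le> 1} = {0}"
    by force
  then show ?thesis by (simp add: spectral_norm_def)
qed

text \<open>Ancillas are the most significant qubits, so the sandwich by \<open>ket0\<close> cuts
  out the top-left block. With exact entries the difference is the zero matrix and no norm has to be
  estimated.\<close>

lemma block_encodingI:
  assumes "unitary_mat (2 ^ (q + s)) U" "A \<in> carrier_mat (2 ^ s) (2 ^ s)"
    and "\<And>i j. i < 2 ^ s \<Longrightarrow> j < 2 ^ s \<Longrightarrow> A $$ (i, j) = complex_of_real \<alpha> * U $$ (i, j)"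
  shows "block_encoding s \<alpha> q 0 U A"
proof -
  have U: "U \<in> carrier_mat (2 ^ (q + s)) (2 ^ (q + s))" using assms(1) by (simp add: unitary_mat_def)
  have le: "(2::nat) ^ s \<le> 2 ^ (q + s)" by simp
  have 1: "(mat_adjoint (ket0 q s) * U) $$ (i, k) = U $$ (i, k)" if "i < 2 ^ s" "k < 2 ^ (q + s)" for i k
  proof -
    have "(mat_adjoint (ket0 q s) * U) $$ (i, k) = (\<Sum>x<2 ^ (q + s). cnj (of_bool (x = i)) * U $$ (x, k))"
      using that U by (simp add: mat_adjoint_eq ket0_def scalar_prod_def atLeast0LessThan)
    also have "\<dots> = (\<Sum>x<2 ^ (q + s). if x = i then U $$ (x, k) else 0)"
      by (intro sum.cong) auto
    also have "\<dots> = U $$ (i, k)" using that less_le_trans[OF that(1) le] by simp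
    finally show ?thesis .
  qed
  have "mat_adjoint (ket0 q s) * U * ket0 q s = mat (2 ^ s) (2 ^ s) (\<lambda>(i, j). U $$ (i, j))" (is "?L = _")
  proof (rule eq_matI)
    fix i j assume "i < dim_row (mat (2 ^ s) (2 ^ s) (\<lambda>(i, j). U $$ (i, j)))"
      "j < dim_col (mat (2 ^ s) (2 ^ s) (\<lambda>(i, j). U $$ (i, j)))"
    then have ij: "i < 2 ^ s" "j < 2 ^ s" by simp_all
    have "?L $$ (i, j) = (\<Sum>x<2 ^ (q + s). (mat_adjoint (ket0 q s) * U) $$ (i, x) * of_bool (x = j))"
      using ij U by (simp add: mat_adjoint_eq ket0_def scalar_prod_def atLeast0LessThan)
    also have "\<dots> = (\<Sum>x<2 ^ (q + s). if x = j then U $$ (i, x) else 0)"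
      using ij by (intro sum.cong) (auto simp: 1)
    also have "\<dots> = U $$ (i, j)" using ij less_le_trans[OF ij(2) le] by simp
    finally show "?L $$ (i, j) = mat (2 ^ s) (2 ^ s) (\<lambda>(i, j). U $$ (i, j)) $$ (i, j)" using ij by simp
  qed (use U in \<open>simp_all add: mat_adjoint_eq ket0_def\<close>)
  then have "A - complex_of_real \<alpha> \<cdot>\<^sub>m ?L = 0\<^sub>m (2 ^ s) (2 ^ s)"
    using assms(2,3) by (intro eq_matI) auto
  then show ?thesis using assms(1,2) by (simp add: block_encoding_def spectral_norm_zero)
qed


section \<open>Registers and layers of one-qubit gates\<close>

text \<open>The upper part \<open>v\<close> is unbounded, so nested \<open>cat\<close>s decompose
  every natural number; only the topmost field carries a range condition.\<close>

definition cat :: "nat \<Rightarrow> nat \<Rightarrow> nat \<Rightarrow> nat" where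
  "cat m u v = or (take_bit m u) (push_bit m v)"

lemma bit_cat: "bit (cat m u v) i = (if i < m then bit u i else bit v (i - m))"
  by (auto simp: cat_def bit_simps)

lemma cat_0: "u < 2 ^ m \<Longrightarrow> cat m u 0 = u"
  by (simp add: cat_def take_bit_nat_eq_self)

lemma put_bit_cat: "put_bit i b (cat m u v) = (if i < m then cat m (put_bit i b u) v else cat m u (put_bit (i - m) b v))"
  by (rule bit_eqI) (auto simp: bit_put_bit bit_cat)

lemma cat_less:
  assumes "v < 2 ^ k"
  shows "cat m u v < 2 ^ (m + k)"
  using assms unfolding nat_less_exp_iff_bit by (auto simp: bit_cat)

lemma cat_split: "cat m (take_bit m x) (drop_bit m x) = x"
  by (rule bit_eqI) (auto simp: bit_cat bit_simps)

lemma take_bit_cat: "u < 2 ^ m \<Longrightarrow> take_bit m (cat m u v) = u"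
proof -
  assume "u < 2 ^ m"
  then have "take_bit m u = u" by (simp add: take_bit_nat_eq_self)
  moreover have "take_bit m (cat m u v) = take_bit m u"
    by (rule bit_eqI) (auto simp: bit_cat bit_simps)
  ultimately show ?thesis by simp
qed

lemma drop_bit_cat: "drop_bit m (cat m u v) = v"
  by (rule bit_eqI) (auto simp: bit_cat bit_simps)

definition layer :: "(nat \<Rightarrow> qgate) \<Rightarrow> nat \<Rightarrow> amp \<Rightarrow> amp" where
  "layer g m = fold (\<lambda>i. apply1 (g i) i) [0..<m]"

lemma layer_0: "layer g 0 f = f"
  by (simp add: layer_def)

lemma layer_Suc: "layer g (Suc m) f = apply1 (g m) m (layer g m f)"
  by (simp add: layer_def)

lemma layer_support:
  assumes "layer g m f x \<noteq> 0"
  shows "\<exists>v. f v \<noteq> 0 \<and> (\<forall>i\<ge>m. bit v i = bit x i)"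
  using assms
proof (induction m arbitrary: x)
  case 0
  then show ?case by (auto simp: layer_0)
next
  case (Suc m)
  then obtain b where "layer g m f (put_bit m b x) \<noteq> 0"
    unfolding layer_Suc apply1_def by fastforce
  from Suc.IH[OF this] show ?case by (auto simp: bit_put_bit)
qed

text \<open>A tensor product of one-qubit gates applied to a basis state factorises over the qubits;
  qubits that the partial layer has not reached must still agree with \<open>e\<close>.\<close>

lemma layer_point:
  assumes f: "\<And>v. v < 2 ^ K \<Longrightarrow> v \<noteq> e \<Longrightarrow> f v = 0" and "m \<le> K" "x < 2 ^ K"
  shows "layer g m f x = (if \<forall>i\<ge>m. bit x i = bit e i then (\<Prod>i<m. g i (bit x i) (bit e i)) * f e else 0)"
  using assms(2,3)
proof (induction m arbitrary: x)
  case 0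
  have "(\<forall>i. bit x i = bit e i) \<longleftrightarrow> x = e" by (metis bit_eqI)
  then show ?case using f[OF 0(2)] by (auto simp: layer_0)
next
  case (Suc m)
  have IH: "layer g m f (put_bit m b x) =
      (if \<forall>i\<ge>m. bit (put_bit m b x) i = bit e i then (\<Prod>i<m. g i (bit x i) (bit e i)) * f e else 0)" for b
  proof -
    have "(\<Prod>i<m. g i (bit (put_bit m b x) i) (bit e i)) = (\<Prod>i<m. g i (bit x i) (bit e i))"
      by (intro prod.cong) (auto simp: bit_put_bit)
    moreover have "put_bit m b x < 2 ^ K" using Suc.prems by (simp add: put_bit_less')
    ultimately show ?thesis using Suc.IH[of "put_bit m b x"] Suc.prems(1) by (simp only: Suc_leD)
  qed
  have c: "(\<forall>i\<ge>m. bit (put_bit m b x) i = bit e i) \<longleftrightarrow> b = bit e m \<and> (\<forall>i\<ge>Suc m. bit x i = bit e i)" for b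
  proof -
    have "(\<forall>i\<ge>m. P i) \<longleftrightarrow> P m \<and> (\<forall>i\<ge>Suc m. P i)" for P
      using le_eq_less_or_eq Suc_le_eq by metis
    from this[of "\<lambda>i. bit (put_bit m b x) i = bit e i"] show ?thesis by (auto simp: bit_put_bit)
  qed
  show ?case
    unfolding layer_Suc apply1_def IH c
    by (cases "bit e m") (auto simp: mult_ac)
qed

abbreviation H_gate :: qgate where
  "H_gate \<equiv> reflection_gate (1 / sqrt 2) (1 / sqrt 2)"

definition rsqrt2 :: complex where "rsqrt2 = complex_of_real (1 / sqrt 2)"

lemma unitary_H: "unitary_gate H_gate"
  by (intro unitary_reflection) (simp add: power_divide)

lemma H_gate_False: "H_gate False b = rsqrt2" "H_gate b False = rsqrt2"
  by (cases b; simp add: reflection_gate_def rsqrt2_def)+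

lemma layer_H_point:
  fixes f :: amp
  assumes "\<And>v. v < 2 ^ K \<Longrightarrow> v \<noteq> 0 \<Longrightarrow> f v = 0" and "m \<le> K" "x < 2 ^ K"
  shows "layer (\<lambda>_. H_gate) m f x = (if x < 2 ^ m then rsqrt2 ^ m * f 0 else 0)"
proof -
  have "layer (\<lambda>_. H_gate) m f x =
      (if \<forall>i\<ge>m. bit x i = bit (0::nat) i then (\<Prod>i<m. H_gate (bit x i) (bit (0::nat) i)) * f 0 else 0)"
    by (rule layer_point[OF assms(1)]) (use assms in simp_all)
  moreover have "(\<forall>i\<ge>m. bit x i = bit (0::nat) i) \<longleftrightarrow> x < 2 ^ m" by (simp add: nat_less_exp_iff_bit)
  ultimately show ?thesis by (simp add: H_gate_False)
qed

text \<open>The row of index \<open>0\<close> in a tensor power of the Hadamard matrix is constant.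
  The induction starts from any \<open>x\<close> with vanishing low bits, because splitting off
  qubit \<open>m\<close> leads to \<open>x + 2 ^ m\<close>.\<close>

lemma layer_H_at_0:
  fixes f :: amp
  shows "layer (\<lambda>_. H_gate) m f 0 = rsqrt2 ^ m * (\<Sum>v<2 ^ m. f v)"
proof -
  have "layer (\<lambda>_. H_gate) m f x = rsqrt2 ^ m * (\<Sum>v<2 ^ m. f (x + v))"
    if "\<And>i. i < m \<Longrightarrow> \<not> bit x i" for x
    using that
  proof (induction m arbitrary: x)
    case 0
    show ?case by (simp add: layer_0)
  next
    case (Suc m)
    have x: "put_bit m False x = x" using put_bit_same[of m x] Suc.prems[of m] by simp
    have y: "put_bit m True x = x + 2 ^ m" using Suc.prems[of m]
      by (simp add: put_bit_def set_bit_eq)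
    have IH: "layer (\<lambda>_. H_gate) m f (put_bit m b x) =
        rsqrt2 ^ m * (\<Sum>v<2 ^ m. f (put_bit m b x + v))" for b
      using Suc.prems by (intro Suc.IH) (auto simp: bit_put_bit)
    from IH[of False] IH[of True] have
      "layer (\<lambda>_. H_gate) m f x = rsqrt2 ^ m * (\<Sum>v<2 ^ m. f (x + v))"
      "layer (\<lambda>_. H_gate) m f (x + 2 ^ m) = rsqrt2 ^ m * (\<Sum>v<2 ^ m. f (x + 2 ^ m + v))"
      unfolding x y .
    moreover have "\<not> bit x m" using Suc.prems by simp
    ultimately have "layer (\<lambda>_. H_gate) (Suc m) f x =
        rsqrt2 ^ Suc m * ((\<Sum>v<2 ^ m. f (x + v)) + (\<Sum>v<2 ^ m. f (x + 2 ^ m + v)))"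
      by (simp add: x y layer_Suc apply1_def H_gate_False distrib_left mult.assoc)
    also have "(\<Sum>v<2 ^ m. f (x + 2 ^ m + v)) = (\<Sum>v=2 ^ m..<2 ^ m + 2 ^ m. f (x + v))"
      using sum.shift_bounds_nat_ivl[of "\<lambda>v. f (x + v)" 0 "2 ^ m" "2 ^ m"]
      by (simp add: atLeast0LessThan ac_simps)
    also have "(\<Sum>v<2 ^ m. f (x + v)) + (\<Sum>v=2 ^ m..<2 ^ m + 2 ^ m. f (x + v)) = (\<Sum>v<2 ^ Suc m. f (x + v))"
      using sum.atLeastLessThan_concat[of 0 "2 ^ m" "2 ^ m + 2 ^ m" "\<lambda>v. f (x + v)"]
      by (simp add: atLeast0LessThan mult_2)
    finally show ?case .
  qed
  from this[of 0] show ?thesis by simp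
qed

text \<open>\<open>F\<close> inserts the value \<open>v\<close> of a register at bit position
  \<open>a\<close> while all other registers are frozen; gates on that register then act as a layer
  on \<open>v\<close> alone.\<close>

lemma fold_apply1_lift:
  assumes "\<And>v i b. i < m \<Longrightarrow> put_bit (a + i) b (F v) = F (put_bit i b v)"
    and "\<And>v i. i < m \<Longrightarrow> bit (F v) (a + i) = bit v i"
  shows "fold (\<lambda>i. apply1 (g i) (a + i)) [0..<m] \<psi> (F v) = layer g m (\<lambda>v. \<psi> (F v)) v"
  using assms
proof (induction m arbitrary: v)
  case 0
  show ?case by (simp add: layer_0)
next
  case (Suc m)
  have "fold (\<lambda>i. apply1 (g i) (a + i)) [0..<m] \<psi> (F v) = layer g m (\<lambda>v. \<psi> (F v)) v" for v
    using Suc by auto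
  moreover define \<phi> where "\<phi> = fold (\<lambda>i. apply1 (g i) (a + i)) [0..<m] \<psi>"
  ultimately have "\<phi> (F v) = layer g m (\<lambda>v. \<psi> (F v)) v" for v by simp
  then have "apply1 (g m) (a + m) \<phi> (F v) = layer g (Suc m) (\<lambda>v. \<psi> (F v)) v"
    using Suc.prems[of m] by (simp add: layer_Suc apply1_def)
  then show ?case by (simp add: \<phi>_def)
qed

lemma fold_applyc_lift:
  assumes "\<And>v i b. i < m \<Longrightarrow> put_bit (a + i) b (F v) = F (put_bit i b v)"
    and "\<And>v i. i < m \<Longrightarrow> bit (F v) (a + i) = bit v i"
    and "\<And>v. bit (F v) c = C"
  shows "fold (\<lambda>i. applyc (g i) c (a + i)) [0..<m] \<psi> (F v) =
    (if C then layer g m (\<lambda>v. \<psi> (F v)) v else \<psi> (F v))"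
  using assms
proof (induction m arbitrary: v)
  case 0
  show ?case by (simp add: layer_0)
next
  case (Suc m)
  have "fold (\<lambda>i. applyc (g i) c (a + i)) [0..<m] \<psi> (F v) =
    (if C then layer g m (\<lambda>v. \<psi> (F v)) v else \<psi> (F v))" for v
    using Suc by auto
  moreover define \<phi> where "\<phi> = fold (\<lambda>i. applyc (g i) c (a + i)) [0..<m] \<psi>"
  ultimately have "\<phi> (F v) = (if C then layer g m (\<lambda>v. \<psi> (F v)) v else \<psi> (F v))" for v by simp
  then have "applyc (g m) c (a + m) \<phi> (F v) =
      (if C then layer g (Suc m) (\<lambda>v. \<psi> (F v)) v else \<psi> (F v))"
    using Suc.prems(1,2)[of m] Suc.prems(3) by (simp add: layer_Suc apply1_def applyc_def)
  then show ?case by (simp add: \<phi>_def)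
qed

text \<open>
  From the least significant qubit: the index \<open>Y\<close>, the one-hot level \<open>e\<close>, the parked level \<open>e'\<close>, the
  offset \<open>t\<close> in a cell of the coarse grid, the coin \<open>u\<close>, a flag \<open>w\<close>, and the qubit \<open>z\<close> of the final
  rotation. The index register only stores numbers of the form \<open>off + x\<close> once a level is set; the
  base-\<open>B\<close> digits of \<open>x\<close> are the grid coordinates minus \<open>1\<close>.
\<close>

locale registers =
  fixes s L :: nat
begin

definition "n = s + (L + (L + (L + (L + (1 + 1)))))"

definition mk :: "nat \<Rightarrow> nat \<Rightarrow> nat \<Rightarrow> nat \<Rightarrow> nat \<Rightarrow> nat \<Rightarrow> nat \<Rightarrow> nat" where
  "mk Y e e' t u w z = cat s Y (cat L e (cat L e' (cat L t (cat L u (cat 1 w z)))))"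

definition "rY x = take_bit s x" for x :: nat
definition "re x = take_bit L (drop_bit s x)" for x :: nat
definition "re' x = take_bit L (drop_bit L (drop_bit s x))" for x :: nat
definition "rt x = take_bit L (drop_bit L (drop_bit L (drop_bit s x)))" for x :: nat
definition "ru x = take_bit L (drop_bit L (drop_bit L (drop_bit L (drop_bit s x))))" for x :: nat
definition "rw x = take_bit 1 (drop_bit L (drop_bit L (drop_bit L (drop_bit L (drop_bit s x)))))" for x :: nat
definition "rz x = drop_bit 1 (drop_bit L (drop_bit L (drop_bit L (drop_bit L (drop_bit s x)))))" for x :: nat

definition ok :: "nat \<Rightarrow> nat \<Rightarrow> nat \<Rightarrow> nat \<Rightarrow> nat \<Rightarrow> nat \<Rightarrow> nat \<Rightarrow> bool" where
  "ok Y e e' t u w z \<longleftrightarrow> Y < 2 ^ s \<and> e < 2 ^ L \<and> e' < 2 ^ L \<and> t < 2 ^ L \<and> u < 2 ^ L \<and> w < 2 \<and> z < 2"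

lemma mk_less: "z < 2 \<Longrightarrow> mk Y e e' t u w z < 2 ^ n"
  unfolding mk_def n_def by (intro cat_less) simp

lemma fields_mk:
  assumes "ok Y e e' t u w z"
  shows "rY (mk Y e e' t u w z) = Y" "re (mk Y e e' t u w z) = e" "re' (mk Y e e' t u w z) = e'"
    "rt (mk Y e e' t u w z) = t" "ru (mk Y e e' t u w z) = u" "rw (mk Y e e' t u w z) = w"
    "rz (mk Y e e' t u w z) = z"
proof -
  have "w < 2 ^ 1" using assms by (simp add: ok_def)
  then show "rw (mk Y e e' t u w z) = w"
    unfolding mk_def rw_def by (simp only: take_bit_cat drop_bit_cat)
  show "rY (mk Y e e' t u w z) = Y" "re (mk Y e e' t u w z) = e" "re' (mk Y e e' t u w z) = e'"
    "rt (mk Y e e' t u w z) = t" "ru (mk Y e e' t u w z) = u" "rz (mk Y e e' t u w z) = z"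
    using assms unfolding ok_def mk_def rY_def re_def re'_def rt_def ru_def rz_def
    by (simp_all only: take_bit_cat drop_bit_cat)
qed

lemma mk_fields: "mk (rY x) (re x) (re' x) (rt x) (ru x) (rw x) (rz x) = x"
  unfolding mk_def rY_def re_def re'_def rt_def ru_def rw_def rz_def by (simp only: cat_split)

lemma ok_fields: "x < 2 ^ n \<Longrightarrow> ok (rY x) (re x) (re' x) (rt x) (ru x) (rw x) (rz x)"
proof -
  assume "x < 2 ^ n"
  then have "\<not> bit x i" if "i \<ge> n" for i using that nat_less_exp_iff_bit by blast
  then have "rz x < 2 ^ 1"
    unfolding nat_less_exp_iff_bit by (simp add: rz_def bit_drop_bit_eq n_def)
  moreover have "rw x < 2 ^ 1" unfolding rw_def by (rule take_bit_nat_less_exp)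
  ultimately show ?thesis by (simp add: ok_def rY_def re_def re'_def rt_def ru_def)
qed

lemma mk_cases:
  assumes "x < 2 ^ n"
  obtains Y e e' t u w z where "ok Y e e' t u w z" "x = mk Y e e' t u w z"
  using ok_fields[OF assms] mk_fields[of x] by metis

lemma mk_inject:
  assumes "ok Y e e' t u w z" "ok Y2 e2 e2' t2 u2 w2 z2"
  shows "mk Y e e' t u w z = mk Y2 e2 e2' t2 u2 w2 z2 \<longleftrightarrow>
    Y = Y2 \<and> e = e2 \<and> e' = e2' \<and> t = t2 \<and> u = u2 \<and> w = w2 \<and> z = z2"
  using fields_mk[OF assms(1)] fields_mk[OF assms(2)] by metis

lemma mk_data: "x < 2 ^ s \<Longrightarrow> mk x 0 0 0 0 0 0 = x"
proof -
  assume x: "x < 2 ^ s"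
  have "cat m 0 0 = 0" for m by (simp add: cat_0)
  then show ?thesis using x by (simp add: mk_def cat_0)
qed

lemma bit_mk:
  "i < L \<Longrightarrow> bit (mk Y e e' t u w z) (s + i) = bit e i"
  "i < L \<Longrightarrow> bit (mk Y e e' t u w z) (s + 2 * L + i) = bit t i"
  "i < L \<Longrightarrow> bit (mk Y e e' t u w z) (s + 3 * L + i) = bit u i"
  "bit (mk Y e e' t u w z) (s + 4 * L) = bit w 0"
  "bit (mk Y e e' t u w z) (s + 4 * L + 1) = bit z 0"
  by (simp_all add: mk_def bit_cat)

lemma put_bit_mk:
  "i < L \<Longrightarrow> put_bit (s + i) b (mk Y e e' t u w z) = mk Y (put_bit i b e) e' t u w z"
  "i < L \<Longrightarrow> put_bit (s + 2 * L + i) b (mk Y e e' t u w z) = mk Y e e' (put_bit i b t) u w z"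
  "i < L \<Longrightarrow> put_bit (s + 3 * L + i) b (mk Y e e' t u w z) = mk Y e e' t (put_bit i b u) w z"
  "put_bit (s + 4 * L) b (mk Y e e' t u w z) = mk Y e e' t u (put_bit 0 b w) z"
  "put_bit (s + 4 * L + 1) b (mk Y e e' t u w z) = mk Y e e' t u w (put_bit 0 b z)"
  by (simp_all add: mk_def put_bit_cat)

end


section \<open>Digits\<close>

definition dig :: "nat \<Rightarrow> nat \<Rightarrow> nat \<Rightarrow> nat" where
  "dig b j x = x div b ^ j mod b"

definition set_dig :: "nat \<Rightarrow> nat \<Rightarrow> nat \<Rightarrow> nat \<Rightarrow> nat" where
  "set_dig b j v x = x mod b ^ j + v * b ^ j + x div b ^ Suc j * b ^ Suc j"

lemma dig_less: "b > 0 \<Longrightarrow> dig b j x < b"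
  by (simp add: dig_def)

lemma dig_mod:
  assumes "b > 0"
  shows "dig b i x = x mod b ^ Suc i div b ^ i"
proof -
  have "x mod (b ^ i * b) = b ^ i * (x div b ^ i mod b) + x mod b ^ i" by (rule mod_mult2_eq)
  then show ?thesis using assms by (simp add: dig_def mult.commute)
qed

lemma dig_cong: "b > 0 \<Longrightarrow> x mod b ^ Suc i = y mod b ^ Suc i \<Longrightarrow> dig b i x = dig b i y"
  by (simp add: dig_mod)

lemma set_dig_eq: "set_dig b j v x = x mod b ^ j + b ^ j * (v + b * (x div b ^ Suc j))"
  by (simp add: set_dig_def algebra_simps)

lemma set_dig_div: "b > 0 \<Longrightarrow> v < b \<Longrightarrow> set_dig b j v x div b ^ j = v + b * (x div b ^ Suc j)"
  unfolding set_dig_eq by simp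

lemma set_dig_div_Suc:
  assumes "b > 0" "v < b"
  shows "set_dig b j v x div b ^ Suc j = x div b ^ Suc j"
proof -
  have "set_dig b j v x div b ^ Suc j = set_dig b j v x div b ^ j div b"
    by (simp only: power_Suc2 div_mult2_eq)
  then show ?thesis using assms by (simp add: set_dig_div)
qed

lemma dig_set_dig_same: "b > 0 \<Longrightarrow> v < b \<Longrightarrow> dig b j (set_dig b j v x) = v"
  by (simp add: dig_def set_dig_div)

lemma dig_set_dig_other:
  assumes "b > 0" "v < b" "i \<noteq> j"
  shows "dig b i (set_dig b j v x) = dig b i x"
proof (cases "i < j")
  case True
  then obtain q where q: "b ^ j = b ^ Suc i * q"
    using le_imp_power_dvd[of "Suc i" j b] by (auto elim: dvdE)
  have "set_dig b j v x mod b ^ Suc i = x mod b ^ j mod b ^ Suc i"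
    unfolding set_dig_eq q by (simp only: mult.assoc mod_mult_self2)
  also have "\<dots> = x mod b ^ Suc i" using q by (simp add: mod_mod_cancel)
  finally show ?thesis by (rule dig_cong[OF assms(1)])
next
  case False
  then obtain k where k: "i = Suc j + k" using assms(3) using le_Suc_ex[of "Suc j" i] by auto
  have "y div b ^ i = y div b ^ Suc j div b ^ k" for y
    unfolding k power_add by (rule div_mult2_eq)
  then show ?thesis by (simp only: dig_def set_dig_div_Suc[OF assms(1,2)])
qed

lemma set_dig_less:
  assumes "x < b ^ d" "j < d" "v < b"
  shows "set_dig b j v x < b ^ d"
proof -
  have b: "b > 0" using assms(3) by simp
  obtain k where k: "d = Suc j + k" using le_Suc_ex[of "Suc j" d] assms(2) by auto
  have "x div b ^ Suc j < b ^ k"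
    using assms(1) unfolding k power_add by (simp add: less_mult_imp_div_less mult.commute)
  then have "set_dig b j v x div b ^ Suc j < b ^ k" using set_dig_div_Suc[OF b assms(3)] by simp
  then show ?thesis unfolding k power_add using b by (simp add: div_less_iff_less_mult mult.commute)
qed

lemma dig_eqI:
  assumes "x < b ^ d" "y < b ^ d" "\<And>j. j < d \<Longrightarrow> dig b j x = dig b j y"
  shows "x = y"
  using assms
proof (induction d arbitrary: x y)
  case (Suc d)
  have b: "b > 0" using Suc.prems(1) by (cases b) auto
  have "x div b = y div b"
  proof (rule Suc.IH)
    show "x div b < b ^ d" "y div b < b ^ d"
      using Suc.prems(1,2) b by (simp_all add: div_less_iff_less_mult mult.commute)
    show "dig b j (x div b) = dig b j (y div b)" if "j < d" for j
      using Suc.prems(3)[of "Suc j"] that by (simp add: dig_def div_mult2_eq)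
  qed
  moreover have "x mod b = y mod b" using Suc.prems(3)[of 0] by (simp add: dig_def)
  ultimately show ?case by (metis div_mult_mod_eq)
qed simp

lemma set_dig_set_dig:
  assumes "x < b ^ d" "j < d" "v < b" "v' < b"
  shows "set_dig b j v (set_dig b j v' x) = set_dig b j v x"
proof (rule dig_eqI)
  fix i assume "i < d"
  then show "dig b i (set_dig b j v (set_dig b j v' x)) = dig b i (set_dig b j v x)"
    using assms by (cases "i = j") (auto simp: dig_set_dig_same dig_set_dig_other)
qed (use assms in \<open>simp_all add: set_dig_less\<close>)

lemma set_dig_dig:
  assumes "x < b ^ d" "j < d"
  shows "set_dig b j (dig b j x) x = x"
proof -
  have b: "b > 0" using assms by (cases b) (auto simp: zero_power)
  have l: "dig b j x < b" using b by (simp add: dig_less)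
  show ?thesis
  proof (rule dig_eqI)
    fix i assume "i < d"
    then show "dig b i (set_dig b j (dig b j x) x) = dig b i x"
      using b l by (cases "i = j") (auto simp: dig_set_dig_same dig_set_dig_other)
  qed (use assms l in \<open>simp_all add: set_dig_less\<close>)
qed

text \<open>Base-\<open>a\<close> digits are reread as base-\<open>b\<close> digits. With
  \<open>a = side l\<close> and \<open>b = B\<close>, a coarse-grid index becomes an index in the
  base of the finest grid, so that every level works on the same digit positions.\<close>

definition conv :: "nat \<Rightarrow> nat \<Rightarrow> nat \<Rightarrow> nat \<Rightarrow> nat" where
  "conv a b d x = (\<Sum>j<d. dig a j x * b ^ j)"

lemma sum_digits_less:
  fixes f :: "nat \<Rightarrow> nat"
  assumes "\<And>j. j < d \<Longrightarrow> f j < b"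
  shows "(\<Sum>j<d. f j * b ^ j) < b ^ d"
  using assms
proof (induction d)
  case (Suc d)
  have "(\<Sum>j<d. f j * b ^ j) < b ^ d" using Suc by simp
  moreover have "f d * b ^ d + b ^ d \<le> b * b ^ d"
  proof -
    have "Suc (f d) * b ^ d \<le> b * b ^ d" using Suc.prems[of d] by (intro mult_right_mono) auto
    then show ?thesis by simp
  qed
  ultimately show ?case by simp
qed simp

lemma dig_sum_digits:
  assumes "\<And>j. j < d \<Longrightarrow> f j < b" "i < d"
  shows "dig b i (\<Sum>j<d. f j * b ^ j) = f i"
  using assms
proof (induction d)
  case (Suc d)
  have b: "b > 0" using Suc.prems(1)[of 0] by simp
  let ?V = "\<Sum>j<d. f j * b ^ j"
  have V: "?V < b ^ d" using Suc.prems(1) by (intro sum_digits_less) simp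
  show ?case
  proof (cases "i < d")
    case True
    then have "b ^ Suc i dvd b ^ d" by (intro le_imp_power_dvd) simp
    then obtain q where q: "b ^ d = b ^ Suc i * q" by (rule dvdE)
    have "(?V + f d * b ^ d) mod b ^ Suc i = (?V + b ^ Suc i * (q * f d)) mod b ^ Suc i"
      unfolding q by (simp only: mult_ac)
    then have "(?V + f d * b ^ d) mod b ^ Suc i = ?V mod b ^ Suc i" by (simp only: mod_mult_self2)
    from dig_cong[OF b this] have "dig b i (\<Sum>j<Suc d. f j * b ^ j) = dig b i ?V"
      by (simp only: sum.lessThan_Suc)
    also have "\<dots> = f i" using Suc.prems(1) True by (intro Suc.IH) auto
    finally show ?thesis .
  next
    case False
    then have "i = d" using Suc.prems(2) by simp
    then show ?thesis using V b Suc.prems(1)[of d] by (simp add: dig_def)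
  qed
qed simp

lemma conv_less: "0 < a \<Longrightarrow> a \<le> b \<Longrightarrow> conv a b d x < b ^ d"
  unfolding conv_def by (intro sum_digits_less) (meson dig_less less_le_trans)

lemma dig_conv: "0 < a \<Longrightarrow> a \<le> b \<Longrightarrow> i < d \<Longrightarrow> dig b i (conv a b d x) = dig a i x"
  unfolding conv_def by (rule dig_sum_digits) (auto intro: less_le_trans[OF dig_less])

lemma conv_less':
  "(\<And>j. j < d \<Longrightarrow> dig b j x < a) \<Longrightarrow> conv b a d x < a ^ d"
  unfolding conv_def by (rule sum_digits_less)

lemma dig_conv':
  "(\<And>j. j < d \<Longrightarrow> dig b j x < a) \<Longrightarrow> i < d \<Longrightarrow> dig a i (conv b a d x) = dig b i x"
  unfolding conv_def by (rule dig_sum_digits)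

lemma conv_conv:
  assumes "0 < a" "a \<le> b" "x < a ^ d"
  shows "conv b a d (conv a b d x) = x"
proof -
  have d: "dig b j (conv a b d x) < a" if "j < d" for j
    using assms that by (simp add: dig_conv dig_less)
  show ?thesis
    by (rule dig_eqI[OF conv_less'[OF d] assms(3)]) (simp_all add: dig_conv'[OF d] dig_conv[OF assms(1,2)])
qed

lemma conv_conv':
  assumes "0 < a" "a \<le> b" "x < b ^ d" "\<And>j. j < d \<Longrightarrow> dig b j x < a"
  shows "conv a b d (conv b a d x) = x"
  by (rule dig_eqI[OF conv_less[OF assms(1,2)] assms(3)])
     (simp add: dig_conv[OF assms(1,2)] dig_conv'[OF assms(4)])


section \<open>The involutions of the circuit\<close>

type_synonym reg_map = "nat \<Rightarrow> nat \<Rightarrow> nat \<Rightarrow> nat \<Rightarrow> nat \<Rightarrow> nat \<Rightarrow> nat \<Rightarrow> nat"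

context registers
begin

lemma okD:
  assumes "ok Y e e' t u w z"
  shows "Y < 2 ^ s" "e < 2 ^ L" "e' < 2 ^ L" "t < 2 ^ L" "u < 2 ^ L" "w < 2" "z < 2"
  using assms unfolding ok_def by blast+

lemma okI:
  "Y < 2 ^ s \<Longrightarrow> e < 2 ^ L \<Longrightarrow> e' < 2 ^ L \<Longrightarrow> t < 2 ^ L \<Longrightarrow> u < 2 ^ L \<Longrightarrow> w < 2 \<Longrightarrow> z < 2 \<Longrightarrow>
    ok Y e e' t u w z"
  unfolding ok_def by blast

definition app :: "reg_map \<Rightarrow> nat \<Rightarrow> nat" where
  "app F x = F (rY x) (re x) (re' x) (rt x) (ru x) (rw x) (rz x)"

lemma app_mk: "ok Y e e' t u w z \<Longrightarrow> app F (mk Y e e' t u w z) = F Y e e' t u w z"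
  by (simp add: app_def fields_mk)

text \<open>One witness tuple serves both directions, so each branch of a register map is verified
  on the components without decoding any bits.\<close>

definition undone :: "reg_map \<Rightarrow> nat \<Rightarrow> nat \<Rightarrow> nat \<Rightarrow> nat \<Rightarrow> nat \<Rightarrow> nat \<Rightarrow> nat \<Rightarrow> bool" where
  "undone F Y e e' t u w z \<longleftrightarrow> (\<exists>Y2 e2 e2' t2 u2 w2 z2. ok Y2 e2 e2' t2 u2 w2 z2 \<and>
     F Y e e' t u w z = mk Y2 e2 e2' t2 u2 w2 z2 \<and> F Y2 e2 e2' t2 u2 w2 z2 = mk Y e e' t u w z)"

lemma undoneI:
  "F Y2 e2 e2' t2 u2 w2 z2 = mk Y e e' t u w z \<Longrightarrow> F Y e e' t u w z = mk Y2 e2 e2' t2 u2 w2 z2 \<Longrightarrow>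
    ok Y2 e2 e2' t2 u2 w2 z2 \<Longrightarrow> undone F Y e e' t u w z"
  unfolding undone_def by blast

definition involutive :: "reg_map \<Rightarrow> bool" where
  "involutive F \<longleftrightarrow> (\<forall>Y e e' t u w z. ok Y e e' t u w z \<longrightarrow> undone F Y e e' t u w z)"

lemma app_involution:
  assumes F: "involutive F"
    and x: "x < 2 ^ n"
  shows "app F x < 2 ^ n" "app F (app F x) = x"
proof -
  obtain Y e e' t u w z where o: "ok Y e e' t u w z" and x': "x = mk Y e e' t u w z"
    using mk_cases[OF x] by metis
  obtain Y2 e2 e2' t2 u2 w2 z2 where o2: "ok Y2 e2 e2' t2 u2 w2 z2" and
    F2: "F Y e e' t u w z = mk Y2 e2 e2' t2 u2 w2 z2" "F Y2 e2 e2' t2 u2 w2 z2 = mk Y e e' t u w z"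
    using F o unfolding involutive_def undone_def by metis
  show "app F x < 2 ^ n" using o2 by (simp add: x' app_mk[OF o] F2 mk_less ok_def)
  show "app F (app F x) = x" by (simp add: x' app_mk[OF o] F2 app_mk[OF o2])
qed

end

text \<open>Digits are coordinates minus \<open>1\<close>: this is \<open>p * k + t - 1\<close> for
  \<open>k = D + 1 - [u < t]\<close>. The subtraction is never cut off, since \<open>u < t\<close>
  makes \<open>t\<close> positive.\<close>

definition shift_digit :: "nat \<Rightarrow> nat \<Rightarrow> nat \<Rightarrow> nat \<Rightarrow> nat" where
  "shift_digit p t u D = (if u < t then D * p + t - 1 else D * p + (p - 1) + t)"

text \<open>The result is a coarse coordinate, not a digit. It may be a boundary coordinate,
  \<open>0\<close> or one above the last interior node; such a pair of \<open>u\<close> and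
  \<open>D\<close> has no preimage under the shift.\<close>

definition shift_source :: "nat \<Rightarrow> nat \<Rightarrow> nat \<Rightarrow> nat" where
  "shift_source p u D = (D + 1) div p + (if u < (D + 1) mod p then 1 else 0)"

lemma shift_digit_Suc:
  "p > 0 \<Longrightarrow> shift_digit p t u D + 1 = (if u < t then p * D + t else p * (D + 1) + t)"
  by (auto simp: shift_digit_def)

text \<open>The coordinate \<open>p * k + t\<close> determines \<open>k\<close> and
  \<open>t\<close>, and the coin is kept, so the source can be recovered. The hypothesis on
  \<open>p\<close>, \<open>m\<close> and \<open>B\<close> compares the numbers of cells of the two
  grids.\<close>

lemma shift_digit_props:
  assumes "p > 0" "t < p" "p * (m + 1) = B + 1" "D < m"
  shows "shift_digit p t u D < B" "(shift_digit p t u D + 1) mod p = t"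
    "shift_source p u (shift_digit p t u D) = D + 1"
proof -
  let ?D = "shift_digit p t u D"
  have "p * (D + 1) \<le> p * m" using assms(4) by (intro mult_left_mono) auto
  then have "?D + 1 < p * (m + 1)" unfolding shift_digit_Suc[OF assms(1)] using assms(2) by auto
  then show "?D < B" using assms(3) by simp
  show 1: "(?D + 1) mod p = t" unfolding shift_digit_Suc[OF assms(1)] using assms(2)
    by (cases "u < t") (simp_all only: if_True if_False mod_mult_self4 mod_less)
  have "(?D + 1) div p = (if u < t then D else D + 1)"
    unfolding shift_digit_Suc[OF assms(1)] using assms(1,2)
    by (cases "u < t") (simp_all only: if_True if_False, simp_all add: div_mult_self4 del: mult_Suc_right)
  then show "shift_source p u ?D = D + 1" unfolding shift_source_def 1 by simp
qed

lemma shift_digit_source: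
  assumes "p > 0" "1 \<le> shift_source p u D"
  shows "shift_digit p ((D + 1) mod p) u (shift_source p u D - 1) = D"
proof -
  have "p * ((D + 1) div p) + (D + 1) mod p = D + 1" by simp
  moreover have "shift_source p u D - 1 + 1 = shift_source p u D" using assms(2) by simp
  ultimately have "shift_digit p ((D + 1) mod p) u (shift_source p u D - 1) + 1 = D + 1"
    unfolding shift_digit_Suc[OF assms(1)]
    by (cases "u < (D + 1) mod p") (simp_all add: shift_source_def)
  then show ?thesis by simp
qed

lemma num_qubits_le: "N \<le> 2 ^ num_qubits N"
  unfolding num_qubits_def by (rule LeastI[of _ N]) (simp add: less_imp_le)

lemma total_dof_Suc: "total_dof d (Suc l) = total_dof d l + ndof d (Suc l)"
  by (simp add: total_dof_def)

lemma total_dof_mono: "l \<le> l' \<Longrightarrow> total_dof d l \<le> total_dof d l'"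
  unfolding total_dof_def by (intro sum_mono2) auto

locale bpx_circuit =
  fixes d L :: nat
  assumes d: "d \<ge> 1" and L: "L \<ge> 1"
begin

abbreviation "N \<equiv> total_dof d L"
abbreviation "s \<equiv> num_qubits (total_dof d L)"
definition B :: nat where "B = 2 ^ L - 1"
definition side :: "nat \<Rightarrow> nat" where "side l = 2 ^ l - 1"
definition half :: nat where "half = 2 ^ (L - 1)"

sublocale registers s L .

text \<open>The finest block occupies the last \<open>B ^ d\<close> positions below
  \<open>N\<close>, which are also the nonzero rows of the square embedding; output indices have the
  form \<open>off + x\<close>.\<close>

definition "off = N - B ^ d"

lemma off: "off + B ^ d = N"
proof -
  have "N = total_dof d (L - 1) + B ^ d" using total_dof_Suc[of d "L - 1"] L by (simp add: ndof_def B_def)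
  then show ?thesis by (simp add: off_def)
qed

lemma N_le: "N \<le> 2 ^ s" by (rule num_qubits_le)

lemma B_pos: "B > 0" using L one_less_power[of "2::nat" L] by (simp add: B_def)

lemma side_pos: "1 \<le> l \<Longrightarrow> side l > 0" using one_less_power[of "2::nat" l] by (simp add: side_def)

lemma side_le: "l \<le> L \<Longrightarrow> side l \<le> B" by (simp add: side_def B_def diff_le_mono)

lemma total_dof_block: "1 \<le> l \<Longrightarrow> total_dof d l = total_dof d (l - 1) + side l ^ d"
  using total_dof_Suc[of d "l - 1"] by (simp add: ndof_def side_def)

lemma total_dof_le: "l \<le> L \<Longrightarrow> total_dof d l \<le> N" by (rule total_dof_mono)

abbreviation "data Y \<equiv> off \<le> Y \<and> Y < N"

lemma data_less: "x < B ^ d \<Longrightarrow> data (off + x) \<and> off + x < 2 ^ s"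
  using off N_le by auto

lemma data_diff: "data Y \<Longrightarrow> Y - off < B ^ d"
  using off by auto

text \<open>
  Each of the following maps exchanges the domain of a partial injection with its range. The two are
  disjoint, since they differ in a flag or in the level registers, so the map is an involution.
\<close>

definition F_out :: reg_map where
  "F_out Y e e' t u w z = (if N \<le> Y then mk Y e e' t u (1 - w) z else mk Y e e' t u w z)"

definition F_in :: "nat \<Rightarrow> reg_map" where
  "F_in l Y e e' t u w z =
    (if e = 0 \<and> total_dof d (l - 1) \<le> Y \<and> Y < total_dof d l
     then mk (off + conv (side l) B d (Y - total_dof d (l - 1))) (2 ^ (l - 1)) e' t u w z
     else if e = 2 ^ (l - 1) \<and> data Y \<and> (\<forall>j<d. dig B j (Y - off) < side l)
     then mk (total_dof d (l - 1) + conv B (side l) d (Y - off)) 0 e' t u w z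
     else mk Y e e' t u w z)"

definition F_mark :: "nat \<Rightarrow> reg_map" where
  "F_mark j Y e e' t u w z =
    (let D = dig B j (Y - off) in
     if u \<noteq> 0 \<and> data Y \<and> e \<noteq> 0 \<and> e' = 0 \<and> D + 1 < half
     then mk (off + set_dig B j (D + half) (Y - off)) 0 e t u w z
     else if u \<noteq> 0 \<and> data Y \<and> e = 0 \<and> e' \<noteq> 0 \<and> half \<le> D
     then mk (off + set_dig B j (D - half) (Y - off)) e' 0 t u w z
     else mk Y e e' t u w z)"

definition F_shift :: "nat \<Rightarrow> nat \<Rightarrow> reg_map" where
  "F_shift j l Y e e' t u w z =
    (let D = dig B j (Y - off); p = 2 ^ (L - l) in
     if bit e (l - 1) \<and> data Y \<and> u < p \<and> w = 0 \<and> t < p \<and> D < side l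
     then mk (off + set_dig B j (shift_digit p t u D) (Y - off)) e e' 0 u 1 z
     else if bit e (l - 1) \<and> data Y \<and> u < p \<and> w = 1 \<and> t = 0 \<and>
       1 \<le> shift_source p u D \<and> shift_source p u D \<le> side l
     then mk (off + set_dig B j (shift_source p u D - 1) (Y - off)) e e' ((D + 1) mod p) u 0 z
     else mk Y e e' t u w z)"

lemma pow_block: "l \<le> L \<Longrightarrow> 2 ^ (L - l) * (side l + 1) = B + 1"
  by (simp add: side_def B_def flip: power_add)

lemma data_set_dig: "data Y \<Longrightarrow> j < d \<Longrightarrow> v < B \<Longrightarrow>
    data (off + set_dig B j v (Y - off)) \<and> off + set_dig B j v (Y - off) < 2 ^ s"
  using set_dig_less data_diff data_less by presburger

lemma set_dig_back:
  assumes "data Y" "j < d" "v < B"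
  shows "off + set_dig B j (dig B j (Y - off)) (off + set_dig B j v (Y - off) - off) = Y"
proof -
  have "Y - off < B ^ d" using assms(1) by (rule data_diff)
  moreover have "dig B j (Y - off) < B" using B_pos by (rule dig_less)
  ultimately show ?thesis using assms set_dig_dig[of "Y - off" B d j]
    by (simp add: set_dig_set_dig)
qed

lemma F_out_involution: "involutive F_out"
proof -
  have "undone F_out Y e e' t u w z"
    if o: "ok Y e e' t u w z" for Y e e' t u w z
  proof -
    have w: "1 - (1 - w) = w" "1 - w < 2" using okD(6)[OF o] by linarith+
    show ?thesis
    proof (cases "N \<le> Y")
      case True
      then have "F_out Y e e' t u w z = mk Y e e' t u (1 - w) z" "F_out Y e e' t u (1 - w) z = mk Y e e' t u w z"
        using w(1) unfolding F_out_def by (simp_all only: if_True)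
      moreover have "ok Y e e' t u (1 - w) z" using okD[OF o] w(2) by (intro okI)
      ultimately show ?thesis unfolding undone_def by blast
    next
      case False
      then have "F_out Y e e' t u w z = mk Y e e' t u w z" unfolding F_out_def by (simp only: if_False)
      then show ?thesis using o unfolding undone_def by blast
    qed
  qed
  then show ?thesis unfolding involutive_def by blast
qed

lemma two_power_pred_less: "1 \<le> l \<Longrightarrow> l \<le> L \<Longrightarrow> (2::nat) ^ (l - 1) < 2 ^ L"
  by (rule power_strict_increasing) auto

lemma F_in_involution:
  assumes "1 \<le> l" "l \<le> L"
  shows "involutive (F_in l)"
proof -
  let ?F = "F_in l" and ?T = "total_dof d (l - 1)" and ?m = "side l"
  have m: "0 < ?m" "?m \<le> B" using side_pos[OF assms(1)] side_le[OF assms(2)] by auto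
  have T: "total_dof d l = ?T + ?m ^ d" "total_dof d l \<le> N"
    using total_dof_block[OF assms(1)] total_dof_le[OF assms(2)] by auto
  have "undone ?F Y e e' t u w z"
    if o: "ok Y e e' t u w z" for Y e e' t u w z
  proof -
    consider (a) "e = 0 \<and> ?T \<le> Y \<and> Y < total_dof d l"
      | (b) "\<not> (e = 0 \<and> ?T \<le> Y \<and> Y < total_dof d l)" "e = 2 ^ (l - 1) \<and> data Y \<and> (\<forall>j<d. dig B j (Y - off) < ?m)"
      | (c) "\<not> (e = 0 \<and> ?T \<le> Y \<and> Y < total_dof d l)" "\<not> (e = 2 ^ (l - 1) \<and> data Y \<and> (\<forall>j<d. dig B j (Y - off) < ?m))"
      by blast
    then show ?thesis
    proof cases
      case a
      let ?x = "Y - ?T"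
      let ?Y = "off + conv ?m B d ?x"
      have x: "?x < ?m ^ d" "?T + ?x = Y" using a T(1) by linarith+
      have 1: "data ?Y \<and> ?Y < 2 ^ s" using data_less[OF conv_less[OF m]] .
      have 2: "\<forall>j<d. dig B j (?Y - off) < ?m" using m by (simp add: dig_conv dig_less)
      have 3: "conv B ?m d (?Y - off) = ?x" using conv_conv[OF m x(1)] by simp
      have "?F ?Y (2 ^ (l - 1)) e' t u w z = mk Y e e' t u w z"
        using 1 2 3 x a by (simp add: F_in_def)
      moreover have "?F Y e e' t u w z = mk ?Y (2 ^ (l - 1)) e' t u w z" using a by (simp add: F_in_def)
      moreover have "ok ?Y (2 ^ (l - 1)) e' t u w z"
        using okD[OF o] 1 two_power_pred_less[OF assms] by (intro okI) blast+
      ultimately show ?thesis by (rule undoneI)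
    next
      case b
      let ?Y = "?T + conv B ?m d (Y - off)"
      have x: "Y - off < B ^ d" "off + (Y - off) = Y" using b data_diff by auto
      have dg: "\<And>j. j < d \<Longrightarrow> dig B j (Y - off) < ?m" using b by blast
      have 1: "?T \<le> ?Y" "?Y < total_dof d l" using conv_less'[OF dg] T by auto
      have 2: "conv ?m B d (?Y - ?T) = Y - off" using conv_conv'[OF m x(1) dg] by simp
      have "?F ?Y 0 e' t u w z = mk Y e e' t u w z"
        using 1 2 x b by (simp add: F_in_def)
      moreover have "?F Y e e' t u w z = mk ?Y 0 e' t u w z" using b by (simp add: F_in_def)
      moreover have "ok ?Y 0 e' t u w z"
        using okD[OF o] less_le_trans[OF less_le_trans[OF 1(2) T(2)] N_le] by (intro okI) simp_all
      ultimately show ?thesis by (rule undoneI)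
    next
      case c
      then have "?F Y e e' t u w z = mk Y e e' t u w z" unfolding F_in_def by (simp only: if_False)
      then show ?thesis using o unfolding undone_def by blast
    qed
  qed
  then show ?thesis unfolding involutive_def by blast
qed

lemma two_half: "2 * half = B + 1"
  using L by (simp add: half_def B_def flip: power_Suc)

text \<open>Since \<open>B = 2 * half - 1\<close>, the guard \<open>D + 1 < half\<close> is exactly
  the condition for \<open>D + half\<close> to be a base-\<open>B\<close> digit. Exchanging
  \<open>e\<close> and \<open>e'\<close> keeps marked and unmarked indices apart.\<close>

lemma F_mark_involution:
  assumes "j < d"
  shows "involutive (F_mark j)"
proof -
  let ?F = "F_mark j"
  note h = two_half
  have "undone ?F Y e e' t u w z"
    if o: "ok Y e e' t u w z" for Y e e' t u w z
  proof -
    let ?D = "dig B j (Y - off)"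
    have DB: "?D < B" using B_pos by (rule dig_less)
    let ?a = "u \<noteq> 0 \<and> data Y \<and> e \<noteq> 0 \<and> e' = 0 \<and> ?D + 1 < half"
    let ?b = "u \<noteq> 0 \<and> data Y \<and> e = 0 \<and> e' \<noteq> 0 \<and> half \<le> ?D"
    consider (a) ?a | (b) "\<not> ?a" ?b | (c) "\<not> ?a" "\<not> ?b" by blast
    then show ?thesis
    proof cases
      case a
      let ?v = "?D + half"
      let ?Y = "off + set_dig B j ?v (Y - off)"
      have "?D + 1 < half" using a by blast
      then have v: "?v < B" using h by linarith
      have dY: "data Y" using a by blast
      have 1: "data ?Y \<and> ?Y < 2 ^ s" by (rule data_set_dig[OF dY assms v(1)])
      have 2: "dig B j (?Y - off) = ?v" by (simp only: diff_add_inverse dig_set_dig_same[OF B_pos v(1)])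
      have 3: "off + set_dig B j ?D (?Y - off) = Y" by (rule set_dig_back[OF dY assms v(1)])
      have "?F ?Y 0 e t u w z = mk Y e e' t u w z"
        using 1 a 3 unfolding F_mark_def Let_def 2 by simp
      moreover have "?F Y e e' t u w z = mk ?Y 0 e t u w z" using a unfolding F_mark_def Let_def by simp
      moreover have "ok ?Y 0 e t u w z" using okD[OF o] 1 by (intro okI) simp_all
      ultimately show ?thesis by (rule undoneI)
    next
      case b
      let ?v = "?D - half"
      let ?Y = "off + set_dig B j ?v (Y - off)"
      have "half \<le> ?D" using b by blast
      then have v: "?v < B" "?v + 1 < half" using h DB by linarith+
      have dY: "data Y" using b by blast
      have 1: "data ?Y \<and> ?Y < 2 ^ s" by (rule data_set_dig[OF dY assms v(1)])
      have 2: "dig B j (?Y - off) = ?v" by (simp only: diff_add_inverse dig_set_dig_same[OF B_pos v(1)])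
      have 3: "off + set_dig B j ?D (?Y - off) = Y" by (rule set_dig_back[OF dY assms v(1)])
      have 4: "?v + half = ?D" using b by simp
      have "?F ?Y e' 0 t u w z = mk Y e e' t u w z"
        using 1 b 3 v unfolding F_mark_def Let_def 2 4 by simp
      moreover have "?F Y e e' t u w z = mk ?Y e' 0 t u w z" using b unfolding F_mark_def Let_def by simp
      moreover have "ok ?Y e' 0 t u w z" using okD[OF o] 1 by (intro okI) simp_all
      ultimately show ?thesis by (rule undoneI)
    next
      case c
      then have "?F Y e e' t u w z = mk Y e e' t u w z" unfolding F_mark_def Let_def by (simp only: if_False)
      then show ?thesis using o unfolding undone_def by blast
    qed
  qed
  then show ?thesis unfolding involutive_def by blast
qed

text \<open>Clearing \<open>t\<close> loses nothing, since the target coordinate is congruent to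
  \<open>t\<close> modulo \<open>?p\<close>. The flag \<open>w\<close> separates the two directions,
  and the bounds on \<open>?M\<close> select the targets that have a source.\<close>

lemma F_shift_involution:
  assumes "j < d" "1 \<le> l" "l \<le> L"
  shows "involutive (F_shift j l)"
proof -
  let ?F = "F_shift j l" and ?p = "2 ^ (L - l) :: nat" and ?m = "side l"
  have p: "?p > 0" "?p \<le> 2 ^ L" by simp_all
  have "undone ?F Y e e' t u w z"
    if o: "ok Y e e' t u w z" for Y e e' t u w z
  proof -
    let ?D = "dig B j (Y - off)"
    have DB: "?D < B" using B_pos by (rule dig_less)
    let ?a = "bit e (l - 1) \<and> data Y \<and> u < ?p \<and> w = 0 \<and> t < ?p \<and> ?D < ?m"
    let ?M = "shift_source ?p u ?D"
    let ?b = "bit e (l - 1) \<and> data Y \<and> u < ?p \<and> w = 1 \<and> t = 0 \<and> 1 \<le> ?M \<and> ?M \<le> ?m"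
    consider (a) ?a | (b) "\<not> ?a" ?b | (c) "\<not> ?a" "\<not> ?b" by blast
    then show ?thesis
    proof cases
      case a
      let ?v = "shift_digit ?p t u ?D"
      let ?Y = "off + set_dig B j ?v (Y - off)"
      have v: "?v < B" "(?v + 1) mod ?p = t" "shift_source ?p u ?v = ?D + 1"
        using a by (intro shift_digit_props[OF p(1) _ pow_block[OF assms(3)]]; simp)+
      have dY: "data Y" using a by blast
      have 1: "data ?Y \<and> ?Y < 2 ^ s" by (rule data_set_dig[OF dY assms(1) v(1)])
      have 2: "dig B j (?Y - off) = ?v" by (simp only: diff_add_inverse dig_set_dig_same[OF B_pos v(1)])
      have 3: "off + set_dig B j ?D (?Y - off) = Y" by (rule set_dig_back[OF dY assms(1) v(1)])
      have "?F ?Y e e' 0 u 1 z = mk Y e e' t u w z"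
        using 1 a 3 unfolding F_shift_def Let_def 2 v(2,3) by simp
      moreover have "?F Y e e' t u w z = mk ?Y e e' 0 u 1 z" using a unfolding F_shift_def Let_def by simp
      moreover have "ok ?Y e e' 0 u 1 z" using okD[OF o] 1 by (intro okI) simp_all
      ultimately show ?thesis by (rule undoneI)
    next
      case b
      let ?v = "?M - 1" and ?t = "(?D + 1) mod ?p"
      let ?Y = "off + set_dig B j ?v (Y - off)"
      have v: "?v < ?m" using b by linarith
      then have vB: "?v < B" using side_le[OF assms(3)] by linarith
      have t: "?t < ?p" using p(1) by (rule mod_less_divisor)
      have dY: "data Y" using b by blast
      have 1: "data ?Y \<and> ?Y < 2 ^ s" by (rule data_set_dig[OF dY assms(1) vB])
      have 2: "dig B j (?Y - off) = ?v" by (simp only: diff_add_inverse dig_set_dig_same[OF B_pos vB])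
      have 3: "off + set_dig B j ?D (?Y - off) = Y" by (rule set_dig_back[OF dY assms(1) vB])
      have 4: "shift_digit ?p ?t u ?v = ?D" using b by (intro shift_digit_source[OF p(1)]) simp
      have "?F ?Y e e' ?t u 0 z = mk Y e e' t u w z"
        using 1 b 3 v t unfolding F_shift_def Let_def 2 4 by simp
      moreover have "?F Y e e' t u w z = mk ?Y e e' ?t u 0 z" using b unfolding F_shift_def Let_def by simp
      moreover have "ok ?Y e e' ?t u 0 z" using okD[OF o] 1 less_le_trans[OF t p(2)] by (intro okI) simp_all
      ultimately show ?thesis by (rule undoneI)
    next
      case c
      then have "?F Y e e' t u w z = mk Y e e' t u w z" unfolding F_shift_def Let_def by (simp only: if_False)
      then show ?thesis using o unfolding undone_def by blast
    qed
  qed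
  then show ?thesis unfolding involutive_def by blast
qed

end


section \<open>Cost of the involutions\<close>

lemma computes_cat:
  assumes "computes G (bits m u) i" "computes G (bits k v) j"
  shows "computes G (bits (m + k) (\<lambda>x. cat m (u x) (v x))) (i + j)"
proof -
  have "bits (m + k) (\<lambda>x. cat m (u x) (v x)) \<subseteq> bits m u \<union> bits k v"
  proof
    fix f assume "f \<in> bits (m + k) (\<lambda>x. cat m (u x) (v x))"
    then obtain i where i: "i < m + k" "f = (\<lambda>x. bit (cat m (u x) (v x)) i)" by (auto simp: bits_def)
    show "f \<in> bits m u \<union> bits k v"
    proof (cases "i < m")
      case True
      then show ?thesis using i bits_mem[of i m u] by (simp add: bit_cat)
    next
      case False
      then show ?thesis using i bits_mem[of "i - m" k v] by (simp add: bit_cat)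
    qed
  qed
  from computes_weaken[OF computes_Un[OF assms] this order_refl] show ?thesis .
qed

text \<open>A field is a slice of the input wires; gates are spent only on constants that pad it to
  the common width \<open>M\<close>.\<close>

lemma computes_field:
  assumes "a + m \<le> n" "m \<le> M" "\<And>x i. bit (v x) i \<longleftrightarrow> i < m \<and> bit x (a + i)"
  shows "num M (inputs n) v M"
  unfolding num_def
proof (intro conjI allI)
  fix x show "v x < 2 ^ M" unfolding nat_less_exp_iff_bit using assms(2,3) by auto
next
  have "computes (inputs n) {\<lambda>x. bit (v x) i} 1" for i
  proof (cases "i < m")
    case True
    then have "(\<lambda>x. bit (v x) i) = (\<lambda>x. bit x (a + i))" using assms(3) by auto
    moreover have "computes (inputs n) {\<lambda>x. bit x (a + i)} 0"
      using True assms(1) bits_mem[of "a + i" n "\<lambda>x. x"] by (intro computes_mem) auto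
    ultimately show ?thesis by (auto elim: computes_weaken)
  next
    case False
    then have "(\<lambda>x. bit (v x) i) = (\<lambda>x. False)" using assms(3) by auto
    then show ?thesis using computes_const[of "inputs n" False] by simp
  qed
  then have "computes (inputs n) (\<Union>i<M. {\<lambda>x. bit (v x) i}) (M * 1)" by (intro computes_UN)
  then show "computes (inputs n) (bits M v) M" by (simp add: bits_UN)
qed

section \<open>Uniform cost of the index arithmetic\<close>

context registers
begin

text \<open>\<open>2 ^ M\<close> exceeds every intermediate result of the index arithmetic.\<close>

definition M where "M = s + 2 * L + 3"
text \<open>Chosen so that every arithmetic operation costs at most one unit and bounds become
  operation counts. Division dominates with \<open>184 * (M * M)\<close> gates plus lower terms; the
  rest of the \<open>1000\<close> is slack.\<close>

definition unit_cost where "unit_cost = 1000 * (M * M)"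

definition NUM where "NUM v k \<longleftrightarrow> num M (inputs n) v (k * unit_cost)"
definition BOOL where "BOOL f k \<longleftrightarrow> computes (inputs n) {f} (k * unit_cost)"
definition MAP where "MAP f k \<longleftrightarrow> computes (inputs n) (bits n f) (k * unit_cost)"

lemma M_le: "M \<le> M * M" "1 \<le> M" by (simp_all add: M_def)

lemma n_le: "n \<le> 2 * M" by (simp add: M_def n_def)

lemma unit_cost_ge: "a \<le> 600 \<Longrightarrow> b \<le> 200 \<Longrightarrow> e \<le> 200 \<Longrightarrow> M * (M * a + b) + M * e \<le> unit_cost"
proof -
  assume a: "a \<le> 600" "b \<le> 200" "e \<le> 200"
  have "M * (M * a + b) + M * e = (M * M) * a + M * (b + e)" by (simp add: algebra_simps)
  also have "\<dots> \<le> (M * M) * 600 + (M * M) * 400"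
    using a M_le by (intro add_mono mult_mono) auto
  finally show ?thesis by (simp add: unit_cost_def)
qed

lemma unit_cost_ge': "e \<le> 200 \<Longrightarrow> i \<le> 200 \<Longrightarrow> M * e + i \<le> unit_cost"
proof -
  assume a: "e \<le> 200" "i \<le> 200"
  have "M * e + i \<le> M * 200 + M * 200" using a M_le(2) by (intro add_mono mult_mono) auto
  also have "\<dots> \<le> 1000 * (M * M)" using M_le(1) by linarith
  finally show ?thesis by (simp add: unit_cost_def)
qed

lemma num_weaken: "num m G v k \<Longrightarrow> k \<le> k' \<Longrightarrow> num m G v k'"
  unfolding num_def using computes_weaken by blast

lemma NUM_weaken: "NUM v k \<Longrightarrow> k \<le> k' \<Longrightarrow> NUM v k'"
  unfolding NUM_def by (erule num_weaken) simp

lemma BOOL_weaken: "BOOL v k \<Longrightarrow> k \<le> k' \<Longrightarrow> BOOL v k'"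
  unfolding BOOL_def by (erule computes_weaken) simp_all

lemma MAP_weaken: "MAP v k \<Longrightarrow> k \<le> k' \<Longrightarrow> MAP v k'"
  unfolding MAP_def by (erule computes_weaken) simp_all

lemma cost1: "e \<le> c \<Longrightarrow> k * c + e \<le> (k + 1) * c" for c :: nat
  unfolding distrib_right mult_1 by (rule add_left_mono)

lemma cost2: "e \<le> c \<Longrightarrow> k * c + j * c + e \<le> (k + j + 1) * c" for c :: nat
  unfolding distrib_right mult_1 by (rule add_left_mono)

lemma cost3: "e \<le> c \<Longrightarrow> i * c + k * c + j * c + e \<le> (i + k + j + 1) * c" for c :: nat
  unfolding distrib_right mult_1 by (rule add_left_mono)

lemma cost_sum: "e \<le> c \<Longrightarrow> e' \<le> c \<Longrightarrow> d * (k * c + e) + e' \<le> (d * (k + 1) + 1) * c" for c :: nat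
proof -
  assume e: "e \<le> c" "e' \<le> c"
  have "d * (k * c + e) \<le> d * ((k + 1) * c)" using cost1[OF e(1)] by (rule mult_left_mono) simp
  then have "d * (k * c + e) + e' \<le> d * ((k + 1) * c) + c" using e(2) by (rule add_mono)
  also have "\<dots> = (d * (k + 1) + 1) * c" by (simp only: distrib_right mult_1 mult.assoc)
  finally show ?thesis .
qed

lemma NUM_const:
  assumes "c < 2 ^ M"
  shows "NUM (\<lambda>x. c) 1"
  unfolding NUM_def by (rule num_weaken[OF num_const[OF assms]]) (use unit_cost_ge'[of 1 0] in simp)

lemma NUM_add:
  assumes "NUM u k" "NUM v j" "\<And>x. u x + v x < 2 ^ M"
  shows "NUM (\<lambda>x. u x + v x) (k + j + 1)"
  unfolding NUM_def
  by (rule num_weaken[OF num_add[OF assms[unfolded NUM_def]] cost2]) (use unit_cost_ge'[of 40 1] in simp)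

lemma NUM_if:
  assumes "BOOL b i" "NUM u k" "NUM v j"
  shows "NUM (\<lambda>x. if b x then u x else v x) (i + k + j + 1)"
  unfolding NUM_def BOOL_def
  by (rule num_weaken[OF num_if[OF assms[unfolded NUM_def BOOL_def]] cost3]) (use unit_cost_ge'[of 8 0] in simp)

lemma NUM_diff:
  assumes "NUM u k" "c < 2 ^ M"
  shows "NUM (\<lambda>x. u x - c) (k + 1)"
  unfolding NUM_def
  by (rule num_weaken[OF num_diff_const[OF assms[unfolded NUM_def]] cost1]) (use unit_cost_ge'[of 92 2] in simp)

lemma NUM_mult:
  assumes "NUM u k" "\<And>x. u x * c < 2 ^ M"
  shows "NUM (\<lambda>x. u x * c) (k + 1)"
  unfolding NUM_def
  by (rule num_weaken[OF num_mult_const[OF assms[unfolded NUM_def]] cost1]) (use unit_cost_ge[of 50 1 1] in simp)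

lemma NUM_div:
  assumes "NUM u k" "0 < c"
  shows "NUM (\<lambda>x. u x div c) (k + 1)"
  unfolding NUM_def
  by (rule num_weaken[OF num_div_mod_const(1)[OF assms[unfolded NUM_def]] cost1]) (use unit_cost_ge[of 184 6 0] in simp)

lemma NUM_mod:
  assumes "NUM u k" "0 < c"
  shows "NUM (\<lambda>x. u x mod c) (k + 1)"
  unfolding NUM_def
  by (rule num_weaken[OF num_div_mod_const(2)[OF assms[unfolded NUM_def]] cost1]) (use unit_cost_ge[of 184 6 0] in simp)

lemma NUM_sum:
  assumes "\<And>i. i < d \<Longrightarrow> NUM (v i) k" "\<And>x. (\<Sum>i<d. v i x) < 2 ^ M"
  shows "NUM (\<lambda>x. \<Sum>i<d. v i x) (d * (k + 1) + 1)"
proof -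
  have "num M (inputs n) (\<lambda>x. \<Sum>i<d. v i x) (d * (k * unit_cost + (M * 40 + 1)) + M)"
    using assms unfolding NUM_def by (rule num_sum)
  moreover have "M * 40 + 1 \<le> unit_cost" by (rule unit_cost_ge') simp_all
  moreover have "M \<le> unit_cost" using unit_cost_ge'[of 1 0] by simp
  ultimately show ?thesis unfolding NUM_def using num_weaken[OF _ cost_sum] by blast
qed

lemma BOOL_less:
  assumes "NUM u k" "NUM v j"
  shows "BOOL (\<lambda>x. u x < v x) (k + j + 1)"
  unfolding NUM_def BOOL_def
  by (rule computes_weaken[OF num_less[OF assms[unfolded NUM_def BOOL_def]] order_refl cost2]) (use unit_cost_ge'[of 41 1] in simp)

lemma BOOL_not:
  assumes "BOOL f k"
  shows "BOOL (\<lambda>x. \<not> f x) (k + 1)"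
  unfolding BOOL_def
  by (rule computes_weaken[OF computes_not[OF assms[unfolded BOOL_def]] order_refl cost1]) (use unit_cost_ge'[of 0 1] in simp)

lemma BOOL_and:
  assumes "BOOL f k" "BOOL g j"
  shows "BOOL (\<lambda>x. f x \<and> g x) (k + j + 1)"
  unfolding BOOL_def
  by (rule computes_weaken[OF computes_and[OF assms[unfolded BOOL_def]] order_refl cost2]) (use unit_cost_ge'[of 0 2] in simp)

lemma BOOL_le: "NUM u k \<Longrightarrow> NUM v j \<Longrightarrow> BOOL (\<lambda>x. u x \<le> v x) (k + j + 2)"
  using BOOL_not[OF BOOL_less[of v j u k]] by (simp add: not_less add.commute)

lemma BOOL_eq: "NUM u k \<Longrightarrow> NUM v j \<Longrightarrow> BOOL (\<lambda>x. u x = v x) (2 * k + 2 * j + 5)"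
proof -
  assume "NUM u k" "NUM v j"
  then have "BOOL (\<lambda>x. u x \<le> v x \<and> v x \<le> u x) ((k + j + 2) + (j + k + 2) + 1)"
    by (intro BOOL_and BOOL_le)
  moreover have "(\<lambda>x. u x \<le> v x \<and> v x \<le> u x) = (\<lambda>x. u x = v x)" by (auto simp: fun_eq_iff)
  ultimately show ?thesis by (auto elim: BOOL_weaken)
qed

lemma BOOL_all:
  assumes "\<And>i. i < d \<Longrightarrow> BOOL (f i) k"
  shows "BOOL (\<lambda>x. \<forall>i<d. f i x) (d * (k + 1) + 1)"
proof -
  have "computes (inputs n) {\<lambda>x. \<forall>i<d. f i x} (d * (k * unit_cost + 2) + 1)"
    using assms unfolding BOOL_def by (rule computes_all)
  moreover have "2 \<le> unit_cost" "1 \<le> unit_cost"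
    using unit_cost_ge'[of 0 2] by simp_all
  ultimately show ?thesis unfolding BOOL_def using computes_weaken[OF _ order_refl cost_sum] by blast
qed

lemma MAP_id: "MAP (\<lambda>x. x) 0"
  unfolding MAP_def by (rule computes_weaken[OF computes_mem[OF order_refl]]) simp_all

lemma MAP_if: "BOOL b i \<Longrightarrow> MAP f k \<Longrightarrow> MAP g j \<Longrightarrow> MAP (\<lambda>x. if b x then f x else g x) (i + k + j + 1)"
proof -
  assume *: "BOOL b i" "MAP f k" "MAP g j"
  have "n * 8 \<le> M * 16 + 0" using n_le by simp
  also have "\<dots> \<le> unit_cost" by (rule unit_cost_ge') simp_all
  finally show ?thesis using * unfolding BOOL_def MAP_def
    by (intro computes_weaken[OF computes_bits_if order_refl cost3])
qed

lemma NUM_bits: "NUM v k \<Longrightarrow> m \<le> M \<Longrightarrow> computes (inputs n) (bits m v) (k * unit_cost)"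
  unfolding NUM_def num_def using computes_weaken bits_mono by blast

lemma NUM_field:
  assumes "a + m \<le> n" "m \<le> M" "\<And>x i. bit (v x) i \<longleftrightarrow> i < m \<and> bit x (a + i)"
  shows "NUM v 1"
  unfolding NUM_def by (rule num_weaken[OF computes_field[OF assms]]) (use unit_cost_ge'[of 1 0] in simp_all)

lemma NUM_rY: "NUM rY 1"
  by (rule NUM_field[of 0 s]) (auto simp: n_def M_def rY_def bit_simps)

lemma NUM_re: "NUM re 1"
  by (rule NUM_field[of s L]) (auto simp: n_def M_def re_def bit_simps ac_simps)

lemma NUM_re': "NUM re' 1"
  by (rule NUM_field[of "s + L" L]) (auto simp: n_def M_def re'_def bit_simps ac_simps)

lemma NUM_rt: "NUM rt 1"
  by (rule NUM_field[of "s + L + L" L]) (auto simp: n_def M_def rt_def bit_simps ac_simps)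

lemma NUM_ru: "NUM ru 1"
  by (rule NUM_field[of "s + 3 * L" L]) (auto simp: n_def M_def ru_def bit_simps ac_simps eval_nat_numeral)

lemma NUM_rw: "NUM rw 1"
proof (rule NUM_field[of "s + 4 * L" 1])
  show "bit (rw x) i \<longleftrightarrow> i < 1 \<and> bit x (s + 4 * L + i)" for x i
    unfolding rw_def bit_take_bit_iff bit_drop_bit_eq by (auto simp: ac_simps eval_nat_numeral)
qed (auto simp: n_def M_def)

lemma MAP_mk:
  assumes "NUM Y a1" "NUM e a2" "NUM e' a3" "NUM t a4" "NUM u a5" "NUM w a6"
  shows "MAP (\<lambda>x. mk (Y x) (e x) (e' x) (t x) (u x) (w x) (rz x)) (a1 + (a2 + (a3 + (a4 + (a5 + a6)))))"
proof -
  have "(\<lambda>x. bit (rz x) 0) = (\<lambda>x. bit x (s + 4 * L + 1))"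
    unfolding rz_def bit_drop_bit_eq by (auto simp: ac_simps eval_nat_numeral fun_eq_iff)
  moreover have "s + 4 * L + 1 < n" by (simp add: n_def)
  ultimately have "bits 1 rz \<subseteq> inputs n" using bits_mem[of "s + 4 * L + 1" n "\<lambda>x. x"]
    by (auto simp: bits_def)
  then have "computes (inputs n) (bits n (\<lambda>x. mk (Y x) (e x) (e' x) (t x) (u x) (w x) (rz x)))
      (a1 * unit_cost + (a2 * unit_cost + (a3 * unit_cost + (a4 * unit_cost + (a5 * unit_cost + (a6 * unit_cost + 0))))))"
    unfolding mk_def n_def by (intro computes_cat NUM_bits[unfolded n_def] assms computes_mem) (simp_all add: M_def)
  then show ?thesis unfolding MAP_def by (rule computes_weaken) (simp_all add: algebra_simps)
qed

lemma BOOL_bit: "NUM v k \<Longrightarrow> i < M \<Longrightarrow> BOOL (\<lambda>x. bit (v x) i) k"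
  unfolding NUM_def num_def BOOL_def using computes_bit by blast

end

context bpx_circuit
begin

lemma less_M: "x < 2 ^ s \<Longrightarrow> x < 2 ^ M" "x \<le> 2 ^ s \<Longrightarrow> x < 2 ^ M" "x \<le> 2 ^ L \<Longrightarrow> x < 2 ^ M" for x :: nat
proof -
  have "(2::nat) ^ s < 2 ^ M" "(2::nat) ^ L < 2 ^ M" by (rule power_strict_increasing; simp add: M_def)+
  then show "x < 2 ^ s \<Longrightarrow> x < 2 ^ M" "x \<le> 2 ^ s \<Longrightarrow> x < 2 ^ M" "x \<le> 2 ^ L \<Longrightarrow> x < 2 ^ M" by linarith+
qed

lemma M_split: "(2::nat) ^ M = 2 ^ s * (2 * 2 ^ (2 * L + 2))"
  by (simp add: M_def power_add)

lemma off_le: "off \<le> 2 ^ s" and Bd_le: "B ^ d \<le> 2 ^ s" and tot_le: "l \<le> L \<Longrightarrow> total_dof d l \<le> 2 ^ s"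
  using off N_le total_dof_le[of l] by linarith+

lemma B_less: "B < 2 ^ L"
  by (simp add: B_def)

lemma rY_less: "rY x < 2 ^ s" and rt_less: "rt x < 2 ^ L"
  unfolding rY_def rt_def by (rule take_bit_nat_less_exp)+

lemma one_less_M: "1 < (2::nat) ^ M"
  by (rule less_M(3)) simp

lemma half_le: "half \<le> 2 ^ L"
  by (simp add: half_def)

lemma NUM_consts: "NUM (\<lambda>x. 0) 1" "NUM (\<lambda>x. 1) 1" "NUM (\<lambda>x. N) 1" "NUM (\<lambda>x. off) 1"
  "NUM (\<lambda>x. half) 1" "NUM (\<lambda>x. 2 ^ (L - i)) 1"
proof -
  show "NUM (\<lambda>x. 0) 1" by (rule NUM_const) simp
  show "NUM (\<lambda>x. 1) 1" by (rule NUM_const[OF one_less_M])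
  show "NUM (\<lambda>x. N) 1" by (rule NUM_const[OF less_M(2)[OF N_le]])
  show "NUM (\<lambda>x. off) 1" by (rule NUM_const[OF less_M(2)[OF off_le]])
  show "NUM (\<lambda>x. half) 1" by (rule NUM_const[OF less_M(3)[OF half_le]])
  show "NUM (\<lambda>x. 2 ^ (L - i)) 1" by (rule NUM_const[OF less_M(3)]) simp
qed

lemma NUM_X: "NUM (\<lambda>x. rY x - off) 2"
  by (rule NUM_weaken[OF NUM_diff[OF NUM_rY less_M(2)[OF off_le]]]) simp

lemma NUM_dig: "NUM v k \<Longrightarrow> 0 < a \<Longrightarrow> NUM (\<lambda>x. dig a j (v x)) (k + 2)"
  unfolding dig_def using NUM_mod[OF NUM_div[of v k "a ^ j"], of a] by (simp add: numeral_2_eq_2)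

lemma NUM_D: "NUM (\<lambda>x. dig B j (rY x - off)) 4"
  using NUM_dig[OF NUM_X B_pos] by simp

lemma NUM_conv:
  assumes "NUM v k" "0 < a" "\<And>x. conv a b d (v x) < 2 ^ M"
  shows "NUM (\<lambda>x. conv a b d (v x)) (d * (k + 4) + 1)"
proof -
  have "dig a j (v x) * b ^ j \<le> conv a b d (v x)" if "j < d" for j x
    unfolding conv_def using that by (intro member_le_sum) auto
  then have "NUM (\<lambda>x. dig a j (v x) * b ^ j) (k + 2 + 1)" if "j < d" for j
    using that le_less_trans[OF _ assms(3)] by (intro NUM_mult NUM_dig assms(1,2)) blast
  then have "NUM (\<lambda>x. \<Sum>j<d. dig a j (v x) * b ^ j) (d * (k + 2 + 1 + 1) + 1)"
    using assms(3) unfolding conv_def by (intro NUM_sum)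
  moreover have "k + 2 + 1 + 1 = k + 4" by simp
  ultimately show ?thesis unfolding conv_def by (simp only:)
qed

lemma set_dig_le: "set_dig b j v x \<le> x + v * b ^ j"
proof -
  have "x mod (b ^ j * b) = b ^ j * (x div b ^ j mod b) + x mod b ^ j" by (rule mod_mult2_eq)
  then have "x mod b ^ j \<le> x mod b ^ Suc j" by (simp add: mult.commute)
  then have "x mod b ^ j + x div b ^ Suc j * b ^ Suc j \<le> x mod b ^ Suc j + x div b ^ Suc j * b ^ Suc j"
    by (rule add_right_mono)
  also have "\<dots> = x" by (rule mod_div_mult_eq)
  finally show ?thesis unfolding set_dig_def by linarith
qed

text \<open>Overflow has to be excluded at every input, also where the register holds no data index
  and \<open>v\<close> is not a base-\<open>B\<close> digit. This explains the generous bound on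
  \<open>v\<close> and the size of \<open>M\<close>.\<close>

lemma NUM_set_dig:
  assumes "NUM v k" "\<And>x. v x < 2 ^ (2 * L + 2)" "j < d"
  shows "NUM (\<lambda>x. off + set_dig B j (v x) (rY x - off)) (k + 15)"
proof -
  have Bj: "B ^ j \<le> 2 ^ s"
    using power_increasing[of j d B] assms(3) B_pos Bd_le by linarith
  have vB: "v x * B ^ j + 2 ^ s \<le> 2 ^ s * 2 ^ (2 * L + 2)" for x
  proof -
    have "v x * B ^ j \<le> v x * 2 ^ s" using Bj by (rule mult_left_mono) simp
    moreover have "Suc (v x) * 2 ^ s \<le> 2 ^ (2 * L + 2) * 2 ^ s"
      using assms(2)[of x] by (intro mult_right_mono) auto
    ultimately have "v x * B ^ j + 2 ^ s \<le> 2 ^ (2 * L + 2) * 2 ^ s" unfolding mult_Suc by linarith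
    then show ?thesis by (simp only: mult.commute)
  qed
  have big: "(2::nat) ^ s \<le> 2 ^ s * 2 ^ (2 * L + 2)" by simp
  have X: "rY x - off < 2 ^ s" for x using rY_less[of x] by linarith
  have tot: "off + (rY x - off + v x * B ^ j) < 2 ^ M" for x
    using vB[of x] X[of x] off_le big unfolding M_split by linarith
  have le: "off + set_dig B j (v x) (rY x - off) < 2 ^ M" for x
    using set_dig_le[of B j "v x" "rY x - off"] tot[of x] by linarith
  have parts: "(rY x - off) mod B ^ j + v x * B ^ j + (rY x - off) div B ^ Suc j * B ^ Suc j < 2 ^ M" for x
    using le[of x] unfolding set_dig_def by linarith
  have Bp: "0 < B ^ j" "0 < B ^ Suc j" using B_pos by simp_all
  have "NUM (\<lambda>x. (rY x - off) mod B ^ j) 3" using NUM_mod[OF NUM_X Bp(1)] by simp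
  moreover have "NUM (\<lambda>x. v x * B ^ j) (k + 1)"
    using parts by (intro NUM_mult assms(1)) (meson add_lessD1 add_leD2 le_less_trans le_add2 trans_le_add1)
  moreover have "NUM (\<lambda>x. (rY x - off) div B ^ Suc j * B ^ Suc j) 4"
    using NUM_mult[OF NUM_div[OF NUM_X Bp(2)], of "B ^ Suc j"] parts by (simp del: power_Suc) (meson le_add2 le_less_trans)
  moreover have "(rY x - off) mod B ^ j + v x * B ^ j < 2 ^ M" for x
    using parts[of x] by linarith
  ultimately have "NUM (\<lambda>x. (rY x - off) mod B ^ j + v x * B ^ j + (rY x - off) div B ^ Suc j * B ^ Suc j)
      ((3 + (k + 1) + 1) + 4 + 1)"
    using parts by (intro NUM_add)
  then have "NUM (\<lambda>x. off + set_dig B j (v x) (rY x - off)) (1 + ((3 + (k + 1) + 1) + 4 + 1) + 1)"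
    using NUM_add[OF NUM_const[OF less_M(2)[OF off_le]]] le unfolding set_dig_def by blast
  then show ?thesis by (rule NUM_weaken) simp
qed

text \<open>The constants in this and the next three bounds are rounded: the cost rules follow the
  term of the map and add up a concrete count, which is compared with the bound at the end.\<close>

lemma MAP_F_out: "MAP (app F_out) 50"
proof -
  have "app F_out = (\<lambda>x. if N \<le> rY x then mk (rY x) (re x) (re' x) (rt x) (ru x) (if 0 < rw x then 0 else 1) (rz x) else x)"
  proof
    fix x
    have "1 - rw x = (if 0 < rw x then 0 else 1)" by simp
    then show "app F_out x = (if N \<le> rY x then mk (rY x) (re x) (re' x) (rt x) (ru x) (if 0 < rw x then 0 else 1) (rz x) else x)"
      unfolding app_def F_out_def mk_fields by (simp only:)
  qed
  moreover have "MAP (\<lambda>x. if N \<le> rY x then mk (rY x) (re x) (re' x) (rt x) (ru x) (if 0 < rw x then 0 else 1) (rz x) else x) 50"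
    by (rule MAP_weaken, (rule MAP_if MAP_id MAP_mk NUM_rY NUM_re NUM_re' NUM_rt NUM_ru NUM_rw NUM_if BOOL_less BOOL_le NUM_consts)+, simp)
  ultimately show ?thesis by simp
qed

text \<open>Two digit conversions and a test of all digits make this the one involution whose
  operation count grows with \<open>d\<close>.\<close>

lemma MAP_F_in:
  assumes l: "1 \<le> l" "l \<le> L"
  shows "MAP (app (F_in l)) (22 * d + 100)"
proof -
  let ?T = "total_dof d (l - 1)" and ?T' = "total_dof d l" and ?m = "side l"
  have m: "0 < ?m" "?m \<le> B" using side_pos[OF l(1)] side_le[OF l(2)] by auto
  have T: "?T \<le> 2 ^ s" "?T' \<le> 2 ^ s" using tot_le[of "l - 1"] tot_le[of l] l by auto
  have c: "NUM (\<lambda>x. ?T) 1" "NUM (\<lambda>x. ?T') 1" "NUM (\<lambda>x. ?m) 1" "NUM (\<lambda>x. 2 ^ (l - 1)) 1"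
    using T m(2) B_less two_power_pred_less[OF l] by (intro NUM_const less_M(2,3); simp)+
  have "NUM (\<lambda>x. conv ?m B d (rY x - ?T)) (d * (1 + 1 + 4) + 1)"
  proof (intro NUM_conv NUM_diff NUM_rY m(1) less_M(2)[OF T(1)])
    show "conv ?m B d (rY x - ?T) < 2 ^ M" for x
      using conv_less[OF m, of d "rY x - ?T"] Bd_le by (intro less_M(2)) linarith
  qed
  then have 1: "NUM (\<lambda>x. off + conv ?m B d (rY x - ?T)) (1 + (d * (1 + 1 + 4) + 1) + 1)"
  proof (intro NUM_add NUM_consts)
    show "off + conv ?m B d (rY x - ?T) < 2 ^ M" for x
      using conv_less[OF m, of d "rY x - ?T"] off N_le by (intro less_M(2)) linarith
  qed
  have cv: "conv B ?m d x < B ^ d" for x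
  proof -
    have "conv B ?m d x \<le> (\<Sum>j<d. dig B j x * B ^ j)"
      unfolding conv_def using m(2) by (intro sum_mono mult_left_mono power_mono) auto
    also have "\<dots> < B ^ d" using B_pos by (intro sum_digits_less dig_less)
    finally show ?thesis .
  qed
  have "NUM (\<lambda>x. conv B ?m d (rY x - off)) (d * (2 + 4) + 1)"
    by (intro NUM_conv NUM_X B_pos less_M(1) less_le_trans[OF cv Bd_le])
  then have 2: "NUM (\<lambda>x. ?T + conv B ?m d (rY x - off)) (1 + (d * (2 + 4) + 1) + 1)"
  proof (intro NUM_add c)
    show "?T + conv B ?m d (rY x - off) < 2 ^ M" for x
    proof -
      have "(2::nat) ^ s * 2 \<le> 2 ^ s * (2 * 2 ^ (2 * L + 2))" by (intro mult_left_mono) auto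
      then show ?thesis using cv[of "rY x - off"] Bd_le T(1) unfolding M_split by linarith
    qed
  qed
  have 3: "BOOL (\<lambda>x. \<forall>j<d. dig B j (rY x - off) < ?m) (d * (4 + 1 + 1 + 1) + 1)"
    by (intro BOOL_all BOOL_less NUM_D c)
  show ?thesis
    unfolding app_def[abs_def] F_in_def Let_def mk_fields
    by (rule MAP_weaken, (rule 1 2 3 c MAP_if MAP_id MAP_mk NUM_rY NUM_re NUM_re' NUM_rt NUM_ru NUM_rw NUM_consts
        BOOL_and BOOL_eq BOOL_less BOOL_le)+, simp)
qed

lemma small_digit: "dig B j x < 2 ^ L"
  using dig_less[OF B_pos] B_less less_trans by blast

lemma pow_bound: "x \<le> 4 * 2 ^ L \<Longrightarrow> x \<le> 2 ^ (2 * L + 2)" for x :: nat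
proof -
  assume "x \<le> 4 * 2 ^ L"
  also have "4 * 2 ^ L \<le> (2::nat) ^ (2 * L + 2)"
    using power_increasing[of "L + 2" "2 * L + 2" "2::nat"] by simp
  finally show ?thesis .
qed

lemma less_M': "x \<le> 2 ^ (2 * L + 2) \<Longrightarrow> x < 2 ^ M" for x :: nat
proof -
  assume "x \<le> 2 ^ (2 * L + 2)"
  also have "(2::nat) ^ (2 * L + 2) < 2 ^ M" by (rule power_strict_increasing) (simp_all add: M_def)
  finally show ?thesis .
qed

lemma two_L_le: "(2::nat) ^ L \<le> 2 ^ (2 * L + 2)"
  by (rule power_increasing) simp_all

lemma MAP_F_mark:
  assumes "j < d"
  shows "MAP (app (F_mark j)) 200"
proof -
  let ?D = "\<lambda>x. dig B j (rY x - off)"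
  have "NUM (\<lambda>x. ?D x + half) (4 + 1 + 1)"
  proof (rule NUM_add[OF NUM_D NUM_consts(5)])
    show "?D x + half < 2 ^ M" for x
      using small_digit[of j "rY x - off"] half_le by (intro less_M' pow_bound) linarith
  qed
  then have 1: "NUM (\<lambda>x. off + set_dig B j (?D x + half) (rY x - off)) (4 + 1 + 1 + 15)"
  proof (rule NUM_set_dig[OF _ _ assms])
    show "?D x + half < 2 ^ (2 * L + 2)" for x
      using small_digit[of j "rY x - off"] half_le pow_bound[of "?D x + half + 1"] by simp
  qed
  have "NUM (\<lambda>x. ?D x - half) (4 + 1)"
    by (intro NUM_diff NUM_D less_M(3) half_le)
  then have 2: "NUM (\<lambda>x. off + set_dig B j (?D x - half) (rY x - off)) (4 + 1 + 15)"
  proof (rule NUM_set_dig[OF _ _ assms])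
    show "?D x - half < 2 ^ (2 * L + 2)" for x
      using small_digit[of j "rY x - off"] two_L_le by linarith
  qed
  have 3: "NUM (\<lambda>x. ?D x + 1) (4 + 1 + 1)"
    by (intro NUM_add NUM_D NUM_consts less_M(3)) (use small_digit[of j] in \<open>simp add: Suc_le_eq\<close>)
  show ?thesis
    unfolding app_def[abs_def] F_mark_def Let_def mk_fields
    by (rule MAP_weaken, (rule 1 2 3 NUM_D MAP_if MAP_id MAP_mk NUM_rY NUM_re NUM_re' NUM_rt NUM_ru NUM_rw NUM_consts
        BOOL_and BOOL_not BOOL_eq BOOL_less BOOL_le)+, simp)
qed

lemma MAP_F_shift:
  assumes "j < d" "1 \<le> l" "l \<le> L"
  shows "MAP (app (F_shift j l)) 400"
proof -
  let ?D = "\<lambda>x. dig B j (rY x - off)" and ?p = "2 ^ (L - l) :: nat" and ?m = "side l"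
  have p: "0 < ?p" "?p \<le> 2 ^ L" by simp_all
  have m: "?m < 2 ^ M" using side_le[OF assms(3)] B_less by (intro less_M(3)) simp
  \<comment> \<open>Inputs outside the domain of the shift can make the product nearly
    \<open>2 ^ (2 * L)\<close>; the factor \<open>4\<close> in \<open>2 ^ (2 * L + 2)\<close>
    absorbs it together with the two summands.\<close>
  have Dp: "?D x * ?p + 2 ^ L + 2 ^ L < 2 ^ (2 * L + 2)" for x
  proof -
    have "?D x * ?p \<le> 2 ^ L * 2 ^ L" using small_digit[of j "rY x - off"] p by (intro mult_mono) auto
    moreover have "(2::nat) ^ (2 * L + 2) = 4 * (2 ^ L * 2 ^ L)" by (simp add: power_add mult_2)
    moreover have "(2::nat) ^ L * 1 \<le> 2 ^ L * 2 ^ L" by (intro mult_left_mono) auto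
    moreover have "(0::nat) < 2 ^ L" by simp
    ultimately show ?thesis by linarith
  qed
  have pp: "?p - 1 \<le> 2 ^ L" using p by linarith
  have d1: "?D x * ?p < 2 ^ M" "?D x * ?p + rt x < 2 ^ M" "?D x * ?p + (?p - 1) < 2 ^ M"
    "?D x * ?p + (?p - 1) + rt x < 2 ^ M" for x
    using Dp[of x] rt_less[of x] pp by (intro less_M'; linarith)+
  have cp: "NUM (\<lambda>x. ?p - 1) 1" by (rule NUM_const[OF less_M(3)[OF pp]])
  have sd: "NUM (\<lambda>x. shift_digit ?p (rt x) (ru x) (?D x)) 30"
    unfolding shift_digit_def
    by (rule NUM_weaken, (rule cp NUM_if BOOL_less NUM_ru NUM_rt NUM_D NUM_diff[where c = 1, OF _ one_less_M] NUM_add NUM_mult d1)+, simp)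
  have 1: "NUM (\<lambda>x. off + set_dig B j (shift_digit ?p (rt x) (ru x) (?D x)) (rY x - off)) (30 + 15)"
  proof (rule NUM_set_dig[OF sd _ assms(1)])
    show "shift_digit ?p (rt x) (ru x) (?D x) < 2 ^ (2 * L + 2)" for x
      using Dp[of x] rt_less[of x] pp unfolding shift_digit_def
      by (split if_split, intro conjI impI; linarith)
  qed
  have D1: "?D x + 1 < 2 ^ M" for x
    using small_digit[of j "rY x - off"] by (intro less_M(3)) simp
  have ND1: "NUM (\<lambda>x. ?D x + 1) 6"
    by (rule NUM_weaken, (rule NUM_add NUM_D NUM_consts D1)+, simp)
  have b: "shift_source ?p (ru x) (?D x) \<le> 2 ^ L + 1" for x
  proof -
    have "(?D x + 1) div ?p \<le> ?D x + 1" by (rule div_le_dividend)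
    then show ?thesis using small_digit[of j "rY x - off"] unfolding shift_source_def
      by (split if_split, intro conjI impI; linarith)
  qed
  have "(1::nat) \<le> 2 ^ L" by simp
  then have "(2::nat) ^ L + 1 + 1 \<le> 4 * 2 ^ L" by linarith
  then have b': "shift_source ?p (ru x) (?D x) < 2 ^ (2 * L + 2)" for x
    using b[of x] pow_bound[of "2 ^ L + 1 + 1"] by linarith
  have ss: "NUM (\<lambda>x. shift_source ?p (ru x) (?D x)) 40"
  proof -
    have "NUM (\<lambda>x. (?D x + 1) div ?p + (if ru x < (?D x + 1) mod ?p then 1 else 0)) ((6 + 1) + ((1 + (6 + 1) + 1) + 1 + 1 + 1) + 1)"
      using less_M'[OF less_imp_le[OF b']] unfolding shift_source_def
      by (intro NUM_add NUM_if BOOL_less NUM_div NUM_mod ND1 NUM_ru NUM_consts p(1))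
    then show ?thesis unfolding shift_source_def by (rule NUM_weaken) simp
  qed
  have ss1: "NUM (\<lambda>x. shift_source ?p (ru x) (?D x) - 1) (40 + 1)"
    by (rule NUM_diff[OF ss one_less_M])
  have 2: "NUM (\<lambda>x. off + set_dig B j (shift_source ?p (ru x) (?D x) - 1) (rY x - off)) (40 + 1 + 15)"
    by (rule NUM_set_dig[OF ss1 _ assms(1)]) (rule le_less_trans[OF diff_le_self b'])
  have 3: "NUM (\<lambda>x. (?D x + 1) mod ?p) (6 + 1)" by (rule NUM_mod[OF ND1 p(1)])
  have 4: "NUM (\<lambda>x. ?m) 1" by (rule NUM_const[OF m])
  have 5: "BOOL (\<lambda>x. bit (re x) (l - 1)) 1"
    using assms by (intro BOOL_bit NUM_re) (simp add: M_def)
  show ?thesis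
    unfolding app_def[abs_def] F_shift_def Let_def mk_fields
    by (rule MAP_weaken, (rule 1 2 3 4 5 ss NUM_D MAP_if MAP_id MAP_mk NUM_rY NUM_re NUM_re' NUM_rt NUM_ru NUM_rw NUM_consts
        BOOL_and BOOL_not BOOL_eq BOOL_less BOOL_le)+, simp)
qed

end


section \<open>The amplitudes of the circuit\<close>

lemma put_bit_0: "put_bit 0 False 0 = 0" "put_bit 0 True 0 = 1" "put_bit 0 False 1 = 0" "put_bit 0 True 1 = 1"
  by (rule bit_eqI; auto simp: bit_put_bit bit_1_iff bit_Suc_0_iff)+

lemma applyc_trivial:
  assumes "\<And>x. bit x c \<Longrightarrow> \<psi> x = 0" "c \<noteq> t"
  shows "applyc g c t \<psi> = \<psi>"
proof
  fix x show "applyc g c t \<psi> x = \<psi> x"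
    using assms by (cases "bit x c") (auto simp: applyc_def apply1_def bit_put_bit)
qed

lemma fold_trivial: "(\<And>i. i \<in> set xs \<Longrightarrow> f i \<psi> = \<psi>) \<Longrightarrow> fold f xs \<psi> = \<psi>"
  by (induction xs) auto

context bpx_circuit
begin

abbreviation "hadamard_t l \<equiv> fold (\<lambda>i. applyc H_gate (s + (l - 1)) (s + 2 * L + i)) [0..<L - l]"
abbreviation "hadamard_u l \<equiv> fold (\<lambda>i. applyc H_gate (s + (l - 1)) (s + 3 * L + i)) [0..<L - l]"
abbreviation "toggle_w l \<equiv> applyc X_gate (s + (l - 1)) (s + 4 * L)"

definition reg_op :: "reg_map \<Rightarrow> amp \<Rightarrow> amp" where
  "reg_op F = permute n (app F)"

text \<open>The shift sets \<open>w\<close> to \<open>1\<close> on the branch that it moves;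
  \<open>toggle_w\<close> clears it for the next dimension. The last Hadamards collect the sum over
  the coins at \<open>u = 0\<close>.\<close>

definition step :: "nat \<Rightarrow> nat \<Rightarrow> amp \<Rightarrow> amp" where
  "step j l \<psi> = hadamard_u l (toggle_w l (reg_op (F_shift j l) (hadamard_u l (hadamard_t l \<psi>))))"

definition dim_op :: "nat \<Rightarrow> amp \<Rightarrow> amp" where
  "dim_op j \<psi> = fold (step j) [1..<Suc L] (reg_op (F_mark j) \<psi>)"

lemma reg_op_mk: "ok Y e e' t u w z \<Longrightarrow> reg_op F \<psi> (mk Y e e' t u w z) = \<psi> (F Y e e' t u w z)"
  using okD(7) by (simp only: reg_op_def permute_def mk_less app_mk if_True)

lemma reg_op_ket:
  assumes "involutive F" "ok Y e e' t u w z"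
  shows "reg_op F (ket (mk Y e e' t u w z)) = ket (F Y e e' t u w z)"
proof
  fix x
  let ?y = "mk Y e e' t u w z"
  have y: "?y < 2 ^ n" using okD(7)[OF assms(2)] by (rule mk_less)
  note i = app_involution[OF assms(1)]
  have "app F ?y = F Y e e' t u w z" by (rule app_mk[OF assms(2)])
  moreover have "app F x = ?y \<longleftrightarrow> x = app F ?y" if "x < 2 ^ n"
    using i(2)[OF that] i(2)[OF y] by metis
  moreover have "app F ?y < 2 ^ n" by (rule i(1)[OF y])
  ultimately show "reg_op F (ket ?y) x = ket (F Y e e' t u w z) x"
    by (auto simp: reg_op_def permute_def ket_def)
qed

lemma hadamard_t_mk:
  assumes "1 \<le> l" "l \<le> L"
  shows "hadamard_t l \<psi> (mk Y e e' t u w z) =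
    (if bit e (l - 1) then layer (\<lambda>_. H_gate) (L - l) (\<lambda>v. \<psi> (mk Y e e' v u w z)) t
     else \<psi> (mk Y e e' t u w z))"
proof (rule fold_applyc_lift)
  fix v i b assume "i < L - l"
  then have "i < L" by linarith
  then show "put_bit (s + 2 * L + i) b (mk Y e e' v u w z) = mk Y e e' (put_bit i b v) u w z"
    and "bit (mk Y e e' v u w z) (s + 2 * L + i) = bit v i" by (simp_all only: put_bit_mk bit_mk)
next
  fix v show "bit (mk Y e e' v u w z) (s + (l - 1)) = bit e (l - 1)"
    using assms by (intro bit_mk(1)) linarith
qed

lemma hadamard_u_mk:
  assumes "1 \<le> l" "l \<le> L"
  shows "hadamard_u l \<psi> (mk Y e e' t u w z) =
    (if bit e (l - 1) then layer (\<lambda>_. H_gate) (L - l) (\<lambda>v. \<psi> (mk Y e e' t v w z)) u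
     else \<psi> (mk Y e e' t u w z))"
proof (rule fold_applyc_lift)
  fix v i b assume "i < L - l"
  then have "i < L" by linarith
  then show "put_bit (s + 3 * L + i) b (mk Y e e' t v w z) = mk Y e e' t (put_bit i b v) w z"
    and "bit (mk Y e e' t v w z) (s + 3 * L + i) = bit v i" by (simp_all only: put_bit_mk bit_mk)
next
  fix v show "bit (mk Y e e' t v w z) (s + (l - 1)) = bit e (l - 1)"
    using assms by (intro bit_mk(1)) linarith
qed

lemma toggle_w_mk:
  assumes "1 \<le> l" "l \<le> L" "w < 2"
  shows "toggle_w l \<psi> (mk Y e e' t u w z) =
    (if bit e (l - 1) then \<psi> (mk Y e e' t u (1 - w) z) else \<psi> (mk Y e e' t u w z))"
proof -
  have "l - 1 < L" using assms by linarith
  moreover have "w = 0 \<or> w = 1" using assms(3) by linarith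
  moreover have "put_bit 0 False 0 = 0" "put_bit 0 True 0 = 1" "put_bit 0 False 1 = 0" "put_bit 0 True 1 = 1"
    by (rule put_bit_0)+
  moreover have "bit (1::nat) 0" by (simp add: bit_Suc_0_iff)
  moreover have "\<not> bit (0::nat) 0" by simp
  ultimately show ?thesis
    by (elim disjE) (simp_all only: applyc_def apply1_def bit_mk put_bit_mk X_gate_def, simp_all)
qed

lemma reg_op_shift_trivial:
  assumes "supported n \<psi>" "\<And>x. bit x (s + (l - 1)) \<Longrightarrow> \<psi> x = 0"
    and "j < d" "1 \<le> l" "l \<le> L"
  shows "reg_op (F_shift j l) \<psi> = \<psi>"
proof
  fix x
  show "reg_op (F_shift j l) \<psi> x = \<psi> x"
  proof (cases "x < 2 ^ n")
    case True
    then obtain Y e e' t u w z where o: "ok Y e e' t u w z" and x: "x = mk Y e e' t u w z"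
      using mk_cases by metis
    have l: "l - 1 < L" using assms by linarith
    have b: "bit (mk Y2 e e2' t2 u2 w2 z2) (s + (l - 1)) = bit e (l - 1)" for Y2 e2' t2 u2 w2 z2
      by (rule bit_mk(1)[OF l])
    show ?thesis
    proof (cases "bit e (l - 1)")
      case True
      then have z: "\<psi> (mk Y2 e e2' t2 u2 w2 z2) = 0" for Y2 e2' t2 u2 w2 z2
        using b by (intro assms(2)) blast
      have "\<psi> (F_shift j l Y e e' t u w z) = 0"
        unfolding F_shift_def Let_def by (split if_split, split if_split) (simp only: z simp_thms)
      then show ?thesis unfolding x reg_op_mk[OF o] z .
    next
      case False
      then have "F_shift j l Y e e' t u w z = mk Y e e' t u w z"
        unfolding F_shift_def Let_def by (simp only: simp_thms if_False)
      then show ?thesis unfolding x reg_op_mk[OF o] by (simp only:)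
    qed
  next
    case False
    then show ?thesis using assms(1) by (simp add: reg_op_def permute_def supported_def)
  qed
qed

text \<open>Every gate of the step tests bit \<open>l - 1\<close> of the level register. This is why
  the steps of all levels may simply run one after the other.\<close>

lemma step_trivial:
  assumes "supported n \<psi>" "\<And>x. bit x (s + (l - 1)) \<Longrightarrow> \<psi> x = 0" "j < d" "1 \<le> l" "l \<le> L"
  shows "step j l \<psi> = \<psi>"
proof -
  have c: "s + (l - 1) \<noteq> s + k * L + i" if "1 \<le> k" for i k
  proof -
    have "L * 1 \<le> k * L" using that by simp
    then show ?thesis using assms(4,5) by linarith
  qed
  have "hadamard_t l \<psi> = \<psi>" "hadamard_u l \<psi> = \<psi>" "toggle_w l \<psi> = \<psi>"
    using c[of 2] c[of 3] c[of 4 0] by (intro fold_trivial applyc_trivial assms(2); simp)+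
  then show ?thesis unfolding step_def using reg_op_shift_trivial[OF assms] by (simp only:)
qed

end

section \<open>Invariant for an input of a fixed level \<open>l\<close> with coarse digits
  \<open>c\<close>\<close>

locale level_state = bpx_circuit +
  fixes l :: nat and c :: "nat \<Rightarrow> nat"
  assumes l: "1 \<le> l" "l \<le> L" and c: "\<And>j. c j < side l"
begin

definition "e0 = (2::nat) ^ (l - 1)"
abbreviation "p \<equiv> (2::nat) ^ (L - l)"

text \<open>\<open>rsqrt2 ^ (2 * (L - l))\<close> comes from preparing \<open>t\<close> and
  \<open>u\<close>, the other power from projecting \<open>u\<close> onto \<open>0\<close>; the
  cardinality counts the coins that lead from coordinate \<open>m + 1\<close> to digit
  \<open>D\<close>.\<close>

definition entry :: "nat \<Rightarrow> nat \<Rightarrow> complex" where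
  "entry D m = rsqrt2 ^ (L - l) * rsqrt2 ^ (2 * (L - l)) * of_nat (card {v. v < p \<and> shift_source p v D = m + 1})"

text \<open>With \<open>k\<close> dimensions done, digits below \<open>k\<close> range over the fine
  grid with product weights, while the others are still those of the input.\<close>

definition amplitude :: "nat \<Rightarrow> nat \<Rightarrow> complex" where
  "amplitude k Y = (if data Y \<and> (\<forall>j. k \<le> j \<and> j < d \<longrightarrow> dig B j (Y - off) = c j)
     then \<Prod>j<k. entry (dig B j (Y - off)) (c j) else 0)"

text \<open>
  A branch whose register \<open>u\<close> has left \<open>0\<close> has failed. Its level is parked in \<open>e'\<close>, and the digit
  following the failure gets its top bit set; unprocessed digits are too small to have this bit.
\<close>

definition failed :: "nat \<Rightarrow> nat \<Rightarrow> nat \<Rightarrow> nat \<Rightarrow> nat \<Rightarrow> bool" where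
  "failed k Y e e' u \<longleftrightarrow> u \<noteq> 0 \<and> data Y \<and> (\<forall>j. k \<le> j \<and> j < d \<longrightarrow> dig B j (Y - off) + 1 < half) \<and>
     (e = 0 \<or> e = e0 \<and> e' = 0)"

definition active :: "nat \<Rightarrow> nat \<Rightarrow> nat \<Rightarrow> nat \<Rightarrow> nat \<Rightarrow> nat \<Rightarrow> bool" where
  "active e e' t u w z \<longleftrightarrow> e = e0 \<and> e' = 0 \<and> t = 0 \<and> u = 0 \<and> w = 0 \<and> z = 0"

definition invar :: "nat \<Rightarrow> amp \<Rightarrow> bool" where
  "invar k \<psi> \<longleftrightarrow> supported n \<psi> \<and> (\<forall>Y<2 ^ s. \<psi> (mk Y e0 0 0 0 0 0) = amplitude k Y) \<and>
     (\<forall>Y e e' t u w z. ok Y e e' t u w z \<longrightarrow> \<psi> (mk Y e e' t u w z) \<noteq> 0 \<longrightarrow>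
        active e e' t u w z \<or> failed k Y e e' u)"

text \<open>Compared with \<open>invar\<close>, all failures are parked: \<open>e = 0\<close> puts
  them out of reach of the gates of the coming step. The price is digit \<open>k\<close>, whose
  bound is given up.\<close>

definition invar_marked :: "nat \<Rightarrow> amp \<Rightarrow> bool" where
  "invar_marked k \<psi> \<longleftrightarrow> supported n \<psi> \<and> (\<forall>Y<2 ^ s. \<psi> (mk Y e0 0 0 0 0 0) = amplitude k Y) \<and>
     (\<forall>Y e e' t u w z. ok Y e e' t u w z \<longrightarrow> \<psi> (mk Y e e' t u w z) \<noteq> 0 \<longrightarrow>
        active e e' t u w z \<or> failed (Suc k) Y e e' u \<and> e = 0)"

lemma e0: "e0 < 2 ^ L" "e0 \<noteq> 0"
  using two_power_pred_less[OF l] by (simp_all add: e0_def)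

lemma bit_e0: "bit e0 i \<longleftrightarrow> i = l - 1"
  by (auto simp: bit_exp_iff e0_def)

lemma ok_active: "Y < 2 ^ s \<Longrightarrow> ok Y e0 0 0 0 0 0"
  using e0(1) by (intro okI) simp_all

lemma reg_op_supported: "supported n (reg_op F \<psi>)"
  by (simp add: reg_op_def permute_def supported_def)

text \<open>A failure of the preceding dimension is moved and acquires a large digit
  \<open>k\<close>. Older failures already have \<open>e = 0\<close> and a small digit
  \<open>k\<close>, so the reverse branch does not fire on them and no two branches collide.\<close>

lemma invar_mark:
  assumes "invar k \<psi>" "k < d"
  shows "invar_marked k (reg_op (F_mark k) \<psi>)"
  unfolding invar_marked_def
proof (intro conjI allI impI reg_op_supported)
  fix Y :: nat assume Y: "Y < 2 ^ s"
  have "F_mark k Y e0 0 0 0 0 0 = mk Y e0 0 0 0 0 0"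
    unfolding F_mark_def Let_def by (simp only: simp_thms if_False)
  then have "reg_op (F_mark k) \<psi> (mk Y e0 0 0 0 0 0) = \<psi> (mk Y e0 0 0 0 0 0)"
    by (simp only: reg_op_mk[OF ok_active[OF Y]])
  then show "reg_op (F_mark k) \<psi> (mk Y e0 0 0 0 0 0) = amplitude k Y" using assms(1) Y by (simp add: invar_def)
next
  fix Y e e' t u w z
  assume o: "ok Y e e' t u w z" and nz: "reg_op (F_mark k) \<psi> (mk Y e e' t u w z) \<noteq> 0"
  have nz: "\<psi> (F_mark k Y e e' t u w z) \<noteq> 0" using nz reg_op_mk[OF o, of "F_mark k" \<psi>] by simp
  have "app (F_mark k) (app (F_mark k) (mk Y e e' t u w z)) = mk Y e e' t u w z"
    and "app (F_mark k) (mk Y e e' t u w z) < 2 ^ n"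
    using app_involution[OF F_mark_involution[OF assms(2)] mk_less[OF okD(7)[OF o]]] by blast+
  then have bk: "app (F_mark k) (F_mark k Y e e' t u w z) = mk Y e e' t u w z"
    and less: "F_mark k Y e e' t u w z < 2 ^ n" using app_mk[OF o] by simp_all
  obtain Y2 e2 e2' t2 u2 w2 z2 where o2: "ok Y2 e2 e2' t2 u2 w2 z2"
    and F: "F_mark k Y e e' t u w z = mk Y2 e2 e2' t2 u2 w2 z2"
    using mk_cases[OF less] by metis
  have bk: "F_mark k Y2 e2 e2' t2 u2 w2 z2 = mk Y e e' t u w z"
    using bk unfolding F app_mk[OF o2] .
  consider (a) "active e2 e2' t2 u2 w2 z2" | (f) "failed k Y2 e2 e2' u2"
    using assms(1) o2 nz unfolding F invar_def by blast
  then show "active e e' t u w z \<or> failed (Suc k) Y e e' u \<and> e = 0"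
  proof cases
    case a
    then have "F_mark k Y2 e2 e2' t2 u2 w2 z2 = mk Y2 e2 e2' t2 u2 w2 z2"
      unfolding F_mark_def Let_def active_def by (simp only: simp_thms if_False)
    then show ?thesis using a bk mk_inject[OF o o2] by simp
  next
    case f
    have half: "dig B k (Y2 - off) + 1 < half" using f assms(2) unfolding failed_def by blast
    let ?D = "dig B k (Y2 - off)"
    show ?thesis
    proof (cases "e2 = 0")
      case True
      have "\<not> half \<le> ?D" using half by linarith
      then have "F_mark k Y2 e2 e2' t2 u2 w2 z2 = mk Y2 e2 e2' t2 u2 w2 z2"
        using True unfolding F_mark_def Let_def by (simp only: simp_thms if_False)
      then have "Y = Y2 \<and> e = e2 \<and> e' = e2' \<and> u = u2" using bk mk_inject[OF o o2] by simp
      then show ?thesis using f True unfolding failed_def by auto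
    next
      case False
      then have e2: "e2 = e0" "e2' = 0" and f': "u2 \<noteq> 0" "data Y2" using f unfolding failed_def by blast+
      let ?v = "?D + half"
      let ?Y = "off + set_dig B k ?v (Y2 - off)"
      have v: "?v < B" using half two_half by linarith
      have Y': "data ?Y \<and> ?Y < 2 ^ s" by (rule data_set_dig[OF f'(2) assms(2) v])
      have "F_mark k Y2 e2 e2' t2 u2 w2 z2 = mk ?Y 0 e2 t2 u2 w2 z2"
        using half e2 e0(2) f' unfolding F_mark_def Let_def by (simp only: simp_thms if_True)
      moreover have "ok ?Y 0 e2 t2 u2 w2 z2" using okD[OF o2] Y' by (intro okI) simp_all
      ultimately have eq: "Y = ?Y" "e = 0" "u = u2" using bk mk_inject[OF o] by simp_all
      have "dig B j (Y - off) + 1 < half" if "Suc k \<le> j \<and> j < d" for j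
      proof -
        have "dig B j (Y - off) = dig B j (Y2 - off)"
          unfolding eq(1) diff_add_inverse using that B_pos v by (intro dig_set_dig_other) auto
        then show ?thesis using f that unfolding failed_def by simp
      qed
      then show ?thesis using eq f' Y' unfolding failed_def by blast
    qed
  qed
qed

text \<open>Where the level bit is set, the marked state lives only at \<open>t = u = 0\<close>,
  because failures have \<open>e = 0\<close>. The Hadamards therefore just spread it
  uniformly.\<close>

lemma invar_marked_shift1:
  assumes "invar_marked k \<psi>" "ok Y e e' t u w z" "bit e (l - 1)"
  shows "hadamard_u l (hadamard_t l \<psi>) (mk Y e e' t u w z) =
    (if e = e0 \<and> e' = 0 \<and> w = 0 \<and> z = 0 \<and> t < p \<and> u < p then rsqrt2 ^ (2 * (L - l)) * amplitude k Y else 0)"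
proof -
  note o = okD[OF assms(2)]
  have e: "e \<noteq> 0"
  proof
    assume "e = 0"
    then show False using assms(3) by simp
  qed
  have zero: "\<psi> (mk Y e e' v v' w z) = 0"
    if "v < 2 ^ L" "v' < 2 ^ L" "\<not> (e = e0 \<and> e' = 0 \<and> w = 0 \<and> z = 0 \<and> v = 0 \<and> v' = 0)" for v v'
  proof -
    have "ok Y e e' v v' w z" using o that by (intro okI)
    then show ?thesis using assms(1) that(3) e unfolding invar_marked_def active_def by blast
  qed
  have inner: "hadamard_t l \<psi> (mk Y e e' t v' w z) =
      (if t < p then rsqrt2 ^ (L - l) * \<psi> (mk Y e e' 0 v' w z) else 0)" if "v' < 2 ^ L" for v'
    unfolding hadamard_t_mk[OF l] if_P[OF assms(3)]
    by (rule layer_H_point[where K = L]) (use that zero o in auto)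
  have "hadamard_u l (hadamard_t l \<psi>) (mk Y e e' t u w z) =
      (if u < p then rsqrt2 ^ (L - l) * hadamard_t l \<psi> (mk Y e e' t 0 w z) else 0)"
    unfolding hadamard_u_mk[OF l] if_P[OF assms(3)]
    by (rule layer_H_point[where K = L]) (use zero inner o in auto)
  also have "\<dots> = (if u < p \<and> t < p then rsqrt2 ^ (2 * (L - l)) * \<psi> (mk Y e e' 0 0 w z) else 0)"
    using inner[of 0] by (simp add: mult_2 power_add)
  also have "\<dots> = (if e = e0 \<and> e' = 0 \<and> w = 0 \<and> z = 0 \<and> t < p \<and> u < p then rsqrt2 ^ (2 * (L - l)) * amplitude k Y else 0)"
  proof (cases "e = e0 \<and> e' = 0 \<and> w = 0 \<and> z = 0")
    case True
    then have "\<psi> (mk Y e e' 0 0 w z) = amplitude k Y" using assms(1) o(1) by (simp add: invar_marked_def)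
    then show ?thesis using True by auto
  next
    case False
    then have "\<psi> (mk Y e e' 0 0 w z) = 0" by (intro zero) auto
    then show ?thesis using False by auto
  qed
  finally show ?thesis .
qed

text \<open>Undoing the shift in digit \<open>k\<close> turns the constraint on this digit into one
  on the source coordinate; the weights of the lower digits are not affected.\<close>

lemma shift_amplitude:
  assumes "data Y" "k < d" "1 \<le> src" "src \<le> side l"
  shows "amplitude k (off + set_dig B k (src - 1) (Y - off)) =
    (if src = c k + 1 \<and> (\<forall>j. Suc k \<le> j \<and> j < d \<longrightarrow> dig B j (Y - off) = c j)
     then \<Prod>j<k. entry (dig B j (Y - off)) (c j) else 0)"
proof -
  let ?Y = "off + set_dig B k (src - 1) (Y - off)"
  have v: "src - 1 < B" using assms(3,4) side_le[OF l(2)] by linarith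
  have Y': "data ?Y" using data_set_dig[OF assms(1,2) v] by blast
  have same: "dig B k (?Y - off) = src - 1"
    unfolding diff_add_inverse by (rule dig_set_dig_same[OF B_pos v])
  have other: "dig B j (?Y - off) = dig B j (Y - off)" if "j \<noteq> k" for j
    unfolding diff_add_inverse by (rule dig_set_dig_other[OF B_pos v that])
  have prod: "(\<Prod>j<k. entry (dig B j (?Y - off)) (c j)) = (\<Prod>j<k. entry (dig B j (Y - off)) (c j))"
    by (intro prod.cong refl arg_cong2[where f = entry] other) auto
  have "src - 1 = c k \<longleftrightarrow> src = c k + 1" using assms(3) by linarith
  moreover have "(\<forall>j. k \<le> j \<and> j < d \<longrightarrow> dig B j (?Y - off) = c j) \<longleftrightarrow>
      dig B k (?Y - off) = c k \<and> (\<forall>j. Suc k \<le> j \<and> j < d \<longrightarrow> dig B j (?Y - off) = c j)"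
    using assms(2) by (metis Suc_leD Suc_leI le_neq_implies_less order_refl)
  moreover have "(\<forall>j. Suc k \<le> j \<and> j < d \<longrightarrow> dig B j (?Y - off) = c j) \<longleftrightarrow>
      (\<forall>j. Suc k \<le> j \<and> j < d \<longrightarrow> dig B j (Y - off) = c j)"
    using other by (metis Suc_n_not_le_n)
  ultimately have cond: "(\<forall>j. k \<le> j \<and> j < d \<longrightarrow> dig B j (?Y - off) = c j) \<longleftrightarrow>
      src = c k + 1 \<and> (\<forall>j. Suc k \<le> j \<and> j < d \<longrightarrow> dig B j (Y - off) = c j)"
    unfolding same by blast
  show ?thesis unfolding amplitude_def prod cond using Y' by (simp only: simp_thms)
qed

definition shifted :: "nat \<Rightarrow> nat \<Rightarrow> nat \<Rightarrow> complex" where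
  "shifted k Y u =
    (if data Y \<and> shift_source p u (dig B k (Y - off)) = c k + 1 \<and>
        (\<forall>j. Suc k \<le> j \<and> j < d \<longrightarrow> dig B j (Y - off) = c j)
     then rsqrt2 ^ (2 * (L - l)) * (\<Prod>j<k. entry (dig B j (Y - off)) (c j)) else 0)"

text \<open>After the toggle, \<open>w = 0\<close> reads the range side of the shift, where the
  source is unique. At \<open>w = 1\<close> everything vanishes: an index that carried amplitude
  satisfied the domain guard and has been moved away.\<close>

lemma invar_marked_shift2:
  assumes "invar_marked k \<psi>" "k < d" "ok Y e e' t u w z" "bit e (l - 1)"
  shows "toggle_w l (reg_op (F_shift k l) (hadamard_u l (hadamard_t l \<psi>))) (mk Y e e' t u w z) =
    (if e = e0 \<and> e' = 0 \<and> w = 0 \<and> z = 0 \<and> t = 0 \<and> u < p then shifted k Y u else 0)"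
proof -
  note o = okD[OF assms(3)]
  let ?\<psi> = "hadamard_u l (hadamard_t l \<psi>)"
  let ?D = "dig B k (Y - off)"
  let ?src = "shift_source p u ?D"
  note one = invar_marked_shift1[OF assms(1) _ assms(4)]
  have o1: "ok Y e e' t u (1 - w) z" using o by (intro okI) linarith+
  have eq: "toggle_w l (reg_op (F_shift k l) ?\<psi>) (mk Y e e' t u w z) = ?\<psi> (F_shift k l Y e e' t u (1 - w) z)"
    unfolding toggle_w_mk[OF l o(6)] if_P[OF assms(4)] by (rule reg_op_mk[OF o1])
  consider (w0) "w = 0" | (w1) "w = 1" using o(6) by linarith
  then show ?thesis
  proof cases
    case w0
    let ?c = "data Y \<and> u < p \<and> t = 0 \<and> 1 \<le> ?src \<and> ?src \<le> side l"
    show ?thesis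
    proof (cases ?c)
      case True
      let ?Y = "off + set_dig B k (?src - 1) (Y - off)" and ?T = "(?D + 1) mod p"
      have T: "?T < p" by (rule mod_less_divisor) simp
      have pL: "p \<le> 2 ^ L" by simp
      have v: "?src - 1 < B" using True side_le[OF l(2)] by linarith
      have dY: "data Y" using True by blast
      have Y': "data ?Y \<and> ?Y < 2 ^ s" by (rule data_set_dig[OF dY assms(2) v])
      have o2: "ok ?Y e e' ?T u 0 z"
        using o Y' less_le_trans[OF T pL] by (intro okI) simp_all
      have "F_shift k l Y e e' t u (1 - w) z = mk ?Y e e' ?T u 0 z"
        using True assms(4) w0 unfolding F_shift_def Let_def by simp
      then have "toggle_w l (reg_op (F_shift k l) ?\<psi>) (mk Y e e' t u w z) =
          (if e = e0 \<and> e' = 0 \<and> z = 0 then rsqrt2 ^ (2 * (L - l)) * amplitude k ?Y else 0)"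
        unfolding eq using one[OF o2] T True by simp
      also have "rsqrt2 ^ (2 * (L - l)) * amplitude k ?Y = shifted k Y u"
      proof -
        have s: "1 \<le> ?src" "?src \<le> side l" using True by blast+
        show ?thesis unfolding shifted_def shift_amplitude[OF dY assms(2) s]
          by (simp only: dY simp_thms if_distrib[where f = "(*) (rsqrt2 ^ (2 * (L - l)))"] mult_zero_right)
      qed
      finally show ?thesis using w0 True by simp
    next
      case False
      have n: "\<not> (bit e (l - 1) \<and> data Y \<and> u < p \<and> 1 - w = 0 \<and> t < p \<and> ?D < side l)" using w0 by simp
      have n': "\<not> (bit e (l - 1) \<and> data Y \<and> u < p \<and> 1 - w = 1 \<and> t = 0 \<and> 1 \<le> ?src \<and> ?src \<le> side l)"
        using False by blast
      have "F_shift k l Y e e' t u (1 - w) z = mk Y e e' t u (1 - w) z"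
        unfolding F_shift_def Let_def if_not_P[OF n] if_not_P[OF n'] ..
      then have "toggle_w l (reg_op (F_shift k l) ?\<psi>) (mk Y e e' t u w z) = 0"
        unfolding eq using one[OF o1] w0 by simp
      moreover have "shifted k Y u = 0" if "t = 0" "u < p"
      proof -
        have "c k + 1 \<le> side l" using c[of k] by linarith
        then have "\<not> (data Y \<and> ?src = c k + 1)" using False that by auto
        then show ?thesis unfolding shifted_def by auto
      qed
      ultimately show ?thesis by simp
    qed
  next
    case w1
    let ?c = "data Y \<and> u < p \<and> t < p \<and> ?D < side l"
    show ?thesis
    proof (cases ?c)
      case True
      let ?v = "shift_digit p t u ?D"
      let ?Y = "off + set_dig B k ?v (Y - off)"
      have v: "?v < B" using True by (intro shift_digit_props(1)[OF _ _ pow_block[OF l(2)]]) simp_all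
      have dY: "data Y" using True by blast
      have Y': "data ?Y \<and> ?Y < 2 ^ s" by (rule data_set_dig[OF dY assms(2) v])
      have o2: "ok ?Y e e' 0 u 1 z" using o Y' by (intro okI) simp_all
      have "F_shift k l Y e e' t u (1 - w) z = mk ?Y e e' 0 u 1 z"
        using True assms(4) w1 unfolding F_shift_def Let_def by simp
      then show ?thesis unfolding eq using one[OF o2] w1 by simp
    next
      case False
      have n: "\<not> (bit e (l - 1) \<and> data Y \<and> u < p \<and> 1 - w = 0 \<and> t < p \<and> ?D < side l)" using False by blast
      have n': "\<not> (bit e (l - 1) \<and> data Y \<and> u < p \<and> 1 - w = 1 \<and> t = 0 \<and> 1 \<le> ?src \<and> ?src \<le> side l)"
        using w1 by simp
      have "F_shift k l Y e e' t u (1 - w) z = mk Y e e' t u (1 - w) z"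
        unfolding F_shift_def Let_def if_not_P[OF n] if_not_P[OF n'] ..
      moreover have "amplitude k Y = 0" if "t < p" "u < p"
      proof -
        have "\<not> (data Y \<and> ?D = c k)" using False that c[of k] by auto
        then show ?thesis using assms(2) unfolding amplitude_def by auto
      qed
      ultimately show ?thesis unfolding eq using one[OF o1] w1 by simp
    qed
  qed
qed

lemma shift_outside:
  assumes "ok Y e e' t u w z" "\<not> bit e (l - 1)"
  shows "toggle_w l (reg_op (F_shift k l) (hadamard_u l (hadamard_t l \<psi>))) (mk Y e e' t u w z) = \<psi> (mk Y e e' t u w z)"
proof -
  have "F_shift k l Y e e' t u w z = mk Y e e' t u w z"
    using assms(2) unfolding F_shift_def Let_def by (simp only: simp_thms if_False)
  then show ?thesis
    unfolding toggle_w_mk[OF l okD(6)[OF assms(1)]] if_not_P[OF assms(2)] reg_op_mk[OF assms(1)]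
    by (simp only: hadamard_u_mk[OF l] hadamard_t_mk[OF l] if_not_P[OF assms(2)])
qed

lemma step_supported:
  assumes "j < d" "supported n \<psi>"
  shows "supported n (step j l \<psi>)"
proof -
  have n: "i < L \<Longrightarrow> s + 2 * L + i < n" "i < L \<Longrightarrow> s + 3 * L + i < n" "s + 4 * L < n" for i
    by (simp_all add: n_def)
  have f: "supported n (fold (\<lambda>i. applyc H_gate a (b + i)) [0..<m] \<phi>)"
    if "supported n \<phi>" "\<And>i. i < m \<Longrightarrow> b + i < n" for \<phi> a b m
    using that(2) by (induction m) (auto simp: that(1) supported_applyc)
  have "L - l \<le> L" by simp
  then show ?thesis
    unfolding step_def by (intro f supported_applyc reg_op_supported n) auto
qed

lemma failed_side: "l < L \<Longrightarrow> side l \<le> half - 1"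
  unfolding side_def half_def by (intro diff_le_mono power_increasing) simp_all

text \<open>At \<open>u = 0\<close> the final Hadamards add up the coins, which yields one more
  factor \<open>entry\<close>. A nonzero \<open>u\<close> needs more than one coin, hence
  \<open>l < L\<close>; then all coarse digits are small enough to be marked later.\<close>

lemma invar_step:
  assumes "invar_marked k \<psi>" "k < d"
  shows "invar (Suc k) (step k l \<psi>)"
proof -
  let ?\<psi> = "toggle_w l (reg_op (F_shift k l) (hadamard_u l (hadamard_t l \<psi>)))"
  have b0: "bit e0 (l - 1)" by (simp add: bit_e0)
  have step: "step k l \<psi> (mk Y e e' t u w z) =
    (if bit e (l - 1) then layer (\<lambda>_. H_gate) (L - l) (\<lambda>v. ?\<psi> (mk Y e e' t v w z)) u
     else ?\<psi> (mk Y e e' t u w z))" for Y e e' t u w z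
    unfolding step_def by (rule hadamard_u_mk[OF l])
  have pL: "p \<le> 2 ^ L" by simp
  show ?thesis
    unfolding invar_def
  proof (intro conjI allI impI)
    show "supported n (step k l \<psi>)" using assms by (intro step_supported) (simp_all add: invar_marked_def)
  next
    fix Y :: nat assume Y: "Y < 2 ^ s"
    let ?pr = "\<Prod>j<k. entry (dig B j (Y - off)) (c j)"
    let ?c = "data Y \<and> (\<forall>j. Suc k \<le> j \<and> j < d \<longrightarrow> dig B j (Y - off) = c j)"
    let ?V = "{v. v < p \<and> shift_source p v (dig B k (Y - off)) = c k + 1}"
    have "?\<psi> (mk Y e0 0 0 v 0 0) = (if v \<in> ?V then (if ?c then rsqrt2 ^ (2 * (L - l)) * ?pr else 0) else 0)"
      if "v < p" for v
    proof -
      have "ok Y e0 0 0 v 0 0" using Y e0(1) less_le_trans[OF that pL] by (intro okI) simp_all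
      from invar_marked_shift2[OF assms this b0] show ?thesis using that by (simp add: shifted_def)
    qed
    then have "(\<Sum>v<p. ?\<psi> (mk Y e0 0 0 v 0 0)) =
        (\<Sum>v<p. if v \<in> ?V then (if ?c then rsqrt2 ^ (2 * (L - l)) * ?pr else 0) else 0)"
      by (intro sum.cong) auto
    also have "\<dots> = (\<Sum>v\<in>?V. if ?c then rsqrt2 ^ (2 * (L - l)) * ?pr else 0)"
      by (rule sum.mono_neutral_cong_right) auto
    also have "\<dots> = of_nat (card ?V) * (if ?c then rsqrt2 ^ (2 * (L - l)) * ?pr else 0)" by simp
    finally have "step k l \<psi> (mk Y e0 0 0 0 0 0) =
        rsqrt2 ^ (L - l) * (of_nat (card ?V) * (if ?c then rsqrt2 ^ (2 * (L - l)) * ?pr else 0))"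
      unfolding step if_P[OF b0] layer_H_at_0 by (simp only:)
    also have "\<dots> = (if ?c then ?pr * entry (dig B k (Y - off)) (c k) else 0)"
    proof (cases ?c)
      case True
      show ?thesis unfolding if_P[OF True] entry_def by (simp only: mult_ac)
    next
      case False
      show ?thesis unfolding if_not_P[OF False] by (simp only: mult_zero_right)
    qed
    also have "\<dots> = amplitude (Suc k) Y" unfolding amplitude_def by (simp only: prod.lessThan_Suc)
    finally show "step k l \<psi> (mk Y e0 0 0 0 0 0) = amplitude (Suc k) Y" .
  next
    fix Y e e' t u w z
    assume ok: "ok Y e e' t u w z" and nz: "step k l \<psi> (mk Y e e' t u w z) \<noteq> 0"
    note o = okD[OF ok]
    show "active e e' t u w z \<or> failed (Suc k) Y e e' u"
    proof (cases "bit e (l - 1)")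
      case False
      then have "\<psi> (mk Y e e' t u w z) \<noteq> 0" using nz shift_outside[OF ok False] unfolding step by simp
      then show ?thesis using assms(1) ok unfolding invar_marked_def by blast
    next
      case True
      then have "layer (\<lambda>_. H_gate) (L - l) (\<lambda>v. ?\<psi> (mk Y e e' t v w z)) u \<noteq> 0" using nz unfolding step by simp
      then obtain v where v: "?\<psi> (mk Y e e' t v w z) \<noteq> 0" "\<forall>i\<ge>L - l. bit v i = bit u i"
        using layer_support by blast
      have "v < 2 ^ L" using v(2) o(5) unfolding nat_less_exp_iff_bit by auto
      then have ok': "ok Y e e' t v w z" using o by (intro okI)
      have eq: "e = e0 \<and> e' = 0 \<and> w = 0 \<and> z = 0 \<and> t = 0 \<and> v < p" and sh: "shifted k Y v \<noteq> 0"
        using v(1) invar_marked_shift2[OF assms ok' True] by (auto split: if_splits)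
      have u: "u < p" using v(2) eq unfolding nat_less_exp_iff_bit by auto
      show ?thesis
      proof (cases "u = 0")
        case True
        then show ?thesis using eq by (simp add: active_def)
      next
        case False
        then have "l < L" using u l(2) by (cases "l = L") auto
        have "data Y" "\<forall>j. Suc k \<le> j \<and> j < d \<longrightarrow> dig B j (Y - off) = c j"
          using sh unfolding shifted_def by (meson)+
        moreover have "c j + 1 < half" for j
          using c[of j] failed_side[OF \<open>l < L\<close>] by linarith
        ultimately show ?thesis using False eq unfolding failed_def by simp
      qed
    qed
  qed
qed

text \<open>Only the step of level \<open>l\<close> acts: before and after it, the level register is
  \<open>0\<close> or the one-hot value \<open>e0\<close> on every branch.\<close>

lemma invar_dim_op:
  assumes "invar k \<psi>" "k < d"
  shows "invar (Suc k) (dim_op k \<psi>)"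
proof -
  have triv: "fold (step k) ls \<phi> = \<phi>"
    if sup: "supported n \<phi>" and e: "\<And>Y e e' t u w z. ok Y e e' t u w z \<Longrightarrow> \<phi> (mk Y e e' t u w z) \<noteq> 0 \<Longrightarrow> e = 0 \<or> e = e0"
      and ls: "\<And>l'. l' \<in> set ls \<Longrightarrow> 1 \<le> l' \<and> l' \<le> L \<and> l' \<noteq> l" for ls \<phi>
  proof (rule fold_trivial)
    fix l' assume "l' \<in> set ls"
    then have l': "1 \<le> l'" "l' \<le> L" "l' \<noteq> l" using ls by auto
    show "step k l' \<phi> = \<phi>"
    proof (rule step_trivial[OF sup _ assms(2) l'(1,2)])
      fix x :: nat assume b: "bit x (s + (l' - 1))"
      show "\<phi> x = 0"
      proof (cases "x < 2 ^ n")
        case True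
        then obtain Y e e' t u w z where o: "ok Y e e' t u w z" and x: "x = mk Y e e' t u w z"
          using mk_cases by metis
        have "l' - 1 < L" using l' by linarith
        then have b': "bit e (l' - 1)" using b unfolding x by (simp only: bit_mk)
        have "l' - 1 \<noteq> l - 1" using l' l by linarith
        then have "e \<noteq> e0" using b' bit_e0[of "l' - 1"] by blast
        moreover have "e \<noteq> 0"
        proof
          assume "e = 0"
          then show False using b' by simp
        qed
        ultimately show ?thesis using e[OF o] unfolding x by blast
      next
        case False
        then show ?thesis using sup by (simp add: supported_def)
      qed
    qed
  qed
  have "[1..<Suc L] = [1..<l] @ [l] @ [Suc l..<Suc L]"
  proof -
    have "[1..<Suc L] = [1..<l] @ [l..<Suc L]" using upt_add_eq_append[of 1 l "Suc L - l"] l by simp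
    moreover have "[l..<Suc L] = [l] @ [Suc l..<Suc L]" using l by (simp add: upt_conv_Cons)
    ultimately show ?thesis by simp
  qed
  then have "dim_op k \<psi> = fold (step k) [Suc l..<Suc L] (step k l (fold (step k) [1..<l] (reg_op (F_mark k) \<psi>)))"
    unfolding dim_op_def by simp
  moreover have m: "invar_marked k (reg_op (F_mark k) \<psi>)" using assms by (rule invar_mark)
  moreover have "fold (step k) [1..<l] (reg_op (F_mark k) \<psi>) = reg_op (F_mark k) \<psi>"
  proof (rule triv)
    show "e = 0 \<or> e = e0" if "ok Y e e' t u w z" "reg_op (F_mark k) \<psi> (mk Y e e' t u w z) \<noteq> 0" for Y e e' t u w z
      using m that unfolding invar_marked_def active_def by blast
  qed (use m l in \<open>auto simp: invar_marked_def\<close>)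
  moreover have i: "invar (Suc k) (step k l (reg_op (F_mark k) \<psi>))" using m assms(2) by (rule invar_step)
  moreover have "fold (step k) [Suc l..<Suc L] (step k l (reg_op (F_mark k) \<psi>)) = step k l (reg_op (F_mark k) \<psi>)"
  proof (rule triv)
    show "e = 0 \<or> e = e0" if "ok Y e e' t u w z" "step k l (reg_op (F_mark k) \<psi>) (mk Y e e' t u w z) \<noteq> 0" for Y e e' t u w z
      using i that unfolding invar_def active_def failed_def by blast
  qed (use i l in \<open>auto simp: invar_def\<close>)
  ultimately show ?thesis by simp
qed

lemma invar_fold:
  assumes "invar 0 \<psi>" "k \<le> d"
  shows "invar k (fold dim_op [0..<k] \<psi>)"
  using assms(2) by (induction k) (simp_all add: assms(1) invar_dim_op)

end


section \<open>Correctness and cost of the circuit\<close>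

lemma rsqrt2_power_even: "rsqrt2 ^ (2 * m) = of_real (1 / 2 ^ m)"
proof -
  have "(1 / sqrt 2) ^ (2 * m) = 1 / (2::real) ^ m"
    unfolding power_mult by (simp add: power_divide power_one_over)
  then show ?thesis unfolding rsqrt2_def of_real_power[symmetric] by (simp only:)
qed

text \<open>Exactly \<open>(D + 1) mod p\<close> coins choose the upper neighbour and the others the
  lower one. The right-hand side imitates \<open>hat_affine_on_cell\<close>, so that the count is
  recognised as a hat value.\<close>

lemma card_shift_source:
  assumes "p > 0"
  shows "real (card {v. v < p \<and> shift_source p v D = m}) =
    real p * ((1 - real ((D + 1) mod p) / real p) * of_bool ((D + 1) div p = m)
      + real ((D + 1) mod p) / real p * of_bool (Suc ((D + 1) div p) = m))"
proof -
  let ?k = "(D + 1) div p" and ?t = "(D + 1) mod p"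
  have t: "?t < p" using assms by simp
  have src: "shift_source p v D = (if v < ?t then Suc ?k else ?k)" for v
    by (simp add: shift_source_def)
  consider (a) "?k = m" | (b) "Suc ?k = m" | (c) "?k \<noteq> m" "Suc ?k \<noteq> m" by blast
  then show ?thesis
  proof cases
    case a
    have "{v. v < p \<and> shift_source p v D = m} = {?t..<p}"
      using a by (auto simp: src split: if_splits)
    then have "card {v. v < p \<and> shift_source p v D = m} = p - ?t" by simp
    moreover have "real (p - ?t) = real p - real ?t" using t by (intro of_nat_diff) simp
    ultimately show ?thesis using a assms by (simp add: right_diff_distrib)
  next
    case b
    have "{v. v < p \<and> shift_source p v D = m} = {..<?t}"
      using b t by (auto simp: src split: if_splits)
    then have "card {v. v < p \<and> shift_source p v D = m} = ?t" by simp
    then show ?thesis using b assms by simp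
  next
    case c
    have "{v. v < p \<and> shift_source p v D = m} = {}"
      using c by (auto simp: src split: if_splits)
    then have "card {v. v < p \<and> shift_source p v D = m} = 0" by simp
    then show ?thesis using c by simp
  qed
qed

lemma hat_shift_source:
  assumes "l \<le> L"
  shows "real (card {v. v < 2 ^ (L - l) \<and> shift_source (2 ^ (L - l)) v D = m}) =
    2 ^ (L - l) * hat (1 / 2 ^ l) m (real (D + 1) / 2 ^ L)"
proof -
  define p :: nat where "p = 2 ^ (L - l)"
  have p: "p > 0" by (simp add: p_def)
  let ?k = "(D + 1) div p" and ?t = "real ((D + 1) mod p) / real p"
  have pL: "real p * 2 ^ l = 2 ^ L" using assms by (simp add: p_def flip: power_add)
  have "(D + 1) mod p \<le> p" using p by (simp add: less_imp_le)
  then have "?t \<in> {0..1}" using p by simp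
  from hat_affine_on_cell[OF _ this, of "2 ^ l" m ?k]
  have h: "hat (1 / 2 ^ l) m ((real ?k + ?t) / 2 ^ l) = (1 - ?t) * of_bool (?k = m) + ?t * of_bool (Suc ?k = m)"
    by simp
  have "real (D + 1) = real (p * ?k + (D + 1) mod p)" by (simp only: mult_div_mod_eq)
  also have "\<dots> = real p * (real ?k + ?t)"
    unfolding of_nat_add of_nat_mult distrib_left using p by simp
  finally have "real (D + 1) / 2 ^ L = (real ?k + ?t) / 2 ^ l"
    using p unfolding pL[symmetric] by simp
  then show ?thesis
    using card_shift_source[OF p, of D m] h unfolding p_def by simp
qed

text \<open>The inverse square of the product of the cosines of the first \<open>m\<close> level
  rotations.\<close>

definition rot_norm :: "nat \<Rightarrow> real" where
  "rot_norm m = (\<Prod>i<m. 1 + (1 / 4) ^ i)"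

lemma rot_norm_pos: "rot_norm m > 0"
  unfolding rot_norm_def by (intro prod_pos) (simp add: add_pos_nonneg)

text \<open>The correction term makes the induction close: with \<open>e = (1 / 4) ^ m\<close>,
  \<open>(3 - 4 * e) * (1 + e)\<close> is \<open>3 - e - 4 * e ^ 2\<close>. A bound by a constant
  alone would not be inductive.\<close>

lemma rot_norm_le: "m \<ge> 1 \<Longrightarrow> rot_norm m \<le> 3 - 4 * (1 / 4) ^ m"
proof (induction m rule: nat_induct_at_least)
  case base
  show ?case by (simp add: rot_norm_def)
next
  case (Suc m)
  let ?e = "(1 / 4 :: real) ^ m"
  have "rot_norm (Suc m) = rot_norm m * (1 + ?e)" by (simp add: rot_norm_def)
  also have "\<dots> \<le> (3 - 4 * ?e) * (1 + ?e)" using Suc.IH by (intro mult_right_mono) simp_all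
  also have "\<dots> \<le> 3 - ?e" by (simp add: algebra_simps)
  finally show ?case by simp
qed

text \<open>
  The tangents of the rotation angles are \<open>1, 1/2, 1/4, \<dots>\<close>; hence the amplitude of \<open>|0\<dots>0\<rangle>\<close> after
  rotating the one-hot state of level \<open>l\<close> is proportional to \<open>2 ^ - l\<close>.
\<close>

definition level_gate :: "nat \<Rightarrow> qgate" where
  "level_gate i = reflection_gate (1 / sqrt (1 + (1 / 4) ^ i)) ((1 / 2) ^ i / sqrt (1 + (1 / 4) ^ i))"

text \<open>The numerator of \<open>c\<close> cancels the normalisation of the level rotations; the
  \<open>2\<close> in the denominator turns \<open>2 ^ (l - 1)\<close> into \<open>2 ^ l\<close>,
  and \<open>m\<close> supplies the factor \<open>L\<close> of the subnormalisation.\<close>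

definition scale_gate :: "nat \<Rightarrow> qgate" where
  "scale_gate m = (let c = sqrt (rot_norm m) / (2 * real m) in reflection_gate c (sqrt (1 - c\<^sup>2)))"

lemma unitary_level_gate: "unitary_gate (level_gate i)"
proof -
  define x :: real where "x = 1 + (1 / 4) ^ i"
  have x: "x > 0" by (simp add: x_def add_pos_nonneg)
  have a: "((1 / 2) ^ i)\<^sup>2 = (1 / 4 :: real) ^ i"
    by (simp add: power2_eq_square flip: power_mult_distrib)
  have "(1 / sqrt x)\<^sup>2 + (y / sqrt x)\<^sup>2 = (1 + y\<^sup>2) / x" for y
    using x by (simp add: power_divide add_divide_distrib)
  from this[of "(1 / 2) ^ i"] have "(1 / sqrt x)\<^sup>2 + ((1 / 2) ^ i / sqrt x)\<^sup>2 = x / x"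
    unfolding a x_def[symmetric] .
  then have "(1 / sqrt x)\<^sup>2 + ((1 / 2) ^ i / sqrt x)\<^sup>2 = 1" using x by simp
  then show ?thesis unfolding level_gate_def x_def by (rule unitary_reflection)
qed

lemma unitary_scale_gate:
  assumes "m \<ge> 1"
  shows "unitary_gate (scale_gate m)"
proof -
  let ?c = "sqrt (rot_norm m) / (2 * real m)"
  have "rot_norm m \<le> 4" using rot_norm_le[OF assms] zero_le_power[of "1 / 4 :: real" m] by linarith
  moreover have "1 \<le> (real m)\<^sup>2" using assms by simp
  ultimately have "rot_norm m \<le> 4 * (real m)\<^sup>2" by linarith
  then have "?c\<^sup>2 \<le> 1" using rot_norm_pos[of m] assms by (simp add: power_divide power_mult_distrib)
  then show ?thesis unfolding scale_gate_def Let_def by (intro unitary_reflection) simp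
qed

lemma level_gate_prod:
  assumes "e < m"
  shows "(\<Prod>i<m. level_gate i False (i = e)) = of_real ((1 / 2) ^ e / sqrt (rot_norm m))"
proof -
  let ?r = "\<lambda>i. sqrt (1 + (1 / 4 :: real) ^ i)"
  have r: "?r i \<noteq> 0" for i
  proof -
    have "1 + (1 / 4) ^ i > (0::real)" by (simp add: add_pos_nonneg)
    then show ?thesis by (metis less_irrefl real_sqrt_eq_zero_cancel_iff)
  qed
  have "(\<Prod>i<m. level_gate i False (i = e)) = of_real (\<Prod>i<m. (if i = e then (1 / 2) ^ i else 1) * (1 / ?r i))"
    unfolding of_real_prod by (intro prod.cong) (simp_all add: level_gate_def reflection_gate_def)
  also have "(\<Prod>i<m. (if i = e then (1 / 2) ^ i else 1) * (1 / ?r i)) =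
      (\<Prod>i<m. if i = e then (1 / 2) ^ i else 1) * (\<Prod>i<m. 1 / ?r i)" by (rule prod.distrib)
  also have "(\<Prod>i<m. if i = e then (1 / 2) ^ i else (1::real)) = (1 / 2) ^ e"
    using assms by (simp add: prod.delta)
  also have "(\<Prod>i<m. 1 / ?r i) = 1 / sqrt (rot_norm m)"
    unfolding rot_norm_def by (induction m) (simp_all add: real_sqrt_mult)
  finally show ?thesis by simp
qed

context bpx_circuit
begin

definition rotations :: "amp \<Rightarrow> amp" where
  "rotations \<psi> = apply1 (scale_gate L) (s + 4 * L + 1) (fold (\<lambda>i. apply1 (level_gate i) (s + i)) [0..<L] \<psi>)"

definition circuit :: "amp \<Rightarrow> amp" where
  "circuit \<psi> = rotations (fold dim_op [0..<d] (fold (\<lambda>l. reg_op (F_in l)) [1..<Suc L] (reg_op F_out \<psi>)))"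

lemma rotations_at:
  "rotations \<psi> (mk Y 0 0 0 0 0 0) =
    scale_gate L False False * layer level_gate L (\<lambda>v. \<psi> (mk Y v 0 0 0 0 0)) 0 +
    scale_gate L False True * layer level_gate L (\<lambda>v. \<psi> (mk Y v 0 0 0 0 1)) 0"
proof -
  have f: "fold (\<lambda>i. apply1 (level_gate i) (s + i)) [0..<L] \<psi> (mk Y e e' t u w z) =
      layer level_gate L (\<lambda>v. \<psi> (mk Y v e' t u w z)) e" for e e' t u w z
    by (rule fold_apply1_lift) (simp_all only: put_bit_mk bit_mk)
  have "\<not> bit (0::nat) 0" by simp
  then show ?thesis
    unfolding rotations_def apply1_def[of "scale_gate L"] by (simp only: bit_mk put_bit_mk put_bit_0 f)
qed

lemma layer_zero:
  assumes "\<And>v. v < 2 ^ L \<Longrightarrow> f v = 0"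
  shows "layer g L f 0 = 0"
  using layer_point[of L 0 f L 0 g] assms by simp

lemma fold_op_in_ket:
  assumes "\<And>l'. l' \<in> set ls \<Longrightarrow> 1 \<le> l' \<and> l' \<le> L \<and> F_in l' Y e e' t u w z = mk Y e e' t u w z"
    and "ok Y e e' t u w z"
  shows "fold (\<lambda>l. reg_op (F_in l)) ls (ket (mk Y e e' t u w z)) = ket (mk Y e e' t u w z)"
  using assms by (intro fold_trivial) (simp add: reg_op_ket F_in_involution)

text \<open>Columns from \<open>N\<close> on belong to the padding and must vanish.
  \<open>F_out\<close> raises \<open>w\<close>, and no later gate lowers it, because the level
  register stays \<open>0\<close> until the final rotations.\<close>

lemma circuit_outside:
  assumes "N \<le> x" "x < 2 ^ s" "Y < 2 ^ s"
  shows "circuit (ket x) Y = 0"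
proof -
  let ?y = "mk x 0 0 0 0 1 0"
  have o0: "ok x 0 0 0 0 0 0" using assms(2) by (intro okI) simp_all
  have o1: "ok x 0 0 0 0 1 0" using assms(2) by (intro okI) simp_all
  have "F_out x 0 0 0 0 0 0 = ?y" unfolding F_out_def if_P[OF assms(1)] by simp
  then have 1: "reg_op F_out (ket x) = ket ?y"
    using reg_op_ket[OF F_out_involution o0] mk_data[OF assms(2)] by simp
  have 2: "fold (\<lambda>l. reg_op (F_in l)) [1..<Suc L] (ket ?y) = ket ?y"
  proof (rule fold_op_in_ket[OF _ o1])
    fix l assume "l \<in> set [1..<Suc L]"
    then have l: "1 \<le> l" "l \<le> L" by auto
    have "\<not> x < total_dof d l" using assms(1) total_dof_le[OF l(2)] by linarith
    moreover have "(0::nat) \<noteq> 2 ^ (l - 1)" by simp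
    ultimately have "F_in l x 0 0 0 0 1 0 = ?y" unfolding F_in_def by (simp only: simp_thms if_False)
    then show "1 \<le> l \<and> l \<le> L \<and> F_in l x 0 0 0 0 1 0 = ?y" using l by blast
  qed
  have y: "?y < 2 ^ n" by (rule mk_less) simp
  have dim: "dim_op j (ket ?y) = ket ?y" if "j < d" for j
  proof -
    have "F_mark j x 0 0 0 0 1 0 = ?y" unfolding F_mark_def Let_def by (simp only: simp_thms if_False)
    then have "reg_op (F_mark j) (ket ?y) = ket ?y" using reg_op_ket[OF F_mark_involution[OF that] o1] by simp
    moreover have "step j l (ket ?y) = ket ?y" if "l \<in> set [1..<Suc L]" for l
    proof (rule step_trivial[OF _ _ \<open>j < d\<close>])
      show "1 \<le> l" "l \<le> L" using that by auto
      then have "l - 1 < L" by linarith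
      then have "\<not> bit ?y (s + (l - 1))" by (simp only: bit_mk) simp
      then show "ket ?y x = 0" if "bit x (s + (l - 1))" for x using that by (auto simp: ket_def)
      show "supported n (ket ?y)" using y by (auto simp: supported_def ket_def)
    qed
    ultimately show ?thesis unfolding dim_op_def by (simp only: fold_trivial)
  qed
  have "fold dim_op [0..<d] (ket ?y) = ket ?y" by (rule fold_trivial, rule dim) simp
  then have "circuit (ket x) = rotations (ket ?y)" unfolding circuit_def 1 2 by simp
  moreover have "ket ?y (mk Y v 0 0 0 0 z) = 0" if "v < 2 ^ L" "z < 2" for v z
  proof -
    have "ok Y v 0 0 0 0 z" using that assms(3) by (intro okI) simp_all
    from mk_inject[OF this o1] show ?thesis by (simp add: ket_def)
  qed
  ultimately have "circuit (ket x) (mk Y 0 0 0 0 0 0) = 0"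
    by (simp add: rotations_at layer_zero)
  then show ?thesis using mk_data[OF assms(3)] by simp
qed

end

context level_state
begin

text \<open>Exactly one loading map fires: before level \<open>l\<close> the index lies in no
  earlier block, and afterwards \<open>e0\<close> is nonzero and different from the one-hot value of
  every later level.\<close>

lemma circuit_inside:
  assumes x: "total_dof d (l - 1) \<le> x" "x < total_dof d l"
    and digits: "\<And>j. j < d \<Longrightarrow> c j = dig (side l) j (x - total_dof d (l - 1))"
    and Y: "Y < 2 ^ s"
  shows "circuit (ket x) Y = of_real (1 / (real L * 2 ^ l)) * amplitude d Y"
proof -
  let ?T = "total_dof d (l - 1)" and ?m = "side l"
  have m: "0 < ?m" "?m \<le> B" using side_pos[OF l(1)] side_le[OF l(2)] by auto
  have N: "x < N" using x(2) total_dof_le[OF l(2)] by linarith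
  then have xs: "x < 2 ^ s" using N_le by linarith
  let ?Y = "off + conv ?m B d (x - ?T)"
  have Y': "data ?Y \<and> ?Y < 2 ^ s" by (rule data_less[OF conv_less[OF m]])
  have o0: "ok x 0 0 0 0 0 0" using xs by (intro okI) simp_all
  have o1: "ok ?Y e0 0 0 0 0 0" using Y' by (intro ok_active) blast
  have "F_out x 0 0 0 0 0 0 = mk x 0 0 0 0 0 0" unfolding F_out_def using N by simp
  then have 1: "reg_op F_out (ket x) = ket (mk x 0 0 0 0 0 0)"
    using reg_op_ket[OF F_out_involution o0] mk_data[OF xs] by simp
  have "[1..<Suc L] = [1..<l] @ [l..<Suc L]" using upt_add_eq_append[of 1 l "Suc L - l"] l by simp
  moreover have "[l..<Suc L] = [l] @ [Suc l..<Suc L]" using l by (simp add: upt_conv_Cons)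
  ultimately have ls: "[1..<Suc L] = [1..<l] @ [l] @ [Suc l..<Suc L]" by simp
  have 2: "fold (\<lambda>l. reg_op (F_in l)) [1..<l] (ket (mk x 0 0 0 0 0 0)) = ket (mk x 0 0 0 0 0 0)"
  proof (rule fold_op_in_ket[OF _ o0])
    fix l' assume "l' \<in> set [1..<l]"
    then have l': "1 \<le> l'" "l' \<le> L" "l' \<le> l - 1" using l by auto
    have "\<not> x < total_dof d l'" using x(1) total_dof_mono[OF l'(3), of d] by linarith
    moreover have "(0::nat) \<noteq> 2 ^ (l' - 1)" by simp
    ultimately have "F_in l' x 0 0 0 0 0 0 = mk x 0 0 0 0 0 0" unfolding F_in_def by (simp only: simp_thms if_False)
    then show "1 \<le> l' \<and> l' \<le> L \<and> F_in l' x 0 0 0 0 0 0 = mk x 0 0 0 0 0 0" using l' by blast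
  qed
  have "F_in l x 0 0 0 0 0 0 = mk ?Y e0 0 0 0 0 0"
    using x unfolding F_in_def e0_def by (simp only: simp_thms if_True)
  then have 3: "reg_op (F_in l) (ket (mk x 0 0 0 0 0 0)) = ket (mk ?Y e0 0 0 0 0 0)"
    using reg_op_ket[OF F_in_involution[OF l] o0] by simp
  have 4: "fold (\<lambda>l. reg_op (F_in l)) [Suc l..<Suc L] (ket (mk ?Y e0 0 0 0 0 0)) = ket (mk ?Y e0 0 0 0 0 0)"
  proof (rule fold_op_in_ket[OF _ o1])
    fix l' assume "l' \<in> set [Suc l..<Suc L]"
    then have l': "1 \<le> l'" "l' \<le> L" "l - 1 < l' - 1" using l by auto
    have "e0 < 2 ^ (l' - 1)" unfolding e0_def by (rule power_strict_increasing[OF l'(3)]) simp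
    then have "F_in l' ?Y e0 0 0 0 0 0 = mk ?Y e0 0 0 0 0 0"
      unfolding F_in_def by (simp only: e0(2) less_irrefl less_imp_neq simp_thms if_False)
    then show "1 \<le> l' \<and> l' \<le> L \<and> F_in l' ?Y e0 0 0 0 0 0 = mk ?Y e0 0 0 0 0 0" using l' by blast
  qed
  have "invar 0 (ket (mk ?Y e0 0 0 0 0 0))"
    unfolding invar_def
  proof (intro conjI allI impI)
    have "mk ?Y e0 0 0 0 0 0 < 2 ^ n" by (rule mk_less) simp
    then show "supported n (ket (mk ?Y e0 0 0 0 0 0))" by (auto simp: supported_def ket_def)
  next
    fix Z :: nat assume Z: "Z < 2 ^ s"
    have "Z = ?Y \<longleftrightarrow> data Z \<and> (\<forall>j. 0 \<le> j \<and> j < d \<longrightarrow> dig B j (Z - off) = c j)"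
    proof
      assume "Z = ?Y"
      then show "data Z \<and> (\<forall>j. 0 \<le> j \<and> j < d \<longrightarrow> dig B j (Z - off) = c j)"
        using Y' by (simp add: dig_conv[OF m] digits)
    next
      assume a: "data Z \<and> (\<forall>j. 0 \<le> j \<and> j < d \<longrightarrow> dig B j (Z - off) = c j)"
      have "Z - off = conv ?m B d (x - ?T)"
      proof (rule dig_eqI)
        show "Z - off < B ^ d" using a by (intro data_diff) blast
        show "conv ?m B d (x - ?T) < B ^ d" by (rule conv_less[OF m])
        show "dig B j (Z - off) = dig B j (conv ?m B d (x - ?T))" if "j < d" for j
          using a that by (simp add: dig_conv[OF m] digits)
      qed
      moreover have "off \<le> Z" using a by blast
      ultimately show "Z = ?Y" by linarith
    qed
    moreover have "mk Z e0 0 0 0 0 0 = mk ?Y e0 0 0 0 0 0 \<longleftrightarrow> Z = ?Y"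
      using mk_inject[OF ok_active[OF Z] o1] by blast
    ultimately show "ket (mk ?Y e0 0 0 0 0 0) (mk Z e0 0 0 0 0 0) = amplitude 0 Z"
      unfolding ket_def amplitude_def by (simp only: lessThan_0 prod.empty of_bool_def)
  next
    fix Z e e' t u w z
    assume "ok Z e e' t u w z" "ket (mk ?Y e0 0 0 0 0 0) (mk Z e e' t u w z) \<noteq> 0"
    then show "active e e' t u w z \<or> failed 0 Z e e' u"
      using mk_inject[OF _ o1] unfolding ket_def active_def by auto
  qed
  from invar_fold[OF this order_refl]
  have inv: "invar d (fold dim_op [0..<d] (ket (mk ?Y e0 0 0 0 0 0)))" .
  define \<phi> where "\<phi> = fold dim_op [0..<d] (ket (mk ?Y e0 0 0 0 0 0))"
  have "circuit (ket x) = rotations \<phi>"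
    unfolding circuit_def 1 ls \<phi>_def by (simp only: fold_append comp_apply 2 fold.simps 3 4 id_apply)
  \<comment> \<open>Failed branches keep a nonzero \<open>u\<close>, so projecting the ancillas onto
    zero removes them whatever their level registers hold.\<close>
  moreover have z: "\<phi> (mk Y v 0 0 0 0 z) = 0" if "v < 2 ^ L" "z < 2" "\<not> (v = e0 \<and> z = 0)" for v z
  proof -
    have "ok Y v 0 0 0 0 z" using that Y by (intro okI) simp_all
    then show ?thesis using inv that(3) unfolding invar_def \<phi>_def[symmetric] active_def failed_def by blast
  qed
  moreover have "layer level_gate L (\<lambda>v. \<phi> (mk Y v 0 0 0 0 0)) 0 =
      of_real ((1 / 2) ^ (l - 1) / sqrt (rot_norm L)) * amplitude d Y"
  proof -
    have a: "\<forall>i\<ge>L. bit (0::nat) i = bit e0 i" using bit_e0 l by auto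
    have "layer level_gate L (\<lambda>v. \<phi> (mk Y v 0 0 0 0 0)) 0 =
        (\<Prod>i<L. level_gate i (bit (0::nat) i) (bit e0 i)) * \<phi> (mk Y e0 0 0 0 0 0)"
      using layer_point[of L e0 "\<lambda>v. \<phi> (mk Y v 0 0 0 0 0)" L 0 level_gate] z a by simp
    also have "(\<Prod>i<L. level_gate i (bit (0::nat) i) (bit e0 i)) = (\<Prod>i<L. level_gate i False (i = l - 1))"
      by (simp add: bit_e0)
    also have "\<dots> = of_real ((1 / 2) ^ (l - 1) / sqrt (rot_norm L))"
      using l by (intro level_gate_prod) linarith
    finally show ?thesis using inv Y unfolding invar_def \<phi>_def[symmetric] by simp
  qed
  moreover have "layer level_gate L (\<lambda>v. \<phi> (mk Y v 0 0 0 0 1)) 0 = 0"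
    by (rule layer_zero) (simp add: z)
  ultimately have "circuit (ket x) (mk Y 0 0 0 0 0 0) =
      scale_gate L False False * (of_real ((1 / 2) ^ (l - 1) / sqrt (rot_norm L)) * amplitude d Y)"
    by (simp only: rotations_at mult_zero_right add_0_right)
  also have "scale_gate L False False * (of_real ((1 / 2) ^ (l - 1) / sqrt (rot_norm L)) * amplitude d Y) =
      of_real (sqrt (rot_norm L) / (2 * real L) * ((1 / 2) ^ (l - 1) / sqrt (rot_norm L))) * amplitude d Y"
    by (simp only: scale_gate_def Let_def reflection_gate_def simp_thms if_True if_False of_real_mult mult.assoc)
  also have "sqrt (rot_norm L) / (2 * real L) * ((1 / 2) ^ (l - 1) / sqrt (rot_norm L)) = 1 / (real L * 2 ^ l)"
  proof -
    have "(2::real) ^ l = 2 * 2 ^ (l - 1)" using l(1) by (metis One_nat_def Suc_pred less_eq_Suc_le power_Suc)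
    moreover have "sqrt (rot_norm L) \<noteq> 0" using rot_norm_pos[of L] by simp
    ultimately show ?thesis by (simp add: power_one_over field_simps)
  qed
  finally show ?thesis using mk_data[OF Y] by simp
qed

text \<open>Three powers of \<open>rsqrt2\<close> meet a factor \<open>2 ^ (L - l)\<close> from the
  number of coins, so a single power with exponent \<open>L - l\<close> survives.\<close>

lemma entry_eq:
  "entry D m = of_real ((1 / sqrt 2) ^ (L - l) * hat (1 / 2 ^ l) (m + 1) (real (D + 1) / 2 ^ L))"
proof -
  have "of_nat (card {v. v < p \<and> shift_source p v D = m + 1}) =
      complex_of_real (2 ^ (L - l) * hat (1 / 2 ^ l) (m + 1) (real (D + 1) / 2 ^ L))"
    unfolding hat_shift_source[OF l(2), symmetric] by simp
  moreover have "rsqrt2 ^ (L - l) = of_real ((1 / sqrt 2) ^ (L - l))" by (simp add: rsqrt2_def)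
  ultimately have "entry D m = of_real ((1 / sqrt 2) ^ (L - l) * (1 / 2 ^ (L - l)) *
      (2 ^ (L - l) * hat (1 / 2 ^ l) (m + 1) (real (D + 1) / 2 ^ L)))"
    unfolding entry_def rsqrt2_power_even of_real_mult by simp
  then show ?thesis by simp
qed

end

section \<open>Comparison with the matrix of the preconditioner\<close>

context bpx_circuit
begin

lemma ndof_B: "ndof d L = B ^ d"
  by (simp add: ndof_def B_def)

lemma total_dof_blocks:
  assumes "x < N"
  obtains l where "1 \<le> l" "l \<le> L" "total_dof d (l - 1) \<le> x" "x < total_dof d l"
proof -
  define l where "l = (LEAST l. x < total_dof d l)"
  have 1: "x < total_dof d l" unfolding l_def by (rule LeastI[where P = "\<lambda>l. x < total_dof d l", OF assms])
  have 2: "l \<le> L" unfolding l_def by (rule Least_le[where P = "\<lambda>l. x < total_dof d l", OF assms])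
  have "total_dof d 0 = 0" by (simp add: total_dof_def)
  then have 3: "1 \<le> l" using 1 by (cases l) auto
  then have "l - 1 < l" by simp
  then have "\<not> x < total_dof d (l - 1)" using not_less_Least[of "l - 1" "\<lambda>l. x < total_dof d l"] by (simp add: l_def)
  then show ?thesis using that 1 2 3 by simp
qed

lemma embedded_interp_block:
  assumes "1 \<le> l" "l \<le> L" "total_dof d (l - 1) \<le> x" "x < total_dof d l" "1 \<le> l'" "l' \<noteq> l"
  shows "\<not> (total_dof d (l' - 1) \<le> x \<and> x < total_dof d l')"
proof (cases "l' < l")
  case True
  then have "total_dof d l' \<le> total_dof d (l - 1)" by (intro total_dof_mono) simp
  then show ?thesis using assms by simp
next
  case False
  then have "total_dof d l \<le> total_dof d (l' - 1)" using assms by (intro total_dof_mono) simp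
  then show ?thesis using assms by simp
qed

text \<open>Column \<open>x\<close> meets the single block \<open>l\<close>.
  \<open>multi_index\<close> starts at the most significant digit and \<open>dig\<close> at the
  least significant one, which only reverses the order of a product.\<close>

lemma bpx_entry:
  assumes l: "1 \<le> l" "l \<le> L" and x: "total_dof d (l - 1) \<le> x" "x < total_dof d l" and i: "i < B ^ d"
  shows "bpx d L $$ (i, x) = 2 powr (- (real l * (2 - real d) / 2)) *
    (\<Prod>j<d. hat (1 / 2 ^ l) (dig (side l) j (x - total_dof d (l - 1)) + 1) (real (dig B j i + 1) / 2 ^ L))"
proof -
  let ?x = "x - total_dof d (l - 1)"
  have xN: "x < N" using x(2) total_dof_le[OF l(2)] by linarith
  have "bpx d L $$ (i, x) = (\<Sum>l'=1..L. 2 powr (- (real l' * (2 - real d) / 2)) * embedded_interp d l' L $$ (i, x))"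
    using i xN by (simp add: bpx_def ndof_B)
  also have "\<dots> = (\<Sum>l'\<in>{l}. 2 powr (- (real l' * (2 - real d) / 2)) * embedded_interp d l' L $$ (i, x))"
  proof (rule sum.mono_neutral_right)
    show "\<forall>l'\<in>{1..L} - {l}. 2 powr (- (real l' * (2 - real d) / 2)) * embedded_interp d l' L $$ (i, x) = 0"
    proof
      fix l' assume "l' \<in> {1..L} - {l}"
      then have "\<not> (total_dof d (l' - 1) \<le> x \<and> x < total_dof d l')"
        using l x by (intro embedded_interp_block[of l]) auto
      then show "2 powr (- (real l' * (2 - real d) / 2)) * embedded_interp d l' L $$ (i, x) = 0"
        using i xN by (auto simp: embedded_interp_def ndof_B)
    qed
  qed (use l in auto)
  also have "\<dots> = 2 powr (- (real l * (2 - real d) / 2)) * interp_mat d l L $$ (i, ?x)"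
    using i xN x by (simp add: embedded_interp_def ndof_B)
  also have "interp_mat d l L $$ (i, ?x) =
      hat_prod d (1 / 2 ^ l) (multi_index (side l) d ?x) (\<lambda>k. real (multi_index B d i k) / 2 ^ L)"
  proof -
    have "?x < ndof d l" using x total_dof_block[OF l(1)] by (simp add: ndof_def side_def)
    then show ?thesis
      using i by (simp add: interp_mat_eq(1)[OF l(2)] ndof_B side_def B_def)
  qed
  also have "\<dots> = (\<Prod>k<d. hat (1 / 2 ^ l) (dig (side l) (d - Suc k) ?x + 1) (real (dig B (d - Suc k) i + 1) / 2 ^ L))"
    by (simp add: hat_prod_def multi_index_def dig_def)
  also have "\<dots> = (\<Prod>j<d. hat (1 / 2 ^ l) (dig (side l) j ?x + 1) (real (dig B j i + 1) / 2 ^ L))"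
    by (rule prod.nat_diff_reindex)
  finally show ?thesis .
qed

text \<open>In powers of two, \<open>d * L / 2 - l - d * (L - l) / 2\<close> equals
  \<open>-l * (2 - d) / 2\<close>; the dependence on \<open>L\<close> cancels, and so does the
  factor \<open>L\<close>.\<close>

lemma scaling:
  assumes "l \<le> L"
  shows "2 powr (- (real l * (2 - real d) / 2)) =
    real L * 2 powr (real d * real L / 2) * (1 / (real L * 2 ^ l) * ((1 / sqrt 2) ^ (L - l)) ^ d)"
proof -
  have "1 / sqrt 2 = 2 powr (- (1 / 2))" by (simp add: powr_minus powr_half_sqrt field_simps)
  then have "((1 / sqrt 2) ^ (L - l)) ^ d = 2 powr (- (1 / 2) * (real (L - l) * real d))"
    by (simp add: powr_powr flip: powr_realpow power_mult)
  moreover have "1 / 2 ^ l = 2 powr (- real l)" by (simp add: powr_minus powr_realpow field_simps)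
  moreover have "real L * 2 powr a * (1 / (real L * 2 ^ l) * y) = 2 powr a * (1 / 2 ^ l) * y" for a y
    using L by simp
  ultimately have "real L * 2 powr (real d * real L / 2) * (1 / (real L * 2 ^ l) * ((1 / sqrt 2) ^ (L - l)) ^ d) =
      2 powr (real d * real L / 2 + - real l + - (1 / 2) * (real (L - l) * real d))"
    by (simp only: powr_add)
  also have "real d * real L / 2 + - real l + - (1 / 2) * (real (L - l) * real d) = - (real l * (2 - real d) / 2)"
    using assms by (simp add: of_nat_diff field_simps)
  finally show ?thesis ..
qed

theorem circuit_encodes:
  assumes "Y < 2 ^ s" "x < 2 ^ s"
  shows "map_mat complex_of_real (zero_pad (2 ^ s) (bpx_square d L)) $$ (Y, x) =
    complex_of_real (real L * 2 powr (real d * real L / 2)) * circuit (ket x) Y"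
proof -
  have pad: "map_mat complex_of_real (zero_pad (2 ^ s) (bpx_square d L)) $$ (Y, x) =
      (if data Y \<and> x < N then complex_of_real (bpx d L $$ (Y - off, x)) else 0)"
    using assms off by (auto simp: zero_pad_def bpx_square_def ndof_B off_def)
  show ?thesis
  proof (cases "x < N")
    case False
    then have "circuit (ket x) Y = 0" using assms by (intro circuit_outside) simp_all
    then show ?thesis using pad False by simp
  next
    case True
    then obtain l where l: "1 \<le> l" "l \<le> L" and x: "total_dof d (l - 1) \<le> x" "x < total_dof d l"
      using total_dof_blocks by blast
    define c where "c j = dig (side l) j (x - total_dof d (l - 1))" for j
    interpret level_state d L l c
      by unfold_locales (use l side_pos[OF l(1)] in \<open>simp_all add: c_def dig_less\<close>)
    have circ: "circuit (ket x) Y = of_real (1 / (real L * 2 ^ l)) * amplitude d Y"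
      by (rule circuit_inside[OF x _ assms(1)]) (simp add: c_def)
    show ?thesis
    proof (cases "data Y")
      case False
      then have "amplitude d Y = 0" unfolding amplitude_def by (simp only: simp_thms if_False)
      then show ?thesis using circ False unfolding pad by (simp only: simp_thms if_False mult_zero_right)
    next
      case True
      let ?h = "\<lambda>j. hat (1 / 2 ^ l) (c j + 1) (real (dig B j (Y - off) + 1) / 2 ^ L)"
      have "amplitude d Y = (\<Prod>j<d. entry (dig B j (Y - off)) (c j))"
        unfolding amplitude_def using True by simp
      also have "\<dots> = of_real (\<Prod>j<d. (1 / sqrt 2) ^ (L - l) * ?h j)"
        unfolding of_real_prod entry_eq ..
      also have "(\<Prod>j<d. (1 / sqrt 2) ^ (L - l) * ?h j) = ((1 / sqrt 2) ^ (L - l)) ^ d * (\<Prod>j<d. ?h j)"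
        by (simp only: prod.distrib prod_constant card_lessThan)
      finally have amp: "amplitude d Y = of_real (((1 / sqrt 2) ^ (L - l)) ^ d * (\<Prod>j<d. ?h j))" .
      have "bpx d L $$ (Y - off, x) = 2 powr (- (real l * (2 - real d) / 2)) * (\<Prod>j<d. ?h j)"
        unfolding c_def by (rule bpx_entry[OF l x data_diff[OF True]])
      also have "\<dots> = real L * 2 powr (real d * real L / 2) *
          (1 / (real L * 2 ^ l) * (((1 / sqrt 2) ^ (L - l)) ^ d * (\<Prod>j<d. ?h j)))"
        unfolding scaling[OF l(2)] by (simp only: mult.assoc)
      finally show ?thesis
        using True \<open>x < N\<close> pad unfolding circ amp of_real_mult[symmetric] by simp
    qed
  qed
qed

section \<open>Gate and ancilla counts\<close>

lemma impl_op:
  assumes "involutive F" "MAP (app F) k" "k * unit_cost + n \<le> a" "k \<le> k'"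
  shows "impl n a (40 * (k' * unit_cost) + 25 * n) (reg_op F)"
proof -
  have "impl n a (40 * (k * unit_cost) + 25 * n) (reg_op F)"
    unfolding reg_op_def
    by (rule impl_involution) (use assms app_involution[OF assms(1)] in \<open>auto simp: MAP_def\<close>)
  moreover have "k * unit_cost \<le> k' * unit_cost" using assms(4) by (rule mult_le_mono1)
  ultimately show ?thesis by (elim impl_weaken) linarith
qed

definition max_cost :: nat where "max_cost = 22 * d + 400"

definition op_cost :: nat where "op_cost = 40 * (max_cost * unit_cost) + 25 * n"

lemma impl_ops:
  assumes a: "max_cost * unit_cost + n \<le> a"
  shows "impl n a op_cost (reg_op F_out)"
    and "1 \<le> l \<Longrightarrow> l \<le> L \<Longrightarrow> impl n a op_cost (reg_op (F_in l))"
    and "j < d \<Longrightarrow> impl n a op_cost (reg_op (F_mark j))"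
    and "j < d \<Longrightarrow> 1 \<le> l \<Longrightarrow> l \<le> L \<Longrightarrow> impl n a op_cost (reg_op (F_shift j l))"
proof -
  have *: "impl n a op_cost (reg_op F)" if "involutive F" "MAP (app F) k" "k \<le> max_cost" for F k
    unfolding op_cost_def
    by (rule impl_op[OF that(1) MAP_weaken[OF that(2,3)] a order_refl])
  show "impl n a op_cost (reg_op F_out)"
    by (rule *[OF F_out_involution MAP_F_out]) (simp add: max_cost_def)
  show "impl n a op_cost (reg_op (F_in l))" if "1 \<le> l" "l \<le> L"
    by (rule *[OF F_in_involution[OF that] MAP_F_in[OF that]]) (simp add: max_cost_def)
  show "impl n a op_cost (reg_op (F_mark j))" if "j < d"
    by (rule *[OF F_mark_involution[OF that] MAP_F_mark[OF that]]) (simp add: max_cost_def)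
  show "impl n a op_cost (reg_op (F_shift j l))" if "j < d" "1 \<le> l" "l \<le> L"
    by (rule *[OF F_shift_involution[OF that] MAP_F_shift[OF that]]) (simp add: max_cost_def)
qed

definition circuit_cost :: nat where
  "circuit_cost = op_cost + L * op_cost + d * (op_cost + L * (3 * L + 1 + op_cost)) + L + 1"

lemma impl_circuit:
  assumes a: "max_cost * unit_cost + n \<le> a"
  shows "impl n a circuit_cost circuit"
proof -
  note ops = impl_ops[OF a]
  have pos: "s + i < n" "s + 2 * L + i < n" "s + 3 * L + i < n" "s + 4 * L < n" "s + 4 * L + 1 < n"
    if "i < L" for i using that by (simp_all add: n_def)
  have had: "impl n a L (fold (\<lambda>i. applyc H_gate (s + (l - 1)) (s + k * L + i)) [0..<L - l])"
    if "1 \<le> l" "l \<le> L" "1 \<le> k" "k \<le> 3" for l k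
  proof -
    have kL: "L * 1 \<le> k * L" "k * L \<le> 3 * L" using that(3,4) by simp_all
    have "impl n a 1 (applyc H_gate (s + (l - 1)) (s + k * L + i))" if "i < L - l" for i
    proof (rule impl_applyc[OF _ _ _ unitary_H])
      show "s + k * L + i < n" using that kL unfolding n_def by linarith
      show "s + (l - 1) < n" using \<open>l \<le> L\<close> \<open>1 \<le> l\<close> by (intro pos) linarith
      show "s + (l - 1) \<noteq> s + k * L + i" using kL(1) \<open>l \<le> L\<close> \<open>1 \<le> l\<close> by linarith
    qed
    then have "impl n a (length [0..<L - l] * 1) (fold (\<lambda>i. applyc H_gate (s + (l - 1)) (s + k * L + i)) [0..<L - l])"
      by (intro impl_fold) simp
    then show ?thesis by (rule impl_weaken) simp
  qed
  have step: "impl n a (3 * L + 1 + op_cost) (step j l)" if "j < d" "1 \<le> l" "l \<le> L" for j l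
  proof -
    have "l - 1 < L" using that by linarith
    have t: "impl n a 1 (toggle_w l)"
      by (rule impl_applyc[OF pos(4) pos(1) _ unitary_X]) (use L \<open>l - 1 < L\<close> in auto)
    have "impl n a ((((L + L) + op_cost) + 1) + L) (\<lambda>\<psi>. hadamard_u l (toggle_w l (reg_op (F_shift j l) (hadamard_u l (hadamard_t l \<psi>)))))"
      using impl_compose[OF impl_compose[OF impl_compose[OF impl_compose[OF had[of l 2] had[of l 3]] ops(4)[OF that]] t] had[of l 3]] that
      by simp
    then show ?thesis unfolding step_def[abs_def] by (rule impl_weaken) simp
  qed
  have dim: "impl n a (op_cost + L * (3 * L + 1 + op_cost)) (dim_op j)" if "j < d" for j
  proof -
    have "impl n a (length [1..<Suc L] * (3 * L + 1 + op_cost)) (fold (step j) [1..<Suc L])"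
      using that by (intro impl_fold step) auto
    then have "impl n a (L * (3 * L + 1 + op_cost)) (fold (step j) [1..<Suc L])"
      unfolding length_upt diff_Suc_1 .
    from impl_compose[OF ops(3)[OF that] this] show ?thesis unfolding dim_op_def[abs_def] .
  qed
  have "impl n a (length [0..<d] * (op_cost + L * (3 * L + 1 + op_cost))) (fold dim_op [0..<d])"
    by (intro impl_fold dim) simp
  then have dims: "impl n a (d * (op_cost + L * (3 * L + 1 + op_cost))) (fold dim_op [0..<d])" by simp
  have "impl n a (length [1..<Suc L] * op_cost) (fold (\<lambda>l. reg_op (F_in l)) [1..<Suc L])"
    by (intro impl_fold ops(2)) auto
  then have ins: "impl n a (L * op_cost) (fold (\<lambda>l. reg_op (F_in l)) [1..<Suc L])"
    unfolding length_upt diff_Suc_1 .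
  have "impl n a (length [0..<L] * 1) (fold (\<lambda>i. apply1 (level_gate i) (s + i)) [0..<L])"
    by (intro impl_fold impl_apply1 unitary_level_gate pos) simp
  then have rots: "impl n a L (fold (\<lambda>i. apply1 (level_gate i) (s + i)) [0..<L])" by simp
  have "impl n a 1 (apply1 (scale_gate L) (s + 4 * L + 1))"
    using L by (intro impl_apply1 unitary_scale_gate pos[of 0]) simp_all
  from impl_compose[OF impl_compose[OF impl_compose[OF impl_compose[OF ops(1) ins] dims] rots] this]
  show ?thesis unfolding circuit_def[abs_def] rotations_def circuit_cost_def .
qed

text \<open>There are \<open>L\<close> blocks of size at most \<open>2 ^ (d * L)\<close>, and
  \<open>L\<close> is below \<open>2 ^ L\<close>.\<close>

lemma s_le: "s \<le> d * L + L"
proof -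
  have "N \<le> (\<Sum>l=1..L. 2 ^ (d * L))"
    unfolding total_dof_def
  proof (rule sum_mono)
    fix l assume "l \<in> {1..L}"
    then have "(2::nat) ^ l \<le> 2 ^ L" by (intro power_increasing) simp_all
    then have "(2::nat) ^ l - 1 \<le> 2 ^ L" by linarith
    then have "(2 ^ l - 1) ^ d \<le> ((2::nat) ^ L) ^ d" by (rule power_mono) simp
    then show "ndof d l \<le> 2 ^ (d * L)" by (simp add: ndof_def mult.commute flip: power_mult)
  qed
  also have "\<dots> = L * 2 ^ (d * L)" by simp
  also have "\<dots> \<le> 2 ^ L * 2 ^ (d * L)" using less_exp[of L] by (intro mult_right_mono) simp_all
  finally have "N \<le> 2 ^ (d * L + L)" by (simp add: power_add mult.commute)
  then show ?thesis unfolding num_qubits_def by (rule Least_le)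
qed

end

theorem theorem10:
  shows "\<exists>pq pg pa :: nat poly. \<forall>d L :: nat. d \<ge> 1 \<longrightarrow> L \<ge> 1 \<longrightarrow>
    (let s = num_qubits (total_dof d L) in
     \<exists>(q :: nat) (a :: nat) (U :: complex mat) (Ms :: complex mat list).
       block_encoding s (real L * 2 powr (real d * real L / 2)) q 0 U
         (map_mat complex_of_real (zero_pad (2 ^ s) (bpx_square d L))) \<and>
       q \<le> poly pq L \<and>
       implements (q + s) a Ms U \<and>
       length Ms \<le> poly pg (d * L) \<and>
       q + a \<le> poly pa (d * L))"
proof -
  \<comment> \<open>The polynomials arise by substituting \<open>d * L\<close> for each of
    \<open>d\<close> and \<open>L\<close> and \<open>2 * (d * L)\<close> for \<open>s\<close>;
    positivity of \<open>d\<close> and \<open>L\<close> makes both at most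
    \<open>d * L\<close>.\<close>
  define pM :: "nat poly" where "pM = [:3, 4:]"
  define pn :: "nat poly" where "pn = [:2, 6:]"
  define pc :: "nat poly" where "pc = [:400, 22:] * ([:1000:] * (pM * pM))"
  define po :: "nat poly" where "po = [:40:] * pc + [:25:] * pn"
  define z :: "nat poly" where "z = [:0, 1:]"
  define pg where "pg = po + z * po + z * (po + z * (3 * z + 1 + po)) + z + 1"
  define pa where "pa = [:2, 4:] + (pc + pn)"
  have main: "let s = num_qubits (total_dof d L) in
     \<exists>q a U Ms.
       block_encoding s (real L * 2 powr (real d * real L / 2)) q 0 U
         (map_mat complex_of_real (zero_pad (2 ^ s) (bpx_square d L))) \<and>
       q \<le> poly [:2, 4:] L \<and>
       implements (q + s) a Ms U \<and>
       length Ms \<le> poly pg (d * L) \<and>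
       q + a \<le> poly pa (d * L)" if dL: "d \<ge> 1" "L \<ge> 1" for d L :: nat
  proof -
    interpret bpx_circuit d L using dL by unfold_locales
    have le: "d \<le> d * L" "L \<le> d * L" using dL by simp_all
    have s: "s \<le> 2 * (d * L)" using s_le le(2) by linarith
    have n: "n \<le> poly pn (d * L)" "n = (4 * L + 2) + s"
    proof -
      show n: "n = (4 * L + 2) + s" by (simp add: n_def)
      have "poly pn (d * L) = 2 + 6 * (d * L)" by (simp add: pn_def)
      then show "n \<le> poly pn (d * L)" using s le(2) unfolding n by linarith
    qed
    have M: "M \<le> poly pM (d * L)"
    proof -
      have "poly pM (d * L) = 3 + 4 * (d * L)" by (simp add: pM_def)
      then show ?thesis using s le(2) unfolding M_def by linarith
    qed
    have c: "max_cost * unit_cost \<le> poly pc (d * L)"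
      unfolding pc_def poly_mult max_cost_def unit_cost_def
      by (intro mult_le_mono M) (use le in simp_all)
    have o: "op_cost \<le> poly po (d * L)"
      unfolding po_def poly_add poly_mult op_cost_def by (intro add_le_mono mult_le_mono c n(1)) simp_all
    have z: "poly z (d * L) = d * L" by (simp add: z_def)
    have cost: "circuit_cost \<le> poly pg (d * L)"
      unfolding pg_def poly_add poly_mult circuit_cost_def z
      by (intro add_le_mono mult_le_mono o le) (simp_all add: z)
    define a where "a = max_cost * unit_cost + n"
    have "impl n a circuit_cost circuit" by (rule impl_circuit) (simp add: a_def)
    then obtain Ms where Ms: "length Ms \<le> circuit_cost"
      "implements n a Ms (mat (2 ^ n) (2 ^ n) (\<lambda>(i, j). circuit (ket j) i))"
      "unitary_mat (2 ^ n) (mat (2 ^ n) (2 ^ n) (\<lambda>(i, j). circuit (ket j) i))"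
      by (rule impl_implements)
    let ?U = "mat (2 ^ n) (2 ^ n) (\<lambda>(i, j). circuit (ket j) i)"
    have "block_encoding s (real L * 2 powr (real d * real L / 2)) (4 * L + 2) 0 ?U
        (map_mat complex_of_real (zero_pad (2 ^ s) (bpx_square d L)))"
    proof (rule block_encodingI)
      show "unitary_mat (2 ^ (4 * L + 2 + s)) ?U" using Ms(3) unfolding n(2)[symmetric] .
      fix i j :: nat assume ij: "i < 2 ^ s" "j < 2 ^ s"
      have "(2::nat) ^ s \<le> 2 ^ n" unfolding n(2) by (rule power_increasing) simp_all
      then have "i < 2 ^ n" "j < 2 ^ n" using ij by linarith+
      then have "?U $$ (i, j) = circuit (ket j) i" by simp
      then show "map_mat complex_of_real (zero_pad (2 ^ s) (bpx_square d L)) $$ (i, j) =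
          complex_of_real (real L * 2 powr (real d * real L / 2)) * ?U $$ (i, j)"
        using circuit_encodes[OF ij] by simp
    qed (simp add: zero_pad_def)
    \<comment> \<open>Four registers \<open>e\<close>, \<open>e'\<close>, \<open>t\<close>,
      \<open>u\<close> of \<open>L\<close> qubits each and the qubits \<open>w\<close> and
      \<open>z\<close>: the count is free of \<open>d\<close>.\<close>
    moreover have "4 * L + 2 \<le> poly [:2, 4:] L" by simp
    moreover have "implements ((4 * L + 2) + s) a Ms ?U" using Ms(2) unfolding n(2)[symmetric] .
    moreover have "length Ms \<le> poly pg (d * L)" using Ms(1) cost by linarith
    moreover have "4 * L + 2 + a \<le> poly pa (d * L)"
    proof -
      have "4 * L + 2 \<le> poly [:2, 4:] (d * L)" using le(2) by simp
      then show ?thesis unfolding pa_def poly_add a_def by (intro add_le_mono c n(1))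
    qed
    ultimately show ?thesis unfolding Let_def by blast
  qed
  show ?thesis
    by (rule exI[of _ "[:2, 4:]"], rule exI[of _ pg], rule exI[of _ pa]) (use main in blast)
qed

end
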